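(* Let $G$, $a>0$, $\rho_a$, $B$ and the vector field $Z$ be as in the context. Then $$\mathcal D(B)=\{f\in\mathcal H\cap L^2(\rho_a): Zf\in L^2(\rho_a)\}$$ and $Bf=\frac{2}{a}Zf$ for all $f\in\mathcal D(B)$.
   Context: Let $\mathfrak g$ be a finite-dimensional complex Lie algebra which is stratified of step $m$: $\mathfrak g=V_1\oplus\cdots\oplus V_m$ (complex subspaces) with $[V_1,V_j]=V_{j+1}$ for $1\le j<m$, $[V_1,V_m]=0$, $V_m\neq 0$. Let $G$ be the connected, simply connected complex Lie group with Lie algebra $\mathfrak g$, identified with $\mathfrak g$ as a set (exponential map = identity, identity $e=0$), with Haar measure $m$ = a Lebesgue measure on $\mathfrak g$. For $\xi\in\mathfrak g$, $\tilde\xi$ is the left-invariant vector field with $\tilde\xi(e)=\xi$. Dilations: $\delta_\lambda(v_1+\cdots+v_m)=\sum_k\lambda^kv_k$ ($v_k\in V_k$, $\lambda\in\mathbb C$). Real vector fields $X,Y$: $(Xf)(z)=\frac{d}{ds}\big|_{s=0}f(\delta_{e^s}z)$, $(Yf)(z)=\frac{d}{d\theta}\big|_{\theta=0}f(\delta_{e^{i\theta}}z)$; complex vector field $Z=\frac12(X-iY)$. Let $J$ be the complex structure of $\mathfrak g$ and $h$ a symmetric positive semidefinite real bilinear form on the real dual $\mathfrak g^*$ with $h(J^*\alpha,J^*\beta)=h(\alpha,\beta)$ whose horizontal space $\{v:\alpha(v)=0\text{ whenever }h(\alpha,\alpha)=0\}$ equals $V_1$; it induces a positive definite $J$-Hermitian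 inner product $g$ on $V_1$. Choose $x_1,\dots,x_k\in V_1$ with $x_1,Jx_1,\dots,x_k,Jx_k$ a $g$-orthonormal real basis of $V_1$; $X_j=\widetilde{x_j}$, $Y_j=\widetilde{Jx_j}$; $\Delta=\sum_j(X_j^2+Y_j^2)$; heat kernel $\rho_s$: smooth positive probability density with $e^{s\Delta/4}f(x)=\int_G f(xy^{-1})\rho_s(y)\,dm(y)$. Fix $a>0$; $L^2(\rho_a)=L^2(G,\rho_a\,dm)$. $Q$ is the closure in $L^2(\rho_a)$ of $Q_0(f_1,f_2)=\int_G\sum_j(X_jf_1\,X_j\bar f_2+Y_jf_1\,Y_j\bar f_2)\rho_a\,dm$ on $C_c^\infty(G)$. $\mathcal H$ = holomorphic functions on $G$. $B$ is the self-adjoint operator on the Hilbert space $\mathcal H\cap L^2(\rho_a)$ associated with the closed form $Q$ restricted to $\mathcal D(Q)\cap\mathcal H$, with domain $\mathcal D(B)$. *)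

theory Defs
  imports "HOL-Analysis.Analysis"
begin

text \<open>The Lie algebra g is modelled as the complex vector space complex^'n
  (an arbitrary finite-dimensional complex vector space); complex scalars act by
  the operation (*s), the complex structure is J v = i *s v.  The group G is g
  itself with a multiplication mul; identity 0, inverse of y is -y (exp = id).\<close>

fun Ck :: "nat \<Rightarrow> ('a::real_normed_vector \<Rightarrow> 'b::real_normed_vector) \<Rightarrow> bool" where
  "Ck 0 f = continuous_on UNIV f"
| "Ck (Suc j) f = ((\<forall>z. f differentiable (at z)) \<and>
                    (\<forall>v. Ck j (\<lambda>z. frechet_derivative f (at z) v)))"

definition smooth :: "('a::real_normed_vector \<Rightarrow> 'b::real_normed_vector) \<Rightarrow> bool" where
  "smooth f \<longleftrightarrow> (\<forall>j. Ck j f)"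

definition Cc_inf :: "(complex^'n \<Rightarrow> complex) \<Rightarrow> bool" where
  "Cc_inf f \<longleftrightarrow> smooth f \<and> compact (closure {z. f z \<noteq> 0})"

definition holo :: "(complex^'n \<Rightarrow> complex) \<Rightarrow> bool" where
  "holo f \<longleftrightarrow> (\<forall>z. \<exists>D. (f has_derivative D) (at z) \<and> (\<forall>c v. D (c *s v) = c * D v))"

definition lie_algebra :: "(complex^'n \<Rightarrow> complex^'n \<Rightarrow> complex^'n) \<Rightarrow> bool" where
  "lie_algebra br \<longleftrightarrow>
     (\<forall>x y z. br (x + y) z = br x z + br y z) \<and>
     (\<forall>c x y. br (c *s x) y = c *s br x y) \<and>
     (\<forall>x y. br x y = - br y x) \<and>
     (\<forall>x y z. br x (br y z) + br y (br z x) + br z (br x y) = 0)"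

definition csubspace :: "(complex^'n) set \<Rightarrow> bool" where
  "csubspace S \<longleftrightarrow> subspace S \<and> (\<forall>v\<in>S. \<i> *s v \<in> S)"

definition stratified ::
  "(complex^'n \<Rightarrow> complex^'n \<Rightarrow> complex^'n) \<Rightarrow> (nat \<Rightarrow> (complex^'n) set) \<Rightarrow> nat \<Rightarrow> bool" where
  "stratified br V m \<longleftrightarrow> m \<ge> 1 \<and>
     (\<forall>j\<in>{1..m}. csubspace (V j)) \<and>
     (\<forall>z. \<exists>!v. (\<forall>j\<in>{1..m}. v j \<in> V j) \<and> (\<forall>j. j \<notin> {1..m} \<longrightarrow> v j = 0) \<and>
              z = (\<Sum>j=1..m. v j)) \<and>
     (\<forall>j. 1 \<le> j \<and> j < m \<longrightarrow> V (Suc j) = span {br u w | u w. u \<in> V 1 \<and> w \<in> V j}) \<and>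
     (\<forall>u\<in>V 1. \<forall>w\<in>V m. br u w = 0) \<and>
     V m \<noteq> {0}"

definition dil :: "(nat \<Rightarrow> (complex^'n) set) \<Rightarrow> nat \<Rightarrow> complex \<Rightarrow> complex^'n \<Rightarrow> complex^'n" where
  "dil V m lam z = (THE w. \<exists>v. (\<forall>j\<in>{1..m}. v j \<in> V j) \<and> z = (\<Sum>j=1..m. v j) \<and>
                              w = (\<Sum>j=1..m. (lam ^ j) *s v j))"

definition lvf :: "(complex^'n \<Rightarrow> complex^'n \<Rightarrow> complex^'n) \<Rightarrow> complex^'n \<Rightarrow>
                   (complex^'n \<Rightarrow> complex) \<Rightarrow> complex^'n \<Rightarrow> complex" where
  "lvf mul xi f z = vector_derivative (\<lambda>t::real. f (mul z (t *\<^sub>R xi))) (at 0)"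

definition Xrad :: "(nat \<Rightarrow> (complex^'n) set) \<Rightarrow> nat \<Rightarrow> (complex^'n \<Rightarrow> complex) \<Rightarrow> complex^'n \<Rightarrow> complex" where
  "Xrad V m f z = vector_derivative (\<lambda>s::real. f (dil V m (exp (complex_of_real s)) z)) (at 0)"

definition Yrot :: "(nat \<Rightarrow> (complex^'n) set) \<Rightarrow> nat \<Rightarrow> (complex^'n \<Rightarrow> complex) \<Rightarrow> complex^'n \<Rightarrow> complex" where
  "Yrot V m f z = vector_derivative (\<lambda>\<theta>::real. f (dil V m (exp (\<i> * complex_of_real \<theta>)) z)) (at 0)"

definition Zop :: "(nat \<Rightarrow> (complex^'n) set) \<Rightarrow> nat \<Rightarrow> (complex^'n \<Rightarrow> complex) \<Rightarrow> complex^'n \<Rightarrow> complex" where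
  "Zop V m f z = (Xrad V m f z - \<i> * Yrot V m f z) / 2"

text \<open>G = g as a set with multiplication mul: a (smooth) Lie group with identity 0,
  whose exponential map is the identity (t \<mapsto> t x are the one-parameter subgroups)
  and whose Lie algebra (left-invariant vector fields) is (g, br).  This determines
  mul uniquely (Baker-Campbell-Hausdorff).\<close>
definition lie_group_exp_id ::
  "(complex^'n \<Rightarrow> complex^'n \<Rightarrow> complex^'n) \<Rightarrow> (complex^'n \<Rightarrow> complex^'n \<Rightarrow> complex^'n) \<Rightarrow> bool" where
  "lie_group_exp_id br mul \<longleftrightarrow>
     (\<forall>x y z. mul (mul x y) z = mul x (mul y z)) \<and>
     (\<forall>x. mul 0 x = x \<and> mul x 0 = x \<and> mul x (- x) = 0 \<and> mul (- x) x = 0) \<and>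
     smooth (\<lambda>p::(complex^'n) \<times> (complex^'n). mul (fst p) (snd p)) \<and>
     (\<forall>x (s::real) (t::real). mul (s *\<^sub>R x) (t *\<^sub>R x) = (s + t) *\<^sub>R x) \<and>
     (\<forall>xi eta f. smooth f \<longrightarrow>
        (\<lambda>z. lvf mul xi (lvf mul eta f) z - lvf mul eta (lvf mul xi f) z) = lvf mul (br xi eta) f)"

text \<open>x_1..x_k (indexed 0..k-1) with x_j, J x_j a real basis of V 1 (orthonormal
  for the J-Hermitian inner product g induced by h).\<close>
definition horiz_basis :: "(nat \<Rightarrow> (complex^'n) set) \<Rightarrow> (nat \<Rightarrow> complex^'n) \<Rightarrow> nat \<Rightarrow> bool" where
  "horiz_basis V x k \<longleftrightarrow>
     (let S = x ` {..<k} \<union> (\<lambda>j. \<i> *s x j) ` {..<k} in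
        independent S \<and> card S = 2 * k \<and> span S = V 1)"

definition subLap :: "(complex^'n \<Rightarrow> complex^'n \<Rightarrow> complex^'n) \<Rightarrow> (nat \<Rightarrow> complex^'n) \<Rightarrow> nat \<Rightarrow>
                      (complex^'n \<Rightarrow> complex) \<Rightarrow> complex^'n \<Rightarrow> complex" where
  "subLap mul x k f z = (\<Sum>j<k. lvf mul (x j) (lvf mul (x j) f) z +
                                 lvf mul (\<i> *s x j) (lvf mul (\<i> *s x j) f) z)"

text \<open>Heat kernel rho_s (s > 0): smooth positive probability densities w.r.t.
  Lebesgue (= Haar) measure such that u(s,z) = int f(z y^{-1}) rho_s(y) dm(y)
  solves the heat equation du/ds = Delta u / 4 with u(s,.) \<rightarrow> f uniformly as
  s \<rightarrow> 0+, for every f in C_c^infinity; i.e. u(s,.) = e^{s Delta/4} f.\<close>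
definition heat_kernel :: "(complex^'n \<Rightarrow> complex^'n \<Rightarrow> complex^'n) \<Rightarrow> (nat \<Rightarrow> complex^'n) \<Rightarrow> nat \<Rightarrow>
                           (real \<Rightarrow> complex^'n \<Rightarrow> real) \<Rightarrow> bool" where
  "heat_kernel mul x k rho \<longleftrightarrow>
     (\<forall>s>0. (\<forall>y. rho s y > 0) \<and> smooth (rho s) \<and> integrable lborel (rho s) \<and>
            integral\<^sup>L lborel (rho s) = 1) \<and>
     (\<forall>f. Cc_inf f \<longrightarrow>
        (let u = (\<lambda>s z. integral\<^sup>L lborel (\<lambda>y. f (mul z (- y)) * complex_of_real (rho s y))) in
          (\<forall>s>0. \<forall>z. ((\<lambda>t. u t z) has_vector_derivative (subLap mul x k (u s) z / 4)) (at s)) \<and>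
          uniform_limit UNIV u f (at_right 0)))"

definition L2 :: "(complex^'n \<Rightarrow> real) \<Rightarrow> (complex^'n \<Rightarrow> complex) \<Rightarrow> bool" where
  "L2 r f \<longleftrightarrow> f \<in> borel_measurable lborel \<and> integrable lborel (\<lambda>z. (cmod (f z))\<^sup>2 * r z)"

definition ipL2 :: "(complex^'n \<Rightarrow> real) \<Rightarrow> (complex^'n \<Rightarrow> complex) \<Rightarrow> (complex^'n \<Rightarrow> complex) \<Rightarrow> complex" where
  "ipL2 r f g = integral\<^sup>L lborel (\<lambda>z. f z * cnj (g z) * complex_of_real (r z))"

definition normL2 :: "(complex^'n \<Rightarrow> real) \<Rightarrow> (complex^'n \<Rightarrow> complex) \<Rightarrow> real" where
  "normL2 r f = sqrt (integral\<^sup>L lborel (\<lambda>z. (cmod (f z))\<^sup>2 * r z))"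

definition Q0 :: "(complex^'n \<Rightarrow> complex^'n \<Rightarrow> complex^'n) \<Rightarrow> (nat \<Rightarrow> complex^'n) \<Rightarrow> nat \<Rightarrow>
                  (complex^'n \<Rightarrow> real) \<Rightarrow> (complex^'n \<Rightarrow> complex) \<Rightarrow> (complex^'n \<Rightarrow> complex) \<Rightarrow> complex" where
  "Q0 mul x k r f1 f2 = integral\<^sup>L lborel (\<lambda>z.
      (\<Sum>j<k. lvf mul (x j) f1 z * cnj (lvf mul (x j) f2 z) +
              lvf mul (\<i> *s x j) f1 z * cnj (lvf mul (\<i> *s x j) f2 z)) * complex_of_real (r z))"

text \<open>fs is a sequence in C_c^infinity approximating f in the form norm
  (L^2-convergent to f and Q_0-Cauchy): closure of Q_0.\<close>
definition Qapprox :: "(complex^'n \<Rightarrow> complex^'n \<Rightarrow> complex^'n) \<Rightarrow> (nat \<Rightarrow> complex^'n) \<Rightarrow> nat \<Rightarrow>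
                  (complex^'n \<Rightarrow> real) \<Rightarrow> (complex^'n \<Rightarrow> complex) \<Rightarrow> (nat \<Rightarrow> complex^'n \<Rightarrow> complex) \<Rightarrow> bool" where
  "Qapprox mul x k r f fs \<longleftrightarrow>
     (\<forall>n. Cc_inf (fs n)) \<and> (\<lambda>n. normL2 r (\<lambda>z. fs n z - f z)) \<longlonglongrightarrow> 0 \<and>
     (\<forall>e>0. \<exists>N. \<forall>n\<ge>N. \<forall>p\<ge>N.
        cmod (Q0 mul x k r (\<lambda>z. fs n z - fs p z) (\<lambda>z. fs n z - fs p z)) < e)"

definition domQ :: "(complex^'n \<Rightarrow> complex^'n \<Rightarrow> complex^'n) \<Rightarrow> (nat \<Rightarrow> complex^'n) \<Rightarrow> nat \<Rightarrow>
                  (complex^'n \<Rightarrow> real) \<Rightarrow> (complex^'n \<Rightarrow> complex) set" where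
  "domQ mul x k r = {f. L2 r f \<and> (\<exists>fs. Qapprox mul x k r f fs)}"

definition Qval :: "(complex^'n \<Rightarrow> complex^'n \<Rightarrow> complex^'n) \<Rightarrow> (nat \<Rightarrow> complex^'n) \<Rightarrow> nat \<Rightarrow>
                  (complex^'n \<Rightarrow> real) \<Rightarrow> (complex^'n \<Rightarrow> complex) \<Rightarrow> (complex^'n \<Rightarrow> complex) \<Rightarrow> complex \<Rightarrow> bool" where
  "Qval mul x k r f g q \<longleftrightarrow>
     (\<forall>fs gs. Qapprox mul x k r f fs \<and> Qapprox mul x k r g gs \<longrightarrow>
        (\<lambda>n. Q0 mul x k r (fs n) (gs n)) \<longlonglongrightarrow> q)"

definition HL2 :: "(complex^'n \<Rightarrow> real) \<Rightarrow> (complex^'n \<Rightarrow> complex) set" where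
  "HL2 r = {f. holo f \<and> L2 r f}"

text \<open>Operator B associated with the closed form Q restricted to D(Q) \<inter> H on the
  Hilbert space H \<inter> L^2(rho):  u \<in> D(B) iff u \<in> D(Q) \<inter> H and there is w \<in> H \<inter> L^2
  with Q(u,v) = <w,v> for all v \<in> D(Q) \<inter> H; then B u = w.\<close>
definition Brel :: "(complex^'n \<Rightarrow> complex^'n \<Rightarrow> complex^'n) \<Rightarrow> (nat \<Rightarrow> complex^'n) \<Rightarrow> nat \<Rightarrow>
                  (complex^'n \<Rightarrow> real) \<Rightarrow> (complex^'n \<Rightarrow> complex) \<Rightarrow> (complex^'n \<Rightarrow> complex) \<Rightarrow> bool" where
  "Brel mul x k r u w \<longleftrightarrow> u \<in> domQ mul x k r \<inter> HL2 r \<and> w \<in> HL2 r \<and>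
     (\<forall>v \<in> domQ mul x k r \<inter> HL2 r. Qval mul x k r u v (ipL2 r w v))"

definition domB :: "(complex^'n \<Rightarrow> complex^'n \<Rightarrow> complex^'n) \<Rightarrow> (nat \<Rightarrow> complex^'n) \<Rightarrow> nat \<Rightarrow>
                  (complex^'n \<Rightarrow> real) \<Rightarrow> (complex^'n \<Rightarrow> complex) set" where
  "domB mul x k r = {u. \<exists>w. Brel mul x k r u w}"

definition Bop :: "(complex^'n \<Rightarrow> complex^'n \<Rightarrow> complex^'n) \<Rightarrow> (nat \<Rightarrow> complex^'n) \<Rightarrow> nat \<Rightarrow>
                  (complex^'n \<Rightarrow> real) \<Rightarrow> (complex^'n \<Rightarrow> complex) \<Rightarrow> (complex^'n \<Rightarrow> complex)" where
  "Bop mul x k r u = (THE w. Brel mul x k r u w)"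

end

theory Submission
  imports Defs "HOL-Complex_Analysis.Complex_Analysis"
begin

text \<open>Write \<open>\<delta>\<close> for the dilations, \<open>L\<close> for left-invariant derivatives and \<open>\<mu>\<close> for the measure with
  density \<open>\<rho>\<^sub>a\<close>. A maximum principle gives uniqueness for the heat equation, hence
  \<open>\<integral> f (\<delta>\<^sub>l y) \<rho>\<^sub>s(y) dy = \<integral> f \<rho>\<^sub>t\<close> with \<open>t = |l|\<^sup>2 s\<close>. Differentiating this in \<open>l\<close> and comparing with the heat
  equation yields \<open>\<integral> \<Delta>f d\<mu> = (4/a) \<integral> Zf d\<mu>\<close> for all test functions \<open>f\<close>. Applied to
  \<open>f cnj(v) \<chi>\<close> with \<open>f\<close>, \<open>v\<close> holomorphic and \<open>\<chi>\<close> a cut-off adapted to the dilations, it shows that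
  \<open>Q(f,v) = (2/a) \<langle>Zf, v\<rangle>\<close> as soon as \<open>Zf\<close> is square-integrable. Conversely, if \<open>Bf = w\<close>, testing against
  the homogeneous components of \<open>w\<close> and \<open>f\<close>, which are square-integrable because \<open>\<mu>\<close> is rotation
  invariant, identifies the Taylor coefficients of \<open>l \<mapsto> w(\<delta>\<^sub>l z)\<close> with those of \<open>(2/a) Zf\<close>.\<close>

subsection \<open>Smooth functions\<close>

text \<open>The group law enters only through axioms, so its two decisive properties, complex
  linearity of the differential of left translations and covariance under dilations, have to be
  extracted from the bracket; both come from one differential equation along rays. The constant
  \<open>2 / a\<close> arises as follows. With \<open>l = exp t\<close> the time
  \<open>|l|^2 s\<close> has derivative \<open>2 s\<close> at \<open>t = 0\<close>, so the radial
  derivative integrates to \<open>s / 2\<close> times the integral of \<open>Lap f\<close>; with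
  \<open>l = exp (i t)\<close> the time is constant and the angular derivative integrates to 0.
  Hence \<open>Z\<close> integrates to \<open>s / 4\<close> times that integral. \<open>Lap\<close>
  annihilates holomorphic and antiholomorphic functions, so \<open>Lap (f cnj v)\<close> is twice
  the gradient pairing and \<open>4 / a\<close> becomes \<open>2 / a\<close>. In the converse
  \<open>Z f\<close> is not yet known to be square-integrable, so the form identity cannot be
  applied to \<open>f\<close>. It is applied to a \<open>j\<close>-homogeneous \<open>g\<close>, for
  which \<open>Z g = j g\<close>, and the Hermitian symmetry of the form transfers the operator from
  \<open>f\<close> to \<open>g\<close>; choosing \<open>g\<close> as the difference of the
  \<open>j\<close>-th components forces it to vanish.\<close>

lemma Ck_Suc_imp: "Ck (Suc j) f \<Longrightarrow> Ck j f"
proof (induction j arbitrary: f)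
  case 0
  then show ?case
    by (auto simp: continuous_on_eq_continuous_at intro: differentiable_imp_continuous_within)
next
  case (Suc j)
  then show ?case by (metis Ck.simps(2))
qed

lemma Ck_SucI:
  assumes "\<And>z. (f has_derivative f' z) (at z)" "\<And>v. Ck j (\<lambda>z. f' z v)"
  shows "Ck (Suc j) f"
proof -
  have "frechet_derivative f (at z) = f' z" for z
    using assms(1) by (metis frechet_derivative_at)
  then show ?thesis using assms by (auto simp: differentiable_def)
qed

lemma Ck_const: "Ck j (\<lambda>z. c)"
proof (induction j arbitrary: c)
  case (Suc j)
  show ?case by (rule Ck_SucI[where f' = "\<lambda>_ _. 0"]) (auto intro!: Suc)
qed auto

lemma Ck_bounded_linear_ident: "bounded_linear T \<Longrightarrow> Ck j T"
proof (cases j)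
  case (Suc i)
  assume "bounded_linear T"
  then show ?thesis unfolding Suc
    by (intro Ck_SucI[where f' = "\<lambda>_. T"]) (auto intro: bounded_linear_imp_has_derivative Ck_const)
qed (auto intro: linear_continuous_on)

lemma Ck_bounded_linear: "bounded_linear T \<Longrightarrow> Ck j f \<Longrightarrow> Ck j (\<lambda>z. T (f z))"
proof (induction j arbitrary: f)
  case 0
  then show ?case using linear_continuous_on continuous_on_compose2[of UNIV T UNIV f] by auto
next
  case (Suc j)
  show ?case
    by (rule Ck_SucI[where f' = "\<lambda>z v. T (frechet_derivative f (at z) v)"])
      (use Suc in \<open>auto intro!: bounded_linear.has_derivative[OF Suc.prems(1)] simp: frechet_derivative_works\<close>)
qed

lemma Ck_add: "Ck j f \<Longrightarrow> Ck j g \<Longrightarrow> Ck j (\<lambda>z. f z + g z)"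
proof (induction j arbitrary: f g)
  case 0 then show ?case by (auto intro: continuous_intros)
next
  case (Suc j)
  show ?case
    by (rule Ck_SucI[where f' = "\<lambda>z v. frechet_derivative f (at z) v + frechet_derivative g (at z) v"])
      (use Suc in \<open>auto intro!: derivative_intros simp: frechet_derivative_works\<close>)
qed

lemma Ck_sum: "(\<And>i. i \<in> I \<Longrightarrow> Ck j (f i)) \<Longrightarrow> Ck j (\<lambda>z. \<Sum>i\<in>I. f i z)"
  by (induction I rule: infinite_finite_induct) (auto intro: Ck_const Ck_add)

lemma Ck_bounded_bilinear:
  assumes "bounded_bilinear B"
  shows "Ck j f \<Longrightarrow> Ck j g \<Longrightarrow> Ck j (\<lambda>z. B (f z) (g z))"
proof (induction j arbitrary: f g)
  case 0 then show ?case by (auto intro: bounded_bilinear.continuous_on[OF assms])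
next
  case (Suc j)
  show ?case
    by (rule Ck_SucI[where f' = "\<lambda>z v. B (f z) (frechet_derivative g (at z) v) + B (frechet_derivative f (at z) v) (g z)"])
      (use Suc Ck_Suc_imp[OF Suc.prems(1)] Ck_Suc_imp[OF Suc.prems(2)] in
        \<open>auto intro!: bounded_bilinear.FDERIV[OF assms] Ck_add simp: frechet_derivative_works\<close>)
qed

lemma Ck_Pair: "Ck j f \<Longrightarrow> Ck j g \<Longrightarrow> Ck j (\<lambda>z. (f z, g z))"
proof (induction j arbitrary: f g)
  case 0 then show ?case by (auto intro: continuous_intros)
next
  case (Suc j)
  show ?case
    by (rule Ck_SucI[where f' = "\<lambda>z v. (frechet_derivative f (at z) v, frechet_derivative g (at z) v)"])
      (use Suc in \<open>auto intro!: has_derivative_Pair simp: frechet_derivative_works\<close>)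
qed

lemma linear_apply_basis:
  fixes T :: "'a::euclidean_space \<Rightarrow> 'b::real_vector"
  assumes "linear T"
  shows "T h = (\<Sum>b\<in>Basis. (h \<bullet> b) *\<^sub>R T b)"
  by (metis (no_types, lifting) assms euclidean_representation linear_scale linear_sum sum.cong)

text \<open>The derivative of the composition applies \<open>Df\<close> at a moving point to a
  moving vector. Expanding that vector in \<open>Basis\<close> leaves a sum of products of
  directional derivatives of \<open>f\<close> along \<open>g\<close>, handled by induction, and
  coordinates of \<open>Dg\<close>.\<close>

lemma Ck_compose:
  fixes f :: "'b::euclidean_space \<Rightarrow> 'c::real_normed_vector" and g :: "'a::real_normed_vector \<Rightarrow> 'b"
  shows "Ck j f \<Longrightarrow> Ck j g \<Longrightarrow> Ck j (\<lambda>z. f (g z))"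
proof (induction j arbitrary: f)
  case 0 then show ?case by (auto intro: continuous_on_compose2)
next
  case (Suc j)
  have lin: "linear (frechet_derivative f (at w))" for w
    using Suc.prems(1) by (auto intro: linear_frechet_derivative)
  have eq: "frechet_derivative f (at w) h = (\<Sum>b\<in>Basis. (h \<bullet> b) *\<^sub>R frechet_derivative f (at w) b)" for w h
    by (rule linear_apply_basis[OF lin])
  show ?case
  proof (rule Ck_SucI[where f' = "\<lambda>z v. frechet_derivative f (at (g z)) (frechet_derivative g (at z) v)"])
    show "((\<lambda>z. f (g z)) has_derivative (\<lambda>v. frechet_derivative f (at (g z)) (frechet_derivative g (at z) v))) (at z)" for z
      using Suc.prems by (auto simp: frechet_derivative_works intro: has_derivative_compose)
    show "Ck j (\<lambda>z. frechet_derivative f (at (g z)) (frechet_derivative g (at z) v))" for v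
      by (subst eq)
        (intro Ck_sum Ck_bounded_bilinear[OF bounded_bilinear_scaleR] Ck_bounded_linear[OF bounded_linear_inner_left] Suc.IH,
         use Suc.prems Ck_Suc_imp[OF Suc.prems(2)] in auto)
  qed
qed

lemma smooth_imp_differentiable: "smooth f \<Longrightarrow> f differentiable (at z)"
  unfolding smooth_def by (metis Ck.simps(2))

lemma smooth_has_derivative: "smooth f \<Longrightarrow> (f has_derivative frechet_derivative f (at z)) (at z)"
  using smooth_imp_differentiable frechet_derivative_works by blast

lemma smooth_continuous_on: "smooth f \<Longrightarrow> continuous_on S f"
  unfolding smooth_def by (metis Ck.simps(1) continuous_on_subset top_greatest)

lemma smooth_frechet_derivative: "smooth f \<Longrightarrow> smooth (\<lambda>z. frechet_derivative f (at z) v)"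
  unfolding smooth_def by (metis Ck.simps(2))

lemma smooth_const: "smooth (\<lambda>z. c)"
  by (simp add: smooth_def Ck_const)

lemma smooth_bounded_linear_ident: "bounded_linear T \<Longrightarrow> smooth T"
  by (simp add: smooth_def Ck_bounded_linear_ident)

lemma smooth_ident: "smooth (\<lambda>z. z)"
  by (intro smooth_bounded_linear_ident bounded_linear_ident)

lemma smooth_bounded_linear: "bounded_linear T \<Longrightarrow> smooth f \<Longrightarrow> smooth (\<lambda>z. T (f z))"
  by (simp add: smooth_def Ck_bounded_linear)

lemma smooth_add: "smooth f \<Longrightarrow> smooth g \<Longrightarrow> smooth (\<lambda>z. f z + g z)"
  by (simp add: smooth_def Ck_add)

lemma smooth_minus: "smooth f \<Longrightarrow> smooth (\<lambda>z. - f z)"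
  by (intro smooth_bounded_linear[of uminus] bounded_linear_minus bounded_linear_ident)

lemma smooth_diff: "smooth f \<Longrightarrow> smooth g \<Longrightarrow> smooth (\<lambda>z. f z - g z)"
  using smooth_add[of f "\<lambda>z. - g z"] smooth_minus[of g] by simp

lemma smooth_sum: "(\<And>i. i \<in> I \<Longrightarrow> smooth (f i)) \<Longrightarrow> smooth (\<lambda>z. \<Sum>i\<in>I. f i z)"
  by (simp add: smooth_def Ck_sum)

lemma smooth_bounded_bilinear:
  "bounded_bilinear B \<Longrightarrow> smooth f \<Longrightarrow> smooth g \<Longrightarrow> smooth (\<lambda>z. B (f z) (g z))"
  by (simp add: smooth_def Ck_bounded_bilinear)

lemmas smooth_mult = smooth_bounded_bilinear[OF bounded_bilinear_mult]
lemmas smooth_scaleR = smooth_bounded_bilinear[OF bounded_bilinear_scaleR]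
lemmas smooth_inner = smooth_bounded_bilinear[OF bounded_bilinear_inner]
lemmas smooth_cnj = smooth_bounded_linear[OF bounded_linear_cnj]
lemmas smooth_of_real = smooth_bounded_linear[OF bounded_linear_of_real]

lemma smooth_Pair: "smooth f \<Longrightarrow> smooth g \<Longrightarrow> smooth (\<lambda>z. (f z, g z))"
  by (simp add: smooth_def Ck_Pair)

lemma smooth_compose:
  fixes f :: "'b::euclidean_space \<Rightarrow> 'c::real_normed_vector"
  shows "smooth f \<Longrightarrow> smooth g \<Longrightarrow> smooth (\<lambda>z. f (g z))"
  by (simp add: smooth_def Ck_compose)

lemma smooth_derivative_apply:
  fixes f :: "'a::euclidean_space \<Rightarrow> 'b::real_normed_vector" and g :: "'c::real_normed_vector \<Rightarrow> 'a"
  assumes "smooth f" "smooth g" "smooth h"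
  shows "smooth (\<lambda>z. frechet_derivative f (at (g z)) (h z))"
  by (subst linear_apply_basis[OF linear_frechet_derivative[OF smooth_imp_differentiable[OF assms(1)]]])
    (intro smooth_sum smooth_scaleR smooth_bounded_linear[OF bounded_linear_inner_left] assms
      smooth_compose[OF smooth_frechet_derivative])

text \<open>Coinduction: a class of differentiable functions containing all its directional
  derivatives lies in every \<open>Ck j\<close>. It replaces explicit formulas for higher
  derivatives, for \<open>flat_exp\<close> and for \<open>holo\<close> alike.\<close>

lemma smooth_coinduct:
  assumes "P f" "\<And>f. P f \<Longrightarrow> \<exists>f'. \<forall>z. (f has_derivative f' z) (at z) \<and> (\<forall>v. P (\<lambda>z. f' z v))"
  shows "smooth f"
proof -
  have "P f \<Longrightarrow> Ck j f" for j f
  proof (induction j arbitrary: f)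
    case 0
    obtain f' where "\<forall>z. (f has_derivative f' z) (at z)" using assms(2)[OF 0] by blast
    then show ?case by (auto simp: continuous_on_eq_continuous_at intro: has_derivative_continuous)
  next
    case (Suc j)
    obtain f' where "\<forall>z. (f has_derivative f' z) (at z) \<and> (\<forall>v. P (\<lambda>z. f' z v))" using assms(2)[OF Suc.prems] by blast
    then show ?case using Suc.IH by (intro Ck_SucI[of f f']) auto
  qed
  then show ?thesis using assms(1) by (simp add: smooth_def)
qed

subsection \<open>A bump function\<close>

text \<open>The classical function \<open>exp (- 1/t)\<close>, flat at 0; the polynomial factor in
  \<open>1/t\<close> makes the family stable under differentiation.\<close>

definition flat_exp :: "real poly \<Rightarrow> real \<Rightarrow> real" where
  "flat_exp p t = (if t > 0 then poly p (1/t) * exp (- (1/t)) else 0)"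

lemma poly_times_exp_decay: "((\<lambda>u. poly p u * exp (- u)) \<longlongrightarrow> (0::real)) at_top"
proof -
  have "((\<lambda>u. \<Sum>i\<le>degree p. coeff p i * (u ^ i / exp u)) \<longlongrightarrow> (\<Sum>i\<le>degree p. coeff p i * 0)) at_top"
    by (intro tendsto_intros tendsto_power_div_exp_0)
  then show ?thesis
    by (simp add: poly_altdef sum_distrib_right exp_minus divide_inverse mult.assoc)
qed

lemma flat_exp_at_right: "(flat_exp p \<longlongrightarrow> 0) (at_right 0)"
proof -
  have "((\<lambda>t. poly p (inverse t) * exp (- inverse t)) \<longlongrightarrow> 0) (at_right (0::real))"
    by (rule filterlim_compose[OF poly_times_exp_decay filterlim_inverse_at_top_right])
  then show ?thesis
    by (rule Lim_transform_eventually)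
      (auto simp: flat_exp_def eventually_at_right_field inverse_eq_divide intro!: exI[of _ 1])
qed

lemma flat_exp_at_0: "(flat_exp p \<longlongrightarrow> 0) (at 0)"
proof -
  have "(flat_exp p \<longlongrightarrow> 0) (at_left 0)"
    by (rule tendsto_eventually) (auto simp: flat_exp_def eventually_at_left_field intro!: exI[of _ "-1"])
  then show ?thesis using flat_exp_at_right filterlim_split_at by blast
qed

text \<open>With \<open>u = 1/t\<close> the chain rule turns \<open>p(u) exp(- u)\<close> into
  \<open>u^2 (p - p')(u) exp(- u)\<close>, which is where \<open>monom 1 2 * (p - pderiv p)\<close>
  comes from.\<close>

lemma flat_exp_deriv:
  "(flat_exp p has_real_derivative flat_exp (monom 1 2 * (p - pderiv p)) t) (at t)"
proof -
  consider "t > 0" | "t < 0" | "t = 0" by linarith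
  then show ?thesis
  proof cases
    case 1
    have "((\<lambda>t. poly p (1/t) * exp (- (1/t))) has_real_derivative
        flat_exp (monom 1 2 * (p - pderiv p)) t) (at t)"
      using 1 by (auto intro!: derivative_eq_intros poly_DERIV[THEN DERIV_chain2]
          simp: flat_exp_def poly_monom field_simps power2_eq_square)
    then show ?thesis
      by (rule has_field_derivative_transform_within_open[of _ _ _ "{0<..}"]) (use 1 in \<open>auto simp: flat_exp_def\<close>)
  next
    case 2
    have "((\<lambda>t. 0) has_real_derivative flat_exp (monom 1 2 * (p - pderiv p)) t) (at t)"
      using 2 by (auto simp: flat_exp_def)
    then show ?thesis
      by (rule has_field_derivative_transform_within_open[of _ _ _ "{..<0}"]) (use 2 in \<open>auto simp: flat_exp_def\<close>)
  next
    case 3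
    \<comment> \<open>The difference quotient at 0 contributes one more power of \<open>u\<close>,
      so it is itself a \<open>flat_exp\<close> and tends to 0 from both sides.\<close>
    have "((\<lambda>h. flat_exp (monom 1 1 * p) h) \<longlongrightarrow> 0) (at 0)" by (rule flat_exp_at_0)
    moreover have "flat_exp (monom 1 1 * p) h = (flat_exp p (0 + h) - flat_exp p 0) / h" for h
      by (auto simp: flat_exp_def poly_monom field_simps)
    ultimately show ?thesis unfolding 3 DERIV_def by (simp add: flat_exp_def)
  qed
qed

lemma smooth_flat_exp: "smooth (flat_exp p)"
proof (rule smooth_coinduct[where P = "\<lambda>f. \<exists>c q. f = (\<lambda>t. c * flat_exp q t)"])
  show "\<exists>c q. flat_exp p = (\<lambda>t. c * flat_exp q t)"
    by (rule exI[of _ 1]) auto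
next
  fix f :: "real \<Rightarrow> real"
  assume "\<exists>c q. f = (\<lambda>t. c * flat_exp q t)"
  then obtain c q where f: "f = (\<lambda>t. c * flat_exp q t)" by blast
  show "\<exists>f'. \<forall>z. (f has_derivative f' z) (at z) \<and> (\<forall>v. \<exists>c q. (\<lambda>z. f' z v) = (\<lambda>t. c * flat_exp q t))"
  proof (intro exI[of _ "\<lambda>z v. c * flat_exp (monom 1 2 * (q - pderiv q)) z * v"] allI conjI)
    show "(f has_derivative (*) (c * flat_exp (monom 1 2 * (q - pderiv q)) z)) (at z)" for z
      unfolding f has_field_derivative_def[symmetric]
      using flat_exp_deriv by (intro DERIV_cmult)
    show "\<exists>c' q'. (\<lambda>z. c * flat_exp (monom 1 2 * (q - pderiv q)) z * v) = (\<lambda>t. c' * flat_exp q' t)" for v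
      by (intro exI[of _ "c * v"] exI[of _ "monom 1 2 * (q - pderiv q)"]) (auto simp: mult_ac)
  qed
qed

text \<open>A bump without plateau: only the value 1 at the origin matters for the cut-offs.\<close>

definition bump :: "'a::euclidean_space \<Rightarrow> real" where
  "bump z = exp 1 * flat_exp 1 (1 - z \<bullet> z)"

lemma smooth_bump: "smooth bump"
  unfolding bump_def
  by (intro smooth_mult smooth_const smooth_compose[OF smooth_flat_exp] smooth_diff smooth_inner smooth_ident)

lemma bump_range: "0 \<le> bump z" "bump z \<le> 1"
proof -
  show "0 \<le> bump z" by (auto simp: bump_def flat_exp_def)
  show "bump z \<le> 1"
  proof (cases "z \<bullet> z < 1")
    case True
    then have "1 \<le> 1 / (1 - z \<bullet> z)" by (simp add: field_simps)
    then show ?thesis using True by (auto simp: bump_def flat_exp_def exp_add[symmetric] simp del: exp_add)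
  qed (auto simp: bump_def flat_exp_def)
qed

lemma bump_0: "bump 0 = 1"
  by (simp add: bump_def flat_exp_def exp_add[symmetric])

lemma bump_support: "bump z \<noteq> 0 \<Longrightarrow> norm z \<le> 1"
  using abs_square_le_1[of "norm z"]
  by (auto simp: bump_def flat_exp_def power2_norm_eq_inner[symmetric] split: if_splits)

subsection \<open>Holomorphic functions of several variables\<close>

lemma bounded_linear_vec_scale: "bounded_linear (\<lambda>c::complex. c *s (v::complex^'n))"
  by (rule linear_conv_bounded_linear[THEN iffD1], rule linearI)
    (auto simp: vec_eq_iff algebra_simps)

lemma bounded_linear_vec_scale2: "bounded_linear (\<lambda>v::complex^'n. (c::complex) *s v)"
  by (rule linear_conv_bounded_linear[THEN iffD1], rule linearI)
    (auto simp: vec_eq_iff algebra_simps)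

lemma bounded_bilinear_vec_scale: "bounded_bilinear (\<lambda>(c::complex) (v::complex^'n). c *s v)"
  by (rule bilinear_conv_bounded_bilinear[THEN iffD1])
    (auto simp: bilinear_def bounded_linear_vec_scale bounded_linear_vec_scale2 bounded_linear.linear)

lemma scaleR_eq_vec_scale: "r *\<^sub>R (v::complex^'n) = complex_of_real r *s v"
  by (auto simp: vec_eq_iff scaleR_conv_of_real[where 'a=complex])

lemma holoD:
  assumes "holo f"
  shows "(f has_derivative frechet_derivative f (at z)) (at z)"
    "frechet_derivative f (at z) (c *s v) = c * frechet_derivative f (at z) v"
proof -
  obtain D where D: "(f has_derivative D) (at z)" "\<forall>c v. D (c *s v) = c * D v"
    using assms unfolding holo_def by blast
  then have "D = frechet_derivative f (at z)" by (metis frechet_derivative_at)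
  then show "(f has_derivative frechet_derivative f (at z)) (at z)"
    "frechet_derivative f (at z) (c *s v) = c * frechet_derivative f (at z) v" using D by auto
qed

lemma holo_continuous_on: "holo f \<Longrightarrow> continuous_on S f"
  by (meson continuous_at_imp_continuous_on has_derivative_continuous holoD(1))

text \<open>Restriction to a complex curve: complex linearity of the derivative turns the real chain
  rule into a complex derivative, so that one-variable Cauchy theory becomes available.\<close>

lemma holo_line_field_derivative:
  fixes g :: "complex \<Rightarrow> complex^'n"
  assumes "holo f" and g: "(g has_derivative (\<lambda>h. h *s v)) (at l)"
  shows "((\<lambda>l. f (g l)) has_field_derivative frechet_derivative f (at (g l)) v) (at l)"
proof -
  have "((\<lambda>l. f (g l)) has_derivative (\<lambda>h. frechet_derivative f (at (g l)) (h *s v))) (at l)"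
    by (rule has_derivative_compose[OF g holoD(1)[OF assms(1)]])
  then show ?thesis
    unfolding has_field_derivative_def
    by (rule has_derivative_eq_rhs) (simp add: holoD(2)[OF assms(1)] mult.commute fun_eq_iff)
qed

text \<open>Cauchy's formula with \<open>u = cis (2 pi t)\<close>: the measure
  \<open>du / (2 pi i u)\<close> becomes \<open>dt\<close> and \<open>u^(-j)\<close> becomes
  \<open>cis (- 2 pi j t)\<close>. The Taylor coefficient appears as a Fourier coefficient.\<close>

lemma circle_integral_Taylor_coeff:
  assumes "F holomorphic_on UNIV"
  shows "((\<lambda>t. F (cis (2 * pi * t)) * cis (- (2 * pi * real j * t))) has_integral ((deriv ^^ j) F 0 / fact j)) {0..1}"
proof -
  have c: "continuous_on (cball 0 1) F" and h: "F holomorphic_on ball 0 1"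
    using assms by (auto intro: holomorphic_on_imp_continuous_on holomorphic_on_subset)
  have "((\<lambda>u. F u / (u - 0) ^ Suc j) has_contour_integral (2 * pi * \<i>) / fact j * (deriv ^^ j) F 0) (circlepath 0 1)"
    using Cauchy_has_contour_integral_higher_derivative_circlepath[OF c h, of 0 j] by simp
  then have "((\<lambda>t. F (circlepath 0 1 t) / circlepath 0 1 t ^ Suc j * vector_derivative (circlepath 0 1) (at t within {0..1}))
      has_integral (2 * of_real pi * \<i>) / fact j * (deriv ^^ j) F 0) {0..1}"
    unfolding has_contour_integral_def by simp
  then have *: "((\<lambda>t. (F (circlepath 0 1 t) / circlepath 0 1 t ^ Suc j * vector_derivative (circlepath 0 1) (at t within {0..1})) / (2 * of_real pi * \<i>))
      has_integral ((2 * of_real pi * \<i>) / fact j * (deriv ^^ j) F 0) / (2 * of_real pi * \<i>)) {0..1}"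
    by (rule has_integral_divide)
  have e: "circlepath 0 1 t = cis (2 * pi * t)" for t :: real
    by (simp add: cis_conv_exp circlepath mult_ac)
  have v: "vector_derivative (circlepath 0 1) (at t within {0..1}) = 2 * of_real pi * \<i> * cis (2 * pi * t)"
    if "t \<in> {0..1}" for t
    using that by (simp add: vector_derivative_circlepath01 cis_conv_exp mult_ac)
  have "(F (circlepath 0 1 t) / circlepath 0 1 t ^ Suc j * vector_derivative (circlepath 0 1) (at t within {0..1})) / (2 * of_real pi * \<i>)
      = F (cis (2 * pi * t)) * cis (- (2 * pi * real j * t))" if "t \<in> {0..1}" for t :: real
  proof -
    have "cis (- (2 * pi * real j * t)) * cis (2 * pi * t) ^ j = 1"
      by (simp only: Complex.DeMoivre cis_mult) (simp add: algebra_simps)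
    then have "cis (- (2 * pi * real j * t)) = 1 / cis (2 * pi * t) ^ j"
      by (simp add: field_simps)
    then show ?thesis unfolding e v[OF that] by (simp add: field_simps)
  qed
  then have "((\<lambda>t. F (cis (2 * pi * t)) * cis (- (2 * pi * real j * t))) has_integral
      ((2 * of_real pi * \<i>) / fact j * (deriv ^^ j) F 0) / (2 * of_real pi * \<i>)) {0..1}"
    by (intro has_integral_eq[OF _ *]) auto
  then show ?thesis by (simp add: field_simps)
qed

text \<open>Coefficient \<open>j = 1\<close> of \<open>l \<mapsto> f (z + l v)\<close>. The
  right-hand side involves only values of \<open>f\<close>, so continuity and then holomorphy of the
  derivative can be read off from those of \<open>f\<close>.\<close>

lemma holo_derivative_circle_integral:
  fixes f :: "complex^'n \<Rightarrow> complex"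
  assumes "holo f"
  shows "frechet_derivative f (at z) v = integral {0..1} (\<lambda>t. cis (- (2 * pi * t)) * f (z + cis (2 * pi * t) *s v))"
proof -
  have d: "((\<lambda>l. f (z + l *s v)) has_field_derivative frechet_derivative f (at (z + l *s v)) v) (at l)" for l
    by (rule holo_line_field_derivative[OF assms])
      (auto intro!: derivative_eq_intros bounded_linear_imp_has_derivative bounded_linear_vec_scale)
  then have "(\<lambda>l. f (z + l *s v)) holomorphic_on UNIV"
    by (auto simp: holomorphic_on_def field_differentiable_def)
  from circle_integral_Taylor_coeff[OF this, of 1] d[THEN DERIV_imp_deriv]
  show ?thesis by (simp add: integral_unique mult.commute)
qed

lemma holo_derivative_continuous:
  fixes f :: "complex^'n \<Rightarrow> complex"
  assumes "holo f"
  shows "continuous_on UNIV (\<lambda>z. frechet_derivative f (at z) v)"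
proof -
  have "continuous_on UNIV (\<lambda>z. integral (cbox 0 1) (\<lambda>t. cis (- (2 * pi * t)) * f (z + cis (2 * pi * t) *s v)))"
    by (intro integral_continuous_on_param, unfold split_beta)
      (intro continuous_intros holo_continuous_on[OF assms] continuous_on_compose2[OF holo_continuous_on[OF assms, of UNIV]]
       bounded_linear.continuous_on[OF bounded_linear_vec_scale], auto)
  then show ?thesis by (simp add: holo_derivative_circle_integral[OF assms])
qed

text \<open>Differentiation under the integral keeps complex linearity. The linear family
  \<open>L\<close> and the shift \<open>b\<close> cover both uses: constant \<open>L\<close> with a
  circle of shifts for directional derivatives, and dilations with zero shift for homogeneous
  components.\<close>

lemma holo_integral:
  fixes f :: "complex^'n \<Rightarrow> complex" and L :: "real \<Rightarrow> complex^'n \<Rightarrow> complex^'n" and b :: "real \<Rightarrow> complex^'n"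
  assumes f: "holo f"
    and L: "\<And>t. linear (L t)" "\<And>t c v. L t (c *s v) = c *s L t v" "\<And>v. continuous_on UNIV (\<lambda>t. L t v)"
    and b: "continuous_on UNIV b" and c: "continuous_on UNIV c"
  shows "holo (\<lambda>z. integral {0..1} (\<lambda>t. c t * f (L t z + b t)))"
proof -
  let ?D = "\<lambda>z t h. c t * frechet_derivative f (at (L t z + b t)) (L t h)"
  define fx where "fx z t = Blinfun (?D z t)" for z t
  have bl: "bounded_linear (L t)" for t using L(1) linear_conv_bounded_linear by blast
  have hd: "((\<lambda>z. c t * f (L t z + b t)) has_derivative ?D z t) (at z)" for z t
  proof -
    have "((\<lambda>z. L t z + b t) has_derivative (\<lambda>h. L t h)) (at z)"
      by (auto intro!: derivative_eq_intros bounded_linear_imp_has_derivative bl)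
    from has_derivative_compose[OF this holoD(1)[OF f]] show ?thesis
      by (rule has_derivative_mult_right)
  qed
  have blD: "bounded_linear (?D z t)" for z t
    using hd has_derivative_bounded_linear by blast
  have fx: "blinfun_apply (fx z t) = ?D z t" for z t
    unfolding fx_def using blD by (rule bounded_linear_Blinfun_apply)
  have contL: "continuous_on UNIV (\<lambda>p. L (snd p) (fst p))"
  proof -
    have "(\<lambda>p. L (snd p) (fst p)) = (\<lambda>p. \<Sum>e\<in>Basis. (fst p \<bullet> e) *\<^sub>R L (snd p) e)"
      using linear_apply_basis[OF L(1)] by (rule ext)
    then show ?thesis
      by (simp only:) (intro continuous_intros continuous_on_compose2[OF L(3)], auto)
  qed
  have contLc: "continuous_on UNIV (\<lambda>p. L (snd p) (fst p) + b (snd p))"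
    by (intro continuous_intros contL continuous_on_compose2[OF b]) auto
  have lin: "linear (frechet_derivative f (at w))" for w
    using holoD(1)[OF f] has_derivative_linear by blast
  have contD: "continuous_on UNIV (\<lambda>p. ?D (fst p) (snd p) h)" for h
    by (subst linear_apply_basis[OF lin])
      (intro continuous_intros continuous_on_compose2[OF holo_derivative_continuous[OF f]] contLc
        continuous_on_compose2[OF L(3)] continuous_on_compose2[OF c], auto)
  have contf: "continuous_on UNIV (\<lambda>t. c t * f (L t z + b t))" for z
    by (intro continuous_intros c continuous_on_compose2[OF holo_continuous_on[OF f, of UNIV]] L b) auto
  have contfx: "continuous_on (UNIV \<times> cbox 0 1) (\<lambda>(z, t). fx z t)"
    unfolding split_beta
    by (rule continuous_on_blinfun_componentwise) (auto simp: fx intro: continuous_on_subset[OF contD])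
  have main: "((\<lambda>z. integral (cbox 0 1) (\<lambda>t. c t * f (L t z + b t))) has_derivative integral (cbox 0 1) (fx z)) (at z)" for z
    using leibniz_rule[where U = UNIV and f = "\<lambda>z t. c t * f (L t z + b t)" and fx = fx and a = 0 and b = 1, OF _ _ contfx UNIV_I convex_UNIV, of z]
      hd contf by (auto simp: fx intro!: integrable_continuous_interval continuous_on_subset[OF contf])
  have int: "fx z integrable_on {0..1}" for z
  proof -
    have "continuous_on {0..1} (\<lambda>t. (\<lambda>(z, t). fx z t) (z, t))"
      by (rule continuous_on_compose2[OF contfx]) (auto intro!: continuous_intros)
    then show ?thesis by (intro integrable_continuous_interval) simp
  qed
  have ap: "blinfun_apply (integral {0..1} (fx z)) h = integral {0..1} (\<lambda>t. ?D z t h)" for z h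
    by (subst blinfun_apply_integral[OF int]) (simp add: fx)
  have cl: "frechet_derivative f (at w) (L t (k *s h)) = k * frechet_derivative f (at w) (L t h)" for w t k h
    by (simp add: L(2) holoD(2)[OF f])
  have "blinfun_apply (integral {0..1} (fx z)) (k *s h) = k * blinfun_apply (integral {0..1} (fx z)) h" for z k h
    unfolding ap cl by (subst integral_mult_right[symmetric]) (simp add: mult_ac)
  then show ?thesis
    unfolding holo_def using main by (simp only: cbox_interval) blast
qed

lemma holo_frechet_derivative:
  fixes f :: "complex^'n \<Rightarrow> complex"
  assumes "holo f"
  shows "holo (\<lambda>z. frechet_derivative f (at z) v)"
proof -
  have "holo (\<lambda>z. integral {0..1} (\<lambda>t. cis (- (2 * pi * t)) * f ((\<lambda>t z. z) t z + cis (2 * pi * t) *s v)))"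
    by (intro holo_integral[OF assms] continuous_intros bounded_linear.continuous_on[OF bounded_linear_vec_scale])
      (auto simp: linear_id[unfolded id_def])
  then show ?thesis by (simp add: holo_derivative_circle_integral[OF assms])
qed

lemma holo_imp_smooth:
  fixes f :: "complex^'n \<Rightarrow> complex"
  assumes "holo f" shows "smooth f"
proof (rule smooth_coinduct[where P = holo])
  fix f :: "complex^'n \<Rightarrow> complex" assume "holo f"
  then show "\<exists>f'. \<forall>z. (f has_derivative f' z) (at z) \<and> (\<forall>v. holo (\<lambda>z. f' z v))"
    using holoD(1) holo_frechet_derivative by (intro exI[of _ "\<lambda>z. frechet_derivative f (at z)"]) blast
qed (rule assms)

text \<open>Otherwise the simplifier rewrites \<open>V 1\<close> and \<open>{1..m}\<close> to forms with \<open>Suc 0\<close>.\<close>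

declare One_nat_def [simp del]

subsection \<open>Stratified Lie algebras and dilations\<close>

lemma csubspace_scale:
  assumes "csubspace S" "v \<in> S" shows "c *s v \<in> S"
proof -
  have "c *s v = Re c *\<^sub>R v + Im c *\<^sub>R (\<i> *s v)"
    by (simp add: vec_eq_iff scaleR_conv_of_real[where 'a=complex] algebra_simps)
      (metis complex_eq distrib_left mult.assoc mult.commute)
  then show ?thesis
    using assms by (auto simp: csubspace_def subspace_add subspace_scale)
qed

definition layer :: "(nat \<Rightarrow> (complex^'n) set) \<Rightarrow> nat \<Rightarrow> complex^'n \<Rightarrow> nat \<Rightarrow> complex^'n" where
  "layer V m z = (THE v. (\<forall>j\<in>{1..m}. v j \<in> V j) \<and> (\<forall>j. j \<notin> {1..m} \<longrightarrow> v j = 0) \<and> z = (\<Sum>j=1..m. v j))"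

lemma ex1_implies_unique: "\<exists>!x. P x \<Longrightarrow> P a \<Longrightarrow> P b \<Longrightarrow> a = b"
  by blast

locale stratified_algebra =
  fixes br :: "complex^'n \<Rightarrow> complex^'n \<Rightarrow> complex^'n" and V :: "nat \<Rightarrow> (complex^'n) set" and m :: nat
  assumes lie: "lie_algebra br" and strat: "stratified br V m"
begin

abbreviation "lay \<equiv> layer V m"
abbreviation "dl \<equiv> dil V m"

lemma m_ge_1: "m \<ge> 1" and csub: "j \<in> {1..m} \<Longrightarrow> csubspace (V j)"
  using strat by (auto simp: stratified_def)

lemma sub: "j \<in> {1..m} \<Longrightarrow> subspace (V j)"
  using csub by (auto simp: csubspace_def)

lemma decomp_ex1: "\<exists>!v. (\<forall>j\<in>{1..m}. v j \<in> V j) \<and> (\<forall>j. j \<notin> {1..m} \<longrightarrow> v j = 0) \<and> z = (\<Sum>j=1..m. v j)"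
  using strat unfolding stratified_def by (elim conjE) (erule spec)

lemma layer_spec: "(\<forall>j\<in>{1..m}. lay z j \<in> V j) \<and> (\<forall>j. j \<notin> {1..m} \<longrightarrow> lay z j = 0) \<and> z = (\<Sum>j=1..m. lay z j)"
  unfolding layer_def by (rule theI'[OF decomp_ex1])

lemma layer_in: "j \<in> {1..m} \<Longrightarrow> lay z j \<in> V j"
  and sum_layers: "(\<Sum>j=1..m. lay z j) = z"
  using layer_spec[of z] by auto

lemma layer_unique:
  assumes "\<And>j. j \<in> {1..m} \<Longrightarrow> v j \<in> V j" "z = (\<Sum>j=1..m. v j)" "j \<in> {1..m}"
  shows "lay z j = v j"
proof -
  let ?v = "\<lambda>j. if j \<in> {1..m} then v j else 0"
  have "z = (\<Sum>j=1..m. ?v j)"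
    unfolding assms(2) by (rule sum.cong) auto
  then have "lay z = ?v"
    using assms(1) layer_spec[of z] by (intro ex1_implies_unique[OF decomp_ex1[of z]]) auto
  then show ?thesis using assms(3) by simp
qed

lemma layer_add: "j \<in> {1..m} \<Longrightarrow> lay (x + y) j = lay x j + lay y j"
  by (rule layer_unique) (auto simp: sum.distrib sum_layers layer_in[simplified] intro!: subspace_add[OF sub])

lemma layer_scale: "j \<in> {1..m} \<Longrightarrow> lay (c *s x) j = c *s lay x j"
  by (rule layer_unique)
    (auto simp: sum_layers layer_in[simplified] vec.scale_sum_right[symmetric] intro!: csubspace_scale[OF csub])

lemma layer_of_layer:
  assumes "u \<in> V i" "i \<in> {1..m}" "j \<in> {1..m}"
  shows "lay u j = (if j = i then u else 0)"
  by (rule layer_unique[where v = "\<lambda>j. if j = i then u else 0"])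
    (use assms sub in \<open>auto intro: subspace_0\<close>)

lemma dil_eq: "dl l z = (\<Sum>j=1..m. l ^ j *s lay z j)"
  unfolding dil_def
proof (rule the_equality)
  show "\<exists>v. (\<forall>j\<in>{1..m}. v j \<in> V j) \<and> z = sum v {1..m} \<and> (\<Sum>j = 1..m. l ^ j *s lay z j) = (\<Sum>j = 1..m. l ^ j *s v j)"
    by (intro exI[of _ "lay z"]) (auto simp: layer_in[simplified] sum_layers)
next
  fix w assume "\<exists>v. (\<forall>j\<in>{1..m}. v j \<in> V j) \<and> z = sum v {1..m} \<and> w = (\<Sum>j = 1..m. l ^ j *s v j)"
  then obtain v where v: "\<forall>j\<in>{1..m}. v j \<in> V j" "z = sum v {1..m}" "w = (\<Sum>j = 1..m. l ^ j *s v j)" by blast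
  then show "w = (\<Sum>j=1..m. l ^ j *s lay z j)"
    using layer_unique[of v z] by (auto intro!: sum.cong)
qed

lemma dil_add: "dl l (x + y) = dl l x + dl l y"
  unfolding dil_eq sum.distrib[symmetric]
  by (rule sum.cong) (auto simp: layer_add vec_eq_iff algebra_simps)

lemma dil_vec_scale: "dl l (c *s x) = c *s dl l x"
  unfolding dil_eq vec.scale_sum_right
  by (rule sum.cong) (auto simp: layer_scale mult.commute)

lemma dil_bounded_linear: "bounded_linear (dl l)"
  by (rule linear_conv_bounded_linear[THEN iffD1], rule linearI)
    (auto simp: dil_add scaleR_eq_vec_scale dil_vec_scale)

lemma dil_0: "dl l 0 = 0"
  using dil_bounded_linear bounded_linear.linear linear_0 by blast

lemma layer_dil: "j \<in> {1..m} \<Longrightarrow> lay (dl l z) j = l ^ j *s lay z j"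
  by (rule layer_unique) (auto simp: dil_eq layer_in[simplified] intro!: csubspace_scale[OF csub])

lemma dil_dil: "dl k (dl l z) = dl (k * l) z"
  unfolding dil_eq[of k] dil_eq[of "k * l"]
  by (rule sum.cong) (auto simp: layer_dil power_mult_distrib)

lemma dil_1: "dl 1 z = z"
  by (simp add: dil_eq sum_layers)

lemma dil_inverse: "l \<noteq> 0 \<Longrightarrow> dl (inverse l) (dl l z) = z" "l \<noteq> 0 \<Longrightarrow> dl l (dl (inverse l) z) = z"
  by (simp_all add: dil_dil dil_1)

lemma dil_of_layer: "u \<in> V i \<Longrightarrow> i \<in> {1..m} \<Longrightarrow> dl l u = l ^ i *s u"
  by (simp add: dil_eq layer_of_layer if_distrib[of "\<lambda>x. _ *s x"] sum.delta cong: if_cong)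

lemma dil_V1: "u \<in> V 1 \<Longrightarrow> dl l u = l *s u"
  using dil_of_layer[of u 1] m_ge_1 by simp

lemma continuous_on_dil: "continuous_on UNIV (\<lambda>p. dl (fst p) (snd p))"
proof -
  have "linear (\<lambda>z. lay z j)" if "j \<in> {1..m}" for j
    by (rule linearI) (auto simp: layer_add[OF that] scaleR_eq_vec_scale layer_scale[OF that])
  then have "continuous_on UNIV (\<lambda>z. lay z j)" if "j \<in> {1..m}" for j
    using that linear_continuous_on linear_conv_bounded_linear by blast
  then show ?thesis
    unfolding dil_eq
    by (intro continuous_on_sum bounded_bilinear.continuous_on[OF bounded_bilinear_vec_scale] continuous_intros)
      (auto intro!: continuous_on_compose2[where g = "\<lambda>z. lay z _" and s = UNIV] continuous_intros)
qed

lemma continuous_on_dil' [continuous_intros]: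
  "continuous_on S f \<Longrightarrow> continuous_on S g \<Longrightarrow> continuous_on S (\<lambda>x. dl (f x) (g x))"
  using continuous_on_compose2[OF continuous_on_dil, of S "\<lambda>x. (f x, g x)"] by (auto intro: continuous_intros)

lemma br_add1: "br (x + y) z = br x z + br y z" and br_scale1: "br (c *s x) z = c *s br x z"
  and br_anti: "br x y = - br y x" and jacobi: "br x (br y z) + br y (br z x) + br z (br x y) = 0"
  using lie unfolding lie_algebra_def by blast+

lemma br_add2: "br z (x + y) = br z x + br z y"
  by (metis br_add1 br_anti minus_add_distrib)

lemma br_scale2: "br z (c *s x) = c *s br z x"
  by (metis br_scale1 br_anti vec.scale_minus_right)

lemma br_self: "br x x = 0"
proof -
  have "2 *\<^sub>R br x x = 0" using br_anti[of x x] by (metis add.right_inverse scaleR_2)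
  then show ?thesis by simp
qed

lemma br_linear: "linear (br z)" "linear (\<lambda>x. br x z)"
  by (rule linearI; simp add: br_add1 br_add2 br_scale1 br_scale2 scaleR_eq_vec_scale)+

lemma br_0: "br z 0 = 0" "br 0 z = 0"
  using linear_0[OF br_linear(1)] linear_0[OF br_linear(2)] by auto

lemma br_sum: "br (\<Sum>i\<in>I. f i) (\<Sum>j\<in>J. g j) = (\<Sum>i\<in>I. \<Sum>j\<in>J. br (f i) (g j))"
  by (subst linear_sum[OF br_linear(2)], subst linear_sum[OF br_linear(1)]) simp

lemma V_Suc: "1 \<le> j \<Longrightarrow> j < m \<Longrightarrow> V (Suc j) = span {br u w | u w. u \<in> V 1 \<and> w \<in> V j}"
  and V_top: "u \<in> V 1 \<Longrightarrow> w \<in> V m \<Longrightarrow> br u w = 0"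
  using strat by (auto simp: stratified_def)

text \<open>Induction on \<open>i\<close>: \<open>V (Suc i)\<close> is spanned by brackets of
  \<open>V 1\<close> with \<open>V i\<close>, and the Jacobi identity rewrites
  \<open>[[a,b],w]\<close> as \<open>[a,[b,w]] - [b,[a,w]]\<close>, where only brackets with
  elements of \<open>V 1\<close> and \<open>V i\<close> are taken. Beyond the top layer the target
  is \<open>{0}\<close>.\<close>

lemma br_graded:
  assumes "i \<in> {1..m}" "j \<in> {1..m}" "u \<in> V i" "w \<in> V j"
  shows "br u w \<in> (if i + j \<le> m then V (i + j) else {0})"
  using assms
proof (induction i arbitrary: j u w)
  case (Suc i)
  let ?W = "\<lambda>n. if n \<le> m then V n else {0}"
  have subW: "subspace (?W n)" if "n \<ge> 1" for n using that by (auto intro: sub subspace_single_0)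
  have one: "br u w \<in> ?W (Suc j)" if "1 \<le> j" "u \<in> V 1" "w \<in> ?W j" for u w j
  proof (cases "j < m")
    case True
    then show ?thesis using that by (auto simp: V_Suc intro!: span_base)
  next
    case False
    then show ?thesis using that V_top[of u w] by (cases "j = m") (auto simp: br_0)
  qed
  show ?case
  proof (cases "i = 0")
    case True
    then show ?thesis using one[of j u w] Suc.prems by (auto simp: One_nat_def)
  next
    case False
    then have i: "1 \<le> i" "i < m" "i \<in> {1..m}" using Suc.prems by auto
    have IH: "br u w \<in> ?W (i + j)" if "1 \<le> j" "u \<in> V i" "w \<in> ?W j" for u w j
      using Suc.IH[OF i(3), of j u w] that by (cases "j \<le> m") (auto simp: br_0 subspace_0[OF sub])
    have "subspace {u. br u w \<in> ?W (Suc i + j)}"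
      using subW[of "Suc i + j"] br_linear(2)[of w]
      by (auto simp: subspace_def br_0 linear_add[OF br_linear(2)] linear_scale[OF br_linear(2)])
    moreover have "{br u w | u w. u \<in> V 1 \<and> w \<in> V i} \<subseteq> {u. br u w \<in> ?W (Suc i + j)}"
    proof clarify
      fix a b assume ab: "a \<in> V 1" "b \<in> V i"
      have "br (br a b) w = br a (br b w) - br b (br a w)"
      proof -
        have "br (br a b) w = - br w (br a b)" by (rule br_anti)
        also have "\<dots> = br a (br b w) + br b (br w a)"
          using jacobi[of a b w] by (metis add.commute add_eq_0_iff2 eq_neg_iff_add_eq_0)
        also have "br b (br w a) = - br b (br a w)"
          by (subst br_anti[of w a]) (rule linear_neg[OF br_linear(1)])
        finally show ?thesis by simp
      qed
      moreover have "br a (br b w) \<in> ?W (Suc i + j)"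
        using one[of "i + j" a "br b w"] IH[of j b w] ab Suc.prems by (simp split: if_splits)
      moreover have "br b (br a w) \<in> ?W (Suc i + j)"
        using IH[of "Suc j" b "br a w"] one[of j a w] ab Suc.prems by (simp split: if_splits)
      ultimately show "br (br a b) w \<in> ?W (Suc i + j)"
        using subspace_diff[OF subW[of "Suc i + j"]] by simp
    qed
    ultimately have "V (Suc i) \<subseteq> {u. br u w \<in> ?W (Suc i + j)}"
      unfolding V_Suc[OF i(1,2)] by (rule span_minimal[rotated])
    then show ?thesis using Suc.prems by auto
  qed
qed simp

text \<open>The bracket of layers \<open>i\<close> and \<open>j\<close> lies in layer
  \<open>i + j\<close> or vanishes, so the factor \<open>l ^ (i + j)\<close> splits over the two
  arguments.\<close>

lemma br_dil: "br (dl l x) (dl l y) = dl l (br x y)"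
proof -
  have "dl l (br x y) = dl l (\<Sum>i=1..m. \<Sum>j=1..m. br (lay x i) (lay y j))"
    by (subst br_sum[symmetric]) (simp add: sum_layers)
  also have "\<dots> = (\<Sum>i=1..m. \<Sum>j=1..m. dl l (br (lay x i) (lay y j)))"
    by (simp add: linear_sum[OF bounded_linear.linear[OF dil_bounded_linear]])
  also have "\<dots> = (\<Sum>i=1..m. \<Sum>j=1..m. br (l ^ i *s lay x i) (l ^ j *s lay y j))"
  proof (intro sum.cong refl)
    fix i j assume ij: "i \<in> {1..m}" "j \<in> {1..m}"
    have "br (lay x i) (lay y j) \<in> (if i + j \<le> m then V (i + j) else {0})"
      using br_graded[OF ij layer_in[OF ij(1)] layer_in[OF ij(2)]] .
    then have "dl l (br (lay x i) (lay y j)) = l ^ (i + j) *s br (lay x i) (lay y j)"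
      using ij dil_of_layer[of _ "i + j" l] by (auto simp: dil_0 split: if_splits)
    then show "dl l (br (lay x i) (lay y j)) = br (l ^ i *s lay x i) (l ^ j *s lay y j)"
      by (simp add: br_scale1 br_scale2 power_add mult.commute)
  qed
  also have "\<dots> = br (dl l x) (dl l y)"
    unfolding dil_eq by (rule br_sum[symmetric])
  finally show ?thesis by simp
qed

end

subsection \<open>Left-invariant vector fields\<close>

text \<open>Gronwall: with \<open>C\<close> bounding the norm of \<open>T\<close>, the squared
  distance of two solutions times \<open>exp (- 2 C t)\<close> is nonincreasing and vanishes at
  0.\<close>

lemma linear_ode_unique:
  fixes p q :: "real \<Rightarrow> 'a::euclidean_space"
  assumes T: "linear T"
    and p: "\<And>t. (p has_vector_derivative h - T (p t)) (at t)"
    and q: "\<And>t. (q has_vector_derivative h - T (q t)) (at t)"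
    and 0: "p 0 = q 0"
  shows "p 1 = q 1"
proof -
  define d where "d t = p t - q t" for t
  obtain C where C: "norm (T v) \<le> norm v * C" for v
    using T linear_conv_bounded_linear bounded_linear.bounded by blast
  have d: "(d has_vector_derivative - T (d t)) (at t)" for t
    unfolding d_def linear_diff[OF T]
    by (rule has_vector_derivative_eq_rhs[OF has_vector_derivative_diff[OF p q]]) simp
  define g where "g t = exp (- (2 * C * t)) * (d t \<bullet> d t)" for t
  have dd: "((\<lambda>t. d t \<bullet> d t) has_real_derivative 2 * (d t \<bullet> - T (d t))) (at t)" for t
    using bounded_bilinear.has_vector_derivative[OF bounded_bilinear_inner d d]
    by (simp add: has_real_derivative_iff_has_vector_derivative inner_commute)
  have g: "(g has_real_derivative exp (- (2 * C * t)) * (2 * (d t \<bullet> - T (d t))) - 2 * C * exp (- (2 * C * t)) * (d t \<bullet> d t)) (at t)" for t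
    unfolding g_def by (rule derivative_eq_intros dd refl)+ (simp add: algebra_simps)
  have "g 1 \<le> g 0"
  proof (rule DERIV_nonpos_imp_nonincreasing[of 0 1])
    fix t :: real
    have "d t \<bullet> - T (d t) \<le> norm (d t) * norm (T (d t))"
      using norm_cauchy_schwarz[of "d t" "- T (d t)"] by simp
    also have "\<dots> \<le> norm (d t) * (norm (d t) * C)" by (intro mult_left_mono C) auto
    finally have "d t \<bullet> - T (d t) \<le> C * (d t \<bullet> d t)"
      by (simp add: power2_norm_eq_inner[symmetric] power2_eq_square algebra_simps)
    then have "exp (- (2 * C * t)) * (2 * (d t \<bullet> - T (d t))) \<le> exp (- (2 * C * t)) * (2 * (C * (d t \<bullet> d t)))"
      by (intro mult_left_mono) auto
    then show "\<exists>y. (g has_real_derivative y) (at t) \<and> y \<le> 0"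
      using g[of t] by (intro exI conjI) (auto simp: algebra_simps)
  qed simp
  moreover have "g 0 = 0" by (simp add: g_def d_def 0)
  ultimately have "d 1 \<bullet> d 1 \<le> 0" by (simp add: g_def mult_le_0_iff)
  then have "d 1 = 0" by (metis antisym inner_ge_zero inner_eq_zero_iff)
  then show ?thesis by (simp add: d_def)
qed

text \<open>Product rule for a family of linear maps when only the maps
  \<open>w \<mapsto> T w h\<close> with fixed \<open>h\<close> are known to be smooth. The expansion
  in \<open>Basis\<close> requires that their derivatives depend linearly on \<open>h\<close>, which
  is \<open>Dg\<close>.\<close>

lemma has_derivative_linear_family:
  fixes T :: "'a::euclidean_space \<Rightarrow> 'b::euclidean_space \<Rightarrow> 'c::real_normed_vector"
  assumes lin: "\<And>w. linear (T w)" and sm: "\<And>h. smooth (\<lambda>w. T w h)"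
    and g: "(g has_derivative g') (at w)"
  shows "((\<lambda>w. T w (g w)) has_derivative (\<lambda>k. T w (g' k) + frechet_derivative (\<lambda>u. T u (g w)) (at w) k)) (at w)"
proof -
  let ?D = "\<lambda>h. frechet_derivative (\<lambda>u. T u h) (at w)"
  have D: "((\<lambda>u. T u h) has_derivative ?D h) (at w)" for h by (rule smooth_has_derivative[OF sm])
  have Dg: "?D h = (\<lambda>k. \<Sum>b\<in>Basis. (h \<bullet> b) *\<^sub>R ?D b k)" for h
  proof -
    have "((\<lambda>u. \<Sum>b\<in>Basis. (h \<bullet> b) *\<^sub>R T u b) has_derivative (\<lambda>k. \<Sum>b\<in>Basis. (h \<bullet> b) *\<^sub>R ?D b k)) (at w)"
      by (intro derivative_intros D)
    then have "((\<lambda>u. T u h) has_derivative (\<lambda>k. \<Sum>b\<in>Basis. (h \<bullet> b) *\<^sub>R ?D b k)) (at w)"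
      by (rule has_derivative_transform_within[where d = 1])
        (simp_all add: linear_apply_basis[OF lin, of _ h, symmetric])
    then show ?thesis by (rule frechet_derivative_at[symmetric])
  qed
  have eq: "(\<lambda>w. T w (g w)) = (\<lambda>w. \<Sum>b\<in>Basis. (g w \<bullet> b) *\<^sub>R T w b)"
    by (rule ext, rule linear_apply_basis[OF lin])
  have *: "((\<lambda>w. \<Sum>b\<in>Basis. (g w \<bullet> b) *\<^sub>R T w b) has_derivative
     (\<lambda>k. \<Sum>b\<in>Basis. (g w \<bullet> b) *\<^sub>R ?D b k + (g' k \<bullet> b) *\<^sub>R T w b)) (at w)"
    by (intro derivative_intros D g)
  have "(\<Sum>b\<in>Basis. (g w \<bullet> b) *\<^sub>R ?D b k + (g' k \<bullet> b) *\<^sub>R T w b) = T w (g' k) + ?D (g w) k" for k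
    unfolding sum.distrib fun_cong[OF Dg[of "g w"]]
    by (simp add: linear_apply_basis[OF lin, of w "g' k", symmetric])
  then show ?thesis
    unfolding eq by (intro has_derivative_eq_rhs[OF *]) simp
qed

text \<open>Cyclicity of the trace, used to cancel a dilation against its inverse inside a
  divergence.\<close>

lemma trace_commute:
  fixes S T :: "'a::euclidean_space \<Rightarrow> 'a"
  assumes "linear S" "linear T"
  shows "(\<Sum>b\<in>Basis. S (T b) \<bullet> b) = (\<Sum>b\<in>Basis. T (S b) \<bullet> b)"
proof -
  have "(\<Sum>b\<in>Basis. S (T b) \<bullet> b) = (\<Sum>b\<in>Basis. \<Sum>c\<in>Basis. (T b \<bullet> c) * (S c \<bullet> b))"
    by (subst linear_apply_basis[OF assms(1)]) (simp add: inner_sum_left)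
  also have "\<dots> = (\<Sum>c\<in>Basis. \<Sum>b\<in>Basis. (S c \<bullet> b) * (T b \<bullet> c))"
    by (subst sum.swap) (simp add: mult.commute)
  also have "\<dots> = (\<Sum>b\<in>Basis. T (S b) \<bullet> b)"
    by (subst (2) linear_apply_basis[OF assms(2)]) (simp add: inner_sum_left)
  finally show ?thesis .
qed

locale stratified_group = stratified_algebra br V m
  for br :: "complex^'n \<Rightarrow> complex^'n \<Rightarrow> complex^'n" and V :: "nat \<Rightarrow> (complex^'n) set" and m :: nat +
  fixes mul :: "complex^'n \<Rightarrow> complex^'n \<Rightarrow> complex^'n"
  assumes grp: "lie_group_exp_id br mul"
begin

abbreviation "L \<equiv> lvf mul"
abbreviation "Mul \<equiv> \<lambda>p. mul (fst p) (snd p)"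

text \<open>\<open>A z\<close> and \<open>N z\<close> are the differentials of left translation by \<open>z\<close> at \<open>0\<close> and of
  left translation by the inverse of \<open>z\<close> at \<open>z\<close>.\<close>

definition A :: "complex^'n \<Rightarrow> complex^'n \<Rightarrow> complex^'n" where
  "A z xi = frechet_derivative Mul (at (z, 0)) (0, xi)"

definition N :: "complex^'n \<Rightarrow> complex^'n \<Rightarrow> complex^'n" where
  "N z h = frechet_derivative Mul (at (- z, z)) (0, h)"

lemma mul_assoc: "mul (mul x y) z = mul x (mul y z)"
  and mul_0 [simp]: "mul 0 x = x" "mul x 0 = x" and mul_inv [simp]: "mul x (- x) = 0" "mul (- x) x = 0"
  and smooth_Mul: "smooth Mul" and mul_exp: "mul (s *\<^sub>R x) (t *\<^sub>R x) = (s + t) *\<^sub>R x"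
  and L_bracket: "smooth f \<Longrightarrow> (\<lambda>z. L xi (L eta f) z - L eta (L xi f) z) = L (br xi eta) f"
  using grp unfolding lie_group_exp_id_def by blast+

lemma mul_inv_cancel [simp]: "mul (- x) (mul x y) = y" "mul x (mul (- x) y) = y"
  by (simp_all add: mul_assoc[symmetric])

lemma smooth_mul: "smooth f \<Longrightarrow> smooth g \<Longrightarrow> smooth (\<lambda>z. mul (f z) (g z))"
  using smooth_compose[OF smooth_Mul smooth_Pair, of f g] by simp

lemma has_derivative_mul_left: "((\<lambda>y. mul w y) has_derivative (\<lambda>h. frechet_derivative Mul (at (w, y)) (0, h))) (at y)"
proof -
  have "((\<lambda>y. (w, y)) has_derivative (\<lambda>h. (0, h))) (at y)" by (intro derivative_intros)
  from has_derivative_compose[OF this smooth_has_derivative[OF smooth_Mul]] show ?thesis by simp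
qed

lemma linear_A: "linear (A z)" and linear_N: "linear (N z)"
  using has_derivative_mul_left[of z 0, THEN has_derivative_linear] has_derivative_mul_left[of "- z" z, THEN has_derivative_linear]
  by (simp_all add: A_def[abs_def] N_def[abs_def])

lemma smooth_A: "smooth (\<lambda>z. A z xi)" and smooth_N: "smooth (\<lambda>z. N z h)"
  unfolding A_def N_def
  by (intro smooth_derivative_apply smooth_Mul smooth_Pair smooth_const smooth_ident smooth_minus)+

lemma N_A: "N w (A w xi) = xi" and A_N: "A w (N w xi) = xi"
proof -
  have 1: "((\<lambda>y. mul w y) has_derivative A w) (at 0)" and 2: "((\<lambda>y. mul (- w) y) has_derivative N w) (at w)"
    using has_derivative_mul_left by (auto simp: A_def[abs_def] N_def[abs_def])
  have id: "((\<lambda>y. y) has_derivative (\<lambda>h. h)) (at y)" for y :: "complex^'n" by (rule has_derivative_ident)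
  have "((\<lambda>y. mul (- w) (mul w y)) has_derivative (\<lambda>h. N w (A w h))) (at 0)"
    by (rule has_derivative_compose[OF 1]) (simp add: 2)
  then show "N w (A w xi) = xi" using has_derivative_unique[OF _ id] by (simp, meson)
  have "((\<lambda>y. mul w (mul (- w) y)) has_derivative (\<lambda>h. A w (N w h))) (at w)"
    by (rule has_derivative_compose[OF 2]) (simp add: 1)
  then show "A w (N w xi) = xi" using has_derivative_unique[OF _ id] by (simp, meson)
qed

text \<open>After time \<open>t\<close> the curve continues as a left translate of the same
  one-parameter subgroup, so the velocity at time 0 from an arbitrary base point suffices.\<close>

lemma curve_deriv: "((\<lambda>t. mul z (t *\<^sub>R xi)) has_vector_derivative A (mul z (t *\<^sub>R xi)) xi) (at t)"
proof -
  have a: "((\<lambda>t. mul w (t *\<^sub>R xi)) has_vector_derivative A w xi) (at 0)" for w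
  proof -
    have "((\<lambda>t. t *\<^sub>R xi) has_derivative (\<lambda>t. t *\<^sub>R xi)) (at 0)"
      by (intro derivative_intros)
    moreover have "(mul w has_derivative A w) (at (0 *\<^sub>R xi))"
      using has_derivative_mul_left[of w 0] by (simp add: A_def[abs_def])
    ultimately have "((\<lambda>t. mul w (t *\<^sub>R xi)) has_derivative (\<lambda>t. A w (t *\<^sub>R xi))) (at 0)"
      by (rule has_derivative_compose)
    then show ?thesis by (simp add: has_vector_derivative_def linear_scale[OF linear_A])
  qed
  have "((\<lambda>s. mul (mul z (t *\<^sub>R xi)) ((s - t) *\<^sub>R xi)) has_vector_derivative A (mul z (t *\<^sub>R xi)) xi) (at t)"
    using vector_diff_chain_at[of "\<lambda>s. s - t" 1 t "\<lambda>s. mul (mul z (t *\<^sub>R xi)) (s *\<^sub>R xi)", OF _ ] a[of "mul z (t *\<^sub>R xi)"]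
    by (simp add: o_def has_vector_derivative_diff_const)
  then show ?thesis by (simp add: mul_assoc mul_exp)
qed

text \<open>The ray through \<open>z\<close> is a one-parameter subgroup,
  \<open>mul z (t z) = (1 + t) z\<close>, and its velocity at \<open>z\<close> is computed in both
  descriptions.\<close>

lemma A_self: "A z z = z"
proof -
  have "((\<lambda>t. mul z (t *\<^sub>R z)) has_vector_derivative A z z) (at 0)"
    using curve_deriv[of z z 0] by simp
  moreover have "mul z (t *\<^sub>R z) = (1 + t) *\<^sub>R z" for t using mul_exp[of 1 z t] by simp
  moreover have "((\<lambda>t. (1 + t) *\<^sub>R z) has_vector_derivative z) (at 0)"
    by (auto intro!: derivative_eq_intros simp: has_vector_derivative_def algebra_simps)
  ultimately show ?thesis using vector_derivative_unique_at by fastforce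
qed

lemma L_curve:
  assumes "f differentiable (at (mul z (t *\<^sub>R xi)))"
  shows "((\<lambda>t. f (mul z (t *\<^sub>R xi))) has_vector_derivative L xi f (mul z (t *\<^sub>R xi))) (at t)"
    and "L xi f (mul z (t *\<^sub>R xi)) = frechet_derivative f (at (mul z (t *\<^sub>R xi))) (A (mul z (t *\<^sub>R xi)) xi)"
proof -
  have *: "((\<lambda>t. f (mul w (t *\<^sub>R xi))) has_vector_derivative frechet_derivative f (at (mul w (t *\<^sub>R xi))) (A (mul w (t *\<^sub>R xi)) xi)) (at t)"
    if "f differentiable (at (mul w (t *\<^sub>R xi)))" for w t
    using has_derivative_compose[OF curve_deriv[unfolded has_vector_derivative_def] that[unfolded frechet_derivative_works]]
    by (simp add: has_vector_derivative_def linear_scale[OF linear_frechet_derivative[OF that]])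
  show 1: "L xi f (mul z (t *\<^sub>R xi)) = frechet_derivative f (at (mul z (t *\<^sub>R xi))) (A (mul z (t *\<^sub>R xi)) xi)"
    unfolding lvf_def using *[of "mul z (t *\<^sub>R xi)" 0] assms by (simp add: vector_derivative_at)
  show "((\<lambda>t. f (mul z (t *\<^sub>R xi))) has_vector_derivative L xi f (mul z (t *\<^sub>R xi))) (at t)"
    unfolding 1 by (rule *[OF assms])
qed

lemma L_eq: "f differentiable (at z) \<Longrightarrow> L xi f z = frechet_derivative f (at z) (A z xi)"
  using L_curve(2)[of f z 0 xi] by simp

lemma L_eq_derivative: "(f has_derivative f') (at z) \<Longrightarrow> L xi f z = f' (A z xi)"
  using L_eq[of f z xi] frechet_derivative_at by (metis differentiable_def)

lemma smooth_L: "smooth f \<Longrightarrow> smooth (L xi f)"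
proof -
  assume f: "smooth f"
  have "L xi f = (\<lambda>z. frechet_derivative f (at z) (A z xi))"
    using L_eq smooth_imp_differentiable[OF f] by blast
  then show ?thesis using smooth_derivative_apply[OF f smooth_ident smooth_A] by simp
qed

abbreviation "DA xi z \<equiv> frechet_derivative (\<lambda>u. A u xi) (at z)"

text \<open>The commutator axiom tested on the coordinate functions, for which \<open>L xi\<close>
  reads off a component of \<open>A z xi\<close>.\<close>

lemma A_bracket: "DA eta z (A z xi) - DA xi z (A z eta) = A z (br xi eta)"
proof (rule vec_eq_iff[THEN iffD2], rule allI)
  fix i
  let ?f = "\<lambda>z::complex^'n. z $ i"
  have bl: "bounded_linear ?f" by (rule bounded_linear_vec_nth)
  have f: "L xi ?f = (\<lambda>z. A z xi $ i)" for xi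
    by (rule ext, rule L_eq_derivative) (rule bounded_linear_imp_has_derivative[OF bl])
  have ff: "L xi (L eta ?f) z = DA eta z (A z xi) $ i" for xi eta
    unfolding f by (rule L_eq_derivative)
      (rule bounded_linear.has_derivative[OF bl smooth_has_derivative[OF smooth_A]])
  have "L xi (L eta ?f) z - L eta (L xi ?f) z = L (br xi eta) ?f z"
    using fun_cong[OF L_bracket[OF smooth_bounded_linear_ident[OF bl]]] .
  then show "(DA eta z (A z xi) - DA xi z (A z eta)) $ i = A z (br xi eta) $ i"
    unfolding ff by (simp add: f)
qed

text \<open>The classical differential equation behind
  \<open>N z = (1 - exp (- ad z)) / ad z\<close>; uniqueness of its solution replaces the
  Baker-Campbell-Hausdorff formula.\<close>

lemma N_ode: "((\<lambda>t. t *\<^sub>R N (t *\<^sub>R z) h) has_vector_derivative h - br z (t *\<^sub>R N (t *\<^sub>R z) h)) (at t)"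
proof -
  define w where "w = t *\<^sub>R z"
  define n where "n = N w h"
  let ?DN = "frechet_derivative (\<lambda>u. N u h) (at w)"
  have An: "A w n = h" by (simp add: n_def A_N)
  \<comment> \<open>This differentiates the constant \<open>N u (A u n) = n\<close>; the next claim
    differentiates \<open>A u u = u\<close>.\<close>
  have 1: "N w (DA n w k) + ?DN k = 0" for k
  proof -
    have "((\<lambda>u. N u (A u n)) has_derivative (\<lambda>k. N w (DA n w k) + frechet_derivative (\<lambda>u. N u (A w n)) (at w) k)) (at w)"
      by (rule has_derivative_linear_family[OF linear_N smooth_N smooth_has_derivative[OF smooth_A]])
    moreover have "((\<lambda>u. N u (A u n)) has_derivative (\<lambda>k. 0)) (at w)" by (simp add: N_A)
    ultimately show ?thesis unfolding An by (rule has_derivative_unique[THEN fun_cong])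
  qed
  have 2: "A w k + DA w w k = k" for k
  proof -
    have "((\<lambda>u. A u u) has_derivative (\<lambda>k. A w k + DA w w k)) (at w)"
      by (rule has_derivative_linear_family[OF linear_A smooth_A has_derivative_ident])
    moreover have "((\<lambda>u. A u u) has_derivative (\<lambda>k. k)) (at w)" by (simp add: A_self)
    ultimately show ?thesis by (rule has_derivative_unique[THEN fun_cong])
  qed
  \<comment> \<open>The bracket identity exchanges the fields generated by \<open>w\<close> and
    \<open>n\<close>, and the second claim then removes the remaining derivative of
    \<open>A\<close>.\<close>
  have "DA n w w = h - A w h - A w (br n w)"
    using A_bracket[of w w n] 2[of h] An by (simp add: A_self algebra_simps)
  then have "N w (DA n w w) = n - h - br n w"
    by (simp add: linear_diff[OF linear_N] N_A n_def)
  then have "?DN w = h - n + br n w" using 1[of w] by (simp add: algebra_simps add_eq_0_iff)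
  then have DN: "n + ?DN w = h - br w n" using br_anti[of n w] by simp
  have "((\<lambda>t. t *\<^sub>R z) has_derivative (\<lambda>s. s *\<^sub>R z)) (at t)" by (intro derivative_intros)
  from has_derivative_compose[OF this, of "\<lambda>u. N u h" ?DN]
  have "((\<lambda>t. N (t *\<^sub>R z) h) has_derivative (\<lambda>s. ?DN (s *\<^sub>R z))) (at t)"
    using smooth_has_derivative[OF smooth_N] by (simp add: w_def)
  then have "((\<lambda>t. t *\<^sub>R N (t *\<^sub>R z) h) has_derivative (\<lambda>s. t *\<^sub>R ?DN (s *\<^sub>R z) + s *\<^sub>R N (t *\<^sub>R z) h)) (at t)"
    by (intro derivative_intros)
  moreover have "t *\<^sub>R ?DN (s *\<^sub>R z) + s *\<^sub>R N (t *\<^sub>R z) h = s *\<^sub>R (h - br z (t *\<^sub>R N (t *\<^sub>R z) h))" for s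
  proof -
    have lin: "linear ?DN" using linear_frechet_derivative[OF smooth_imp_differentiable[OF smooth_N]] .
    have "t *\<^sub>R ?DN (s *\<^sub>R z) = s *\<^sub>R ?DN w"
      by (simp add: linear_scale[OF lin]) (simp add: w_def linear_scale[OF lin[unfolded w_def]])
    moreover have "br z (t *\<^sub>R N (t *\<^sub>R z) h) = br w n"
      by (simp add: w_def n_def linear_scale[OF br_linear(1)] linear_scale[OF br_linear(2)])
    ultimately show ?thesis using DN
      by (simp add: n_def w_def[symmetric] scaleR_right_distrib[symmetric] add.commute del: scaleR_right_distrib)
  qed
  ultimately show ?thesis unfolding has_vector_derivative_def by simp
qed

text \<open>\<open>T\<close> intertwines \<open>ad z\<close> with \<open>ad w\<close>, hence maps
  the solution of the equation for \<open>z\<close> and \<open>h\<close> to a solution of the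
  equation for \<open>w\<close> and \<open>T h\<close>. Both start at 0, and they are compared at
  time 1.\<close>

lemma N_equivariant:
  assumes T: "linear T" and br: "\<And>y. br w (T y) = T (br z y)"
  shows "N w (T h) = T (N z h)"
proof -
  have "bounded_linear T" using T linear_conv_bounded_linear by blast
  then have "((\<lambda>t. T (t *\<^sub>R N (t *\<^sub>R z) h)) has_vector_derivative T (h - br z (t *\<^sub>R N (t *\<^sub>R z) h))) (at t)" for t
    using bounded_linear.has_vector_derivative N_ode by blast
  then have "((\<lambda>t. T (t *\<^sub>R N (t *\<^sub>R z) h)) has_vector_derivative T h - br w (T (t *\<^sub>R N (t *\<^sub>R z) h))) (at t)" for t
    by (simp only: br linear_diff[OF T])
  from linear_ode_unique[OF br_linear(1) N_ode this] show ?thesis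
    by (simp add: linear_0[OF T])
qed

lemma A_equivariant:
  assumes T: "linear T" and br: "\<And>y. br w (T y) = T (br z y)"
  shows "A w (T h) = T (A z h)"
  by (metis A_N N_A N_equivariant[OF assms])

text \<open>Take \<open>T\<close> to be multiplication by \<open>c\<close> and \<open>w = z\<close>:
  complex bilinearity of the bracket makes the differentials of left translations at the identity
  complex linear. This is how the complex structure of the group is recovered.\<close>

lemma A_vec_scale: "A z (c *s xi) = c *s A z xi"
  by (rule A_equivariant[of "\<lambda>v. c *s v"])
    (auto simp: bounded_linear.linear[OF bounded_linear_vec_scale2] br_scale2)

lemma A_dil: "A (dl l z) (dl l xi) = dl l (A z xi)"
  by (rule A_equivariant) (auto simp: bounded_linear.linear[OF dil_bounded_linear] br_dil)

lemma A_dil_V1: "xi \<in> V 1 \<Longrightarrow> l \<noteq> 0 \<Longrightarrow> A (dl l z) xi = inverse l *s dl l (A z xi)"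
  using A_dil[of l z xi] by (simp add: dil_V1 A_vec_scale) (metis left_inverse vec.scale_one vec.scale_scale)

text \<open>Euclidean divergence at \<open>z\<close> of the left-invariant field generated by
  \<open>xi\<close>.\<close>

definition divA :: "complex^'n \<Rightarrow> complex^'n \<Rightarrow> real" where
  "divA xi z = (\<Sum>b\<in>Basis. DA xi z b \<bullet> b)"

text \<open>The field equals \<open>l\<close> times its conjugate by the dilation, because
  \<open>xi\<close> lies in \<open>V 1\<close>; conjugation leaves the trace of the derivative
  unchanged.\<close>

lemma divA_scaling:
  assumes "xi \<in> V 1" "l > 0"
  shows "divA xi z = l * divA xi (dl (of_real l) z)"
proof -
  let ?d = "dl (of_real l)" and ?e = "dl (inverse (of_real l))"
  have l: "of_real l \<noteq> (0::complex)" using assms by simp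
  have lin: "linear (DA xi w)" for w
    using linear_frechet_derivative[OF smooth_imp_differentiable[OF smooth_A]] .
  have ld: "linear ?d" "linear ?e" using dil_bounded_linear bounded_linear.linear by blast+
  have eq: "A z xi = l *\<^sub>R ?e (A (?d z) xi)" for z
    using l by (simp add: A_dil_V1[OF assms(1) l] scaleR_eq_vec_scale dil_vec_scale dil_inverse(1)[OF l])
  have "((\<lambda>z. l *\<^sub>R ?e (A (?d z) xi)) has_derivative (\<lambda>h. l *\<^sub>R ?e (DA xi (?d z) (?d h)))) (at z)"
    by (intro derivative_intros bounded_linear.has_derivative[OF dil_bounded_linear]
        has_derivative_compose[OF bounded_linear_imp_has_derivative[OF dil_bounded_linear] smooth_has_derivative[OF smooth_A]])
  then have "((\<lambda>z. A z xi) has_derivative (\<lambda>h. l *\<^sub>R ?e (DA xi (?d z) (?d h)))) (at z)"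
    by (simp only: eq[symmetric])
  then have "DA xi z = (\<lambda>h. l *\<^sub>R ?e (DA xi (?d z) (?d h)))" by (rule frechet_derivative_at[symmetric])
  then have "divA xi z = l * (\<Sum>b\<in>Basis. ?e (DA xi (?d z) (?d b)) \<bullet> b)"
    by (simp add: divA_def sum_distrib_left)
  also have "(\<Sum>b\<in>Basis. ?e (DA xi (?d z) (?d b)) \<bullet> b) = (\<Sum>b\<in>Basis. DA xi (?d z) (?d (?e b)) \<bullet> b)"
    using trace_commute[OF ld(2) linear_compose[OF ld(1) lin[of "?d z"]]] by (simp add: o_def)
  finally show ?thesis by (simp only: dil_inverse(2)[OF l] divA_def)
qed

text \<open>In the scaling relation the left side does not depend on \<open>l\<close>, while the
  right side tends to 0 with \<open>l\<close>. Horizontal fields are thus divergence-free, the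
  infinitesimal invariance of Lebesgue measure on which integration by parts rests.\<close>

lemma divA_zero:
  assumes "xi \<in> V 1" shows "divA xi z = 0"
proof -
  have "continuous_on UNIV (divA xi)"
    unfolding divA_def
    by (intro continuous_intros smooth_continuous_on smooth_frechet_derivative smooth_A)
  then have c: "continuous_on UNIV (\<lambda>l. l * divA xi (dl (of_real l) z))"
    by (intro continuous_intros continuous_on_compose2[where s = UNIV and g = "divA xi"]) auto
  have "((\<lambda>l. l * divA xi (dl (of_real l) z)) \<longlongrightarrow> 0 * divA xi (dl (of_real 0) z)) (at_right 0)"
    using c[unfolded continuous_on_def, rule_format, OF UNIV_I, of 0] by (rule tendsto_within_subset) simp
  moreover have "\<forall>\<^sub>F l in at_right 0. l * divA xi (dl (of_real l) z) = divA xi z"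
    unfolding eventually_at_right_field
    by (intro exI[of _ 1]) (use divA_scaling[OF assms, symmetric] in simp)
  ultimately have "((\<lambda>l::real. divA xi z) \<longlongrightarrow> 0 * divA xi (dl (of_real 0) z)) (at_right 0)"
    by (rule Lim_transform_eventually)
  then show ?thesis by (simp add: tendsto_const_iff)
qed

end

subsection \<open>Test functions and differentiation under the integral sign\<close>

lemma Cc_inf_smooth: "Cc_inf f \<Longrightarrow> smooth f"
  by (simp add: Cc_inf_def)

lemma Cc_inf_support:
  assumes "Cc_inf f"
  obtains K where "compact K" "\<And>z. z \<notin> K \<Longrightarrow> f z = 0"
  using assms closure_subset[of "{z. f z \<noteq> 0}"] unfolding Cc_inf_def by blast

lemma Cc_infI:
  assumes "smooth f" "compact K" "\<And>z. z \<notin> K \<Longrightarrow> f z = 0"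
  shows "Cc_inf f"
proof -
  have "closure {z. f z \<noteq> 0} \<subseteq> K"
    using assms by (intro closure_minimal compact_imp_closed) auto
  then show ?thesis
    using assms(1) compact_Int_closed[OF assms(2), of "closure {z. f z \<noteq> 0}"]
    by (simp add: Cc_inf_def Int_absorb1)
qed

lemma Cc_inf_mult_left: "Cc_inf f \<Longrightarrow> smooth g \<Longrightarrow> Cc_inf (\<lambda>z. g z * f z)"
  by (rule Cc_inf_support, assumption, rule Cc_infI) (auto intro: smooth_mult Cc_inf_smooth)

lemma Cc_inf_mult_right: "Cc_inf f \<Longrightarrow> smooth g \<Longrightarrow> Cc_inf (\<lambda>z. f z * g z)"
  using Cc_inf_mult_left[of f g] by (simp add: mult.commute)

lemma Cc_inf_cnj: "Cc_inf f \<Longrightarrow> Cc_inf (\<lambda>z. cnj (f z))"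
  by (rule Cc_inf_support, assumption, rule Cc_infI) (auto intro: smooth_cnj Cc_inf_smooth)

lemma Cc_inf_add: "Cc_inf f \<Longrightarrow> Cc_inf g \<Longrightarrow> Cc_inf (\<lambda>z. f z + g z)"
proof -
  assume fg: "Cc_inf f" "Cc_inf g"
  obtain K where K: "compact K" "\<And>z. z \<notin> K \<Longrightarrow> f z = 0" by (rule Cc_inf_support[OF fg(1)]) blast
  obtain K' where K': "compact K'" "\<And>z. z \<notin> K' \<Longrightarrow> g z = 0" by (rule Cc_inf_support[OF fg(2)]) blast
  show ?thesis
    by (rule Cc_infI[of _ "K \<union> K'"]) (use K K' smooth_add[OF Cc_inf_smooth[OF fg(1)] Cc_inf_smooth[OF fg(2)]] in auto)
qed

lemma Cc_inf_diff: "Cc_inf f \<Longrightarrow> Cc_inf g \<Longrightarrow> Cc_inf (\<lambda>z. f z - g z)"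
  using Cc_inf_add[of f "\<lambda>z. - 1 * g z"] Cc_inf_mult_left[OF _ smooth_const, of g "- 1"] by simp

lemma Cc_inf_compose:
  assumes "Cc_inf f" "smooth g" "continuous_on UNIV h" "\<And>z. h (g z) = z"
  shows "Cc_inf (\<lambda>z. f (g z))"
proof -
  obtain K where K: "compact K" "\<And>z. z \<notin> K \<Longrightarrow> f z = 0" by (rule Cc_inf_support[OF assms(1)]) blast
  show ?thesis
  proof (rule Cc_infI)
    show "smooth (\<lambda>z. f (g z))" using smooth_compose[of f g] Cc_inf_smooth[OF assms(1)] assms(2) by simp
    show "compact (h ` K)" using K(1) assms(3) by (meson compact_continuous_image continuous_on_subset subset_UNIV)
    show "f (g z) = 0" if "z \<notin> h ` K" for z using that K(2) assms(4) by (metis imageI)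
  qed
qed

lemma frechet_derivative_outside_support:
  assumes "closed K" "\<And>z. z \<notin> K \<Longrightarrow> f z = 0" "z \<notin> K"
  shows "frechet_derivative f (at z) = (\<lambda>v. 0)"
proof -
  have "((\<lambda>z. 0) has_derivative (\<lambda>v. 0)) (at z)" by simp
  then have "(f has_derivative (\<lambda>v. 0)) (at z)"
    by (rule has_derivative_transform_within_open[of _ _ _ _ "- K"]) (use assms in auto)
  then show ?thesis by (metis frechet_derivative_at)
qed

lemma Cc_inf_derivative_apply:
  assumes "Cc_inf f" "smooth h"
  shows "Cc_inf (\<lambda>z. frechet_derivative f (at z) (h z))"
proof -
  obtain K where K: "compact K" "\<And>z. z \<notin> K \<Longrightarrow> f z = 0" by (rule Cc_inf_support[OF assms(1)]) blast
  show ?thesis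
    by (rule Cc_infI[OF _ K(1)])
      (use frechet_derivative_outside_support[OF compact_imp_closed[OF K(1)] K(2)] assms in
        \<open>auto intro: smooth_derivative_apply[OF Cc_inf_smooth smooth_ident]\<close>)
qed

lemma continuous_compact_support_bounded:
  fixes f :: "'a::metric_space \<Rightarrow> 'b::real_normed_vector"
  assumes "continuous_on UNIV f" "compact K" "\<And>z. z \<notin> K \<Longrightarrow> f z = 0"
  obtains B where "B > 0" "\<And>z. norm (f z) \<le> B"
proof -
  have "bounded (f ` K)"
    using assms by (meson compact_continuous_image compact_imp_bounded continuous_on_subset subset_UNIV)
  then obtain B where "B > 0" "\<And>z. z \<in> K \<Longrightarrow> norm (f z) \<le> B" by (auto simp: bounded_pos)
  then show thesis using assms(3) that[of B] by (metis less_imp_le norm_zero)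
qed

lemma Cc_inf_bounded:
  assumes "Cc_inf f" obtains B where "B > 0" "\<And>z. cmod (f z) \<le> B"
  using Cc_inf_support[OF assms] continuous_compact_support_bounded[of f] smooth_continuous_on[OF Cc_inf_smooth[OF assms]]
  by metis

lemma smooth_borel_measurable: "smooth f \<Longrightarrow> f \<in> borel_measurable borel"
  using borel_measurable_continuous_onI smooth_continuous_on by blast

lemma Cc_inf_borel_measurable: "Cc_inf f \<Longrightarrow> f \<in> borel_measurable borel"
  by (intro smooth_borel_measurable Cc_inf_smooth)

lemma has_vector_derivative_quotient:
  fixes f :: "real \<Rightarrow> 'a::real_normed_vector"
  shows "(f has_vector_derivative f') (at x) \<longleftrightarrow> ((\<lambda>t. (f t - f x) /\<^sub>R (t - x)) \<longlongrightarrow> f') (at x)"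
proof -
  have eq: "norm ((f t - f x) - (t - x) *\<^sub>R f') / norm (t - x) = norm ((f t - f x) /\<^sub>R (t - x) - f')" if "t \<noteq> x" for t
  proof -
    have "(f t - f x) /\<^sub>R (t - x) - f' = ((f t - f x) - (t - x) *\<^sub>R f') /\<^sub>R (t - x)"
      using that by (simp add: scaleR_diff_right)
    then show ?thesis by (simp add: divide_inverse mult.commute)
  qed
  have "((\<lambda>t. norm ((f t - f x) - (t - x) *\<^sub>R f') / norm (t - x)) \<longlongrightarrow> 0) (at x) \<longleftrightarrow>
      ((\<lambda>t. norm ((f t - f x) /\<^sub>R (t - x) - f')) \<longlongrightarrow> 0) (at x)"
    by (rule filterlim_cong[OF refl refl]) (simp add: eventually_at_filter eq[simplified])
  then show ?thesis
    unfolding has_vector_derivative_def has_derivative_iff_norm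
    by (simp add: bounded_linear_scaleR_left tendsto_norm_zero_iff LIM_zero_iff)
qed

text \<open>Dominated convergence for difference quotients, which the mean value inequality bounds
  by \<open>G\<close>. The domination is required for all \<open>t\<close>, so the parametrisations
  used later have to be controlled globally in time.\<close>

lemma has_vector_derivative_integral:
  fixes F F' :: "real \<Rightarrow> 'b \<Rightarrow> 'c::{banach,second_countable_topology}"
  assumes int: "\<And>t. integrable M (F t)"
    and der: "\<And>t y. y \<in> space M \<Longrightarrow> ((\<lambda>t. F t y) has_vector_derivative F' t y) (at t)"
    and bd: "\<And>t y. y \<in> space M \<Longrightarrow> norm (F' t y) \<le> G y" and G: "integrable M G"
    and meas: "F' t0 \<in> borel_measurable M"
  shows "((\<lambda>t. integral\<^sup>L M (F t)) has_vector_derivative integral\<^sup>L M (F' t0)) (at t0)"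
proof -
  let ?q = "\<lambda>t y. (F t y - F t0 y) /\<^sub>R (t - t0)"
  have lim: "((\<lambda>t. integral\<^sup>L M (?q t)) \<longlongrightarrow> integral\<^sup>L M (F' t0)) (at t0)"
    unfolding tendsto_at_iff_sequentially comp_def
  proof (intro allI impI)
    fix X assume X: "\<forall>i. X i \<in> UNIV - {t0}" "X \<longlonglongrightarrow> t0"
    show "(\<lambda>i. integral\<^sup>L M (?q (X i))) \<longlonglongrightarrow> integral\<^sup>L M (F' t0)"
    proof (rule integral_dominated_convergence[where w = G])
      show "?q (X i) \<in> borel_measurable M" for i
        using int[of "X i"] int[of t0] by (auto dest: borel_measurable_integrable)
      show "AE y in M. (\<lambda>i. ?q (X i) y) \<longlonglongrightarrow> F' t0 y"
      proof (rule AE_I2)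
        fix y assume "y \<in> space M"
        from der[OF this, of t0] have "((\<lambda>t. ?q t y) \<longlongrightarrow> F' t0 y) (at t0)"
          by (simp add: has_vector_derivative_quotient)
        then show "(\<lambda>i. ?q (X i) y) \<longlonglongrightarrow> F' t0 y"
          using X unfolding tendsto_at_iff_sequentially comp_def by blast
      qed
      show "AE y in M. norm (?q (X i) y) \<le> G y" for i
      proof (rule AE_I2)
        fix y assume y: "y \<in> space M"
        have "norm (F (X i) y - F t0 y) \<le> G y * norm (X i - t0)"
          using der[OF y] bd[OF y]
          by (intro differentiable_bound[where S = UNIV and f' = "\<lambda>t h. h *\<^sub>R F' t y"])
            (auto simp: has_vector_derivative_def mult.commute[of _ "\<bar>_\<bar>"] intro!: onorm_le mult_left_mono)
        then show "norm (?q (X i) y) \<le> G y"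
          using X(1)[rule_format, of i] by (simp add: divide_simps mult.commute)
      qed
    qed (use meas G in auto)
  qed
  have "integral\<^sup>L M (?q t) = (integral\<^sup>L M (F t) - integral\<^sup>L M (F t0)) /\<^sub>R (t - t0)" for t
    using int by simp
  then show ?thesis using lim by (simp only: has_vector_derivative_quotient)
qed

lemma integrable_indicator_compact:
  fixes K :: "'a::euclidean_space set"
  shows "compact K \<Longrightarrow> integrable lborel (\<lambda>z. indicator K z * (B::real))"
  using emeasure_compact_finite[of K]
  by (intro integrable_mult_left integrable_real_indicator) (auto simp: borel_compact)

lemma Cc_inf_integrable_lborel:
  assumes "Cc_inf f" shows "integrable lborel f"
proof -
  obtain K where K: "compact K" "\<And>z. z \<notin> K \<Longrightarrow> f z = 0" by (rule Cc_inf_support[OF assms]) blast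
  obtain B where "B > 0" and B: "\<And>z. cmod (f z) \<le> B" by (rule Cc_inf_bounded[OF assms]) blast
  show ?thesis
  proof (rule Bochner_Integration.integrable_bound[of _ "\<lambda>z. indicator K z * B"])
    show "integrable lborel (\<lambda>z. indicator K z * B)"
      by (rule integrable_indicator_compact[OF K(1)])
    show "AE z in lborel. norm (f z) \<le> norm (indicator K z * B)"
      using B K(2) by (auto simp: indicator_def intro!: order_trans[OF B])
  qed (use Cc_inf_borel_measurable[OF assms] in simp)
qed

text \<open>Translation invariance makes the integral of \<open>f (z + s e)\<close> constant in
  \<open>s\<close>. The shift is taken as \<open>s = sin t\<close>, which is bounded and has
  derivative 1 at 0, so one compact set carries the derivatives for all \<open>t\<close>, as the
  domination demands.\<close>

lemma integral_directional_derivative_zero: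
  fixes f :: "complex^'n \<Rightarrow> complex"
  assumes "Cc_inf f"
  shows "integral\<^sup>L lborel (\<lambda>z. frechet_derivative f (at z) e) = 0"
proof -
  let ?D = "\<lambda>z. frechet_derivative f (at z) e"
  obtain K where K: "compact K" "\<And>z. z \<notin> K \<Longrightarrow> f z = 0" by (rule Cc_inf_support[OF assms]) blast
  have D: "Cc_inf ?D" by (rule Cc_inf_derivative_apply[OF assms smooth_const])
  obtain B where B: "B > 0" "\<And>z. cmod (?D z) \<le> B" by (rule Cc_inf_bounded[OF D]) blast
  define K' where "K' = (\<lambda>(t, z). z - sin t *\<^sub>R e) ` ({-pi..pi} \<times> K)"
  have "compact K'" unfolding K'_def split_beta
    by (intro compact_continuous_image compact_Times K continuous_intros) auto
  have K': "?D (z + sin t *\<^sub>R e) = 0" if "z \<notin> K'" for z t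
  proof -
    \<comment> \<open>This angle has the same sine as \<open>t\<close> and reduces arbitrary
      \<open>t\<close> to the compact parameter interval.\<close>
    have t': "arcsin (sin t) \<in> {-pi..pi}" "sin (arcsin (sin t)) = sin t"
      using arcsin_bounded[of "sin t"] by (auto intro: order_trans)
    have "z + sin t *\<^sub>R e \<notin> K"
    proof
      assume "z + sin t *\<^sub>R e \<in> K"
      then have "z \<in> K'" unfolding K'_def using t' by (intro image_eqI[of _ _ "(arcsin (sin t), z + sin t *\<^sub>R e)"]) auto
      then show False using that by simp
    qed
    then show ?thesis
      using frechet_derivative_outside_support[OF compact_imp_closed[OF K(1)] K(2)] by simp
  qed
  have c: "integral\<^sup>L lborel (\<lambda>z. f (z + sin t *\<^sub>R e)) = integral\<^sup>L lborel f" for t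
    by (subst (2) lborel_distr_plus[of "sin t *\<^sub>R e", symmetric], subst integral_distr)
      (use Cc_inf_borel_measurable[OF assms] in \<open>auto simp: add.commute\<close>)
  have "((\<lambda>t. integral\<^sup>L lborel (\<lambda>z. f (z + sin t *\<^sub>R e))) has_vector_derivative integral\<^sup>L lborel (\<lambda>z. (\<lambda>t z. cos t *\<^sub>R ?D (z + sin t *\<^sub>R e)) 0 z)) (at 0)"
  proof (rule has_vector_derivative_integral[where G = "\<lambda>z. indicator K' z * B"])
    show "integrable lborel (\<lambda>z. f (z + sin t *\<^sub>R e))" for t
      by (rule Cc_inf_integrable_lborel, rule Cc_inf_compose[OF assms, where h = "\<lambda>z. z - sin t *\<^sub>R e"])
        (auto intro!: smooth_add smooth_ident smooth_const continuous_intros)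
    show "((\<lambda>t. f (z + sin t *\<^sub>R e)) has_vector_derivative cos t *\<^sub>R ?D (z + sin t *\<^sub>R e)) (at t)" for t z
    proof -
      have "((\<lambda>t. z + sin t *\<^sub>R e) has_derivative (\<lambda>s. s *\<^sub>R (cos t *\<^sub>R e))) (at t)"
        by (auto intro!: derivative_eq_intros simp: algebra_simps)
      from has_derivative_compose[OF this smooth_has_derivative[OF Cc_inf_smooth[OF assms]]]
      show ?thesis
        unfolding has_vector_derivative_def
        by (simp add: linear_scale[OF linear_frechet_derivative[OF smooth_imp_differentiable[OF Cc_inf_smooth[OF assms]]]])
    qed
    show "norm (cos t *\<^sub>R ?D (z + sin t *\<^sub>R e)) \<le> indicator K' z * B" for t z
    proof (cases "z \<in> K'")
      case True
      have "\<bar>cos t\<bar> * cmod (?D (z + sin t *\<^sub>R e)) \<le> 1 * B"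
        by (intro mult_mono B abs_cos_le_one) auto
      then show ?thesis using True by simp
    qed (simp add: K')
    show "integrable lborel (\<lambda>z. indicator K' z * B)"
      by (rule integrable_indicator_compact[OF \<open>compact K'\<close>])
    show "(\<lambda>z. cos 0 *\<^sub>R ?D (z + sin 0 *\<^sub>R e)) \<in> borel_measurable lborel"
      using Cc_inf_borel_measurable[OF D] by simp
  qed
  then have "((\<lambda>t::real. integral\<^sup>L lborel f) has_vector_derivative integral\<^sup>L lborel ?D) (at 0)"
    by (simp add: c)
  then show ?thesis
    using vector_derivative_unique_at has_vector_derivative_const by blast
qed

section \<open>Left-invariant derivatives: product rules, integration, integral curves\<close>

context stratified_group begin

lemma Cc_inf_L: "Cc_inf f \<Longrightarrow> Cc_inf (L xi f)"
proof -
  assume f: "Cc_inf f"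
  have "L xi f = (\<lambda>z. frechet_derivative f (at z) (A z xi))"
    using L_eq smooth_imp_differentiable[OF Cc_inf_smooth[OF f]] by blast
  then show ?thesis using Cc_inf_derivative_apply[OF f smooth_A] by simp
qed

lemma L_add: "smooth f \<Longrightarrow> smooth g \<Longrightarrow> L xi (\<lambda>z. f z + g z) z = L xi f z + L xi g z"
  by (subst L_eq_derivative) (auto intro!: has_derivative_add smooth_has_derivative simp: L_eq smooth_imp_differentiable)

lemma L_diff: "smooth f \<Longrightarrow> smooth g \<Longrightarrow> L xi (\<lambda>z. f z - g z) z = L xi f z - L xi g z"
  by (subst L_eq_derivative) (auto intro!: has_derivative_diff smooth_has_derivative simp: L_eq smooth_imp_differentiable)

lemma L_cmult: "smooth f \<Longrightarrow> L xi (\<lambda>z. c * f z) z = c * L xi f z"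
  by (subst L_eq_derivative) (auto intro!: has_derivative_mult_right smooth_has_derivative simp: L_eq smooth_imp_differentiable)

lemma L_mult: "smooth f \<Longrightarrow> smooth g \<Longrightarrow> L xi (\<lambda>z. f z * g z) z = f z * L xi g z + L xi f z * g z"
  by (subst L_eq_derivative) (auto intro!: has_derivative_mult smooth_has_derivative simp: L_eq smooth_imp_differentiable)

lemma L_cnj: "smooth f \<Longrightarrow> L xi (\<lambda>z. cnj (f z)) z = cnj (L xi f z)"
  by (subst L_eq_derivative) (auto intro!: has_derivative_cnj smooth_has_derivative simp: L_eq smooth_imp_differentiable)

lemma L_vec_add: "smooth f \<Longrightarrow> L (xi + eta) f z = L xi f z + L eta f z"
  by (simp add: L_eq smooth_imp_differentiable linear_add[OF linear_A] linear_add[OF linear_frechet_derivative])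

lemma L_vec_scaleR: "smooth f \<Longrightarrow> L (c *\<^sub>R xi) f z = c *\<^sub>R L xi f z"
  by (simp add: L_eq smooth_imp_differentiable linear_scale[OF linear_A] linear_scale[OF linear_frechet_derivative])

lemma L_i_holo: "holo f \<Longrightarrow> L (\<i> *s xi) f z = \<i> * L xi f z"
  using holoD(1)[of f z] by (simp add: L_eq differentiable_def[of f] exI A_vec_scale holoD(2) smooth_imp_differentiable holo_imp_smooth)

lemma L_dil:
  assumes "smooth f"
  shows "L xi (\<lambda>z. f (dl l z)) z = L (dl l xi) f (dl l z)"
proof -
  have "((\<lambda>z. f (dl l z)) has_derivative (\<lambda>h. frechet_derivative f (at (dl l z)) (dl l h))) (at z)"
    by (rule has_derivative_compose[OF bounded_linear_imp_has_derivative[OF dil_bounded_linear] smooth_has_derivative[OF assms]])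
  then show ?thesis
    by (simp add: L_eq_derivative A_dil L_eq smooth_imp_differentiable[OF assms])
qed

lemma smooth_dil: "smooth f \<Longrightarrow> smooth (\<lambda>z. f (dl l z))"
  by (rule smooth_compose[of f "dl l"]) (auto intro: smooth_bounded_linear_ident dil_bounded_linear)

lemma Cc_inf_dil: "Cc_inf f \<Longrightarrow> l \<noteq> 0 \<Longrightarrow> Cc_inf (\<lambda>z. f (dl l z))"
  by (rule Cc_inf_compose[where h = "dl (inverse l)"])
    (auto intro: smooth_bounded_linear_ident dil_bounded_linear linear_continuous_on simp: dil_inverse)

text \<open>As the field is divergence-free, \<open>L xi f\<close> is the divergence of
  \<open>f\<close> times the field, and each coordinate contribution integrates to 0.\<close>

lemma integral_L_zero:
  assumes f: "Cc_inf f" and xi: "xi \<in> V 1"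
  shows "integral\<^sup>L lborel (L xi f) = 0"
proof -
  have sf: "smooth f" by (rule Cc_inf_smooth[OF f])
  let ?g = "\<lambda>b z. complex_of_real (A z xi \<bullet> b) * f z"
  have sA: "smooth (\<lambda>z. complex_of_real (A z xi \<bullet> b))" for b
    by (intro smooth_of_real smooth_bounded_linear[OF bounded_linear_inner_left] smooth_A)
  have g: "Cc_inf (?g b)" for b by (rule Cc_inf_mult_left[OF f sA])
  have dg: "(?g b has_derivative (\<lambda>h. of_real (A z xi \<bullet> b) * frechet_derivative f (at z) h + of_real (DA xi z h \<bullet> b) * f z)) (at z)" for b z
    by (intro has_derivative_mult smooth_has_derivative[OF sf] has_derivative_of_real has_derivative_inner_left smooth_has_derivative[OF smooth_A])
  have fd: "frechet_derivative (?g b) (at z) b = of_real (A z xi \<bullet> b) * frechet_derivative f (at z) b + of_real (DA xi z b \<bullet> b) * f z" for b z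
    by (rule fun_cong[OF frechet_derivative_at[OF dg[of b z], symmetric]])
  have "(\<Sum>b\<in>Basis. frechet_derivative (?g b) (at z) b) = L xi f z" for z
  proof -
    have "(\<Sum>b\<in>Basis. frechet_derivative (?g b) (at z) b) = L xi f z + of_real (divA xi z) * f z"
      unfolding fd sum.distrib
      by (simp add: L_eq smooth_imp_differentiable[OF sf] divA_def sum_distrib_right scaleR_conv_of_real[symmetric]
          linear_apply_basis[OF linear_frechet_derivative[OF smooth_imp_differentiable[OF sf]], of z "A z xi"])
    then show ?thesis by (simp add: divA_zero[OF xi])
  qed
  then have "integral\<^sup>L lborel (L xi f) = integral\<^sup>L lborel (\<lambda>z. \<Sum>b\<in>Basis. frechet_derivative (?g b) (at z) b)"
    by simp
  also have "\<dots> = (\<Sum>b\<in>Basis. integral\<^sup>L lborel (\<lambda>z. frechet_derivative (?g b) (at z) b))"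
    by (intro Bochner_Integration.integral_sum Cc_inf_integrable_lborel Cc_inf_derivative_apply g smooth_const)
  also have "\<dots> = 0" by (simp add: integral_directional_derivative_zero[OF g])
  finally show ?thesis .
qed

lemma neg_mul: "- mul x y = mul (- y) (- x)"
proof -
  have "mul (mul (- y) (- x)) (mul x y) = 0"
    by (simp add: mul_assoc)
  then have "mul (mul (mul (- y) (- x)) (mul x y)) (- mul x y) = - mul x y" by (simp del: mul_inv_cancel)
  then show ?thesis by (simp only: mul_assoc[of "mul (- y) (- x)"] mul_inv mul_0)
qed

text \<open>Multiplying \<open>c t\<close> on the right by \<open>- (t *\<^sub>R eta)\<close> gives
  a curve with derivative 0.\<close>

lemma integral_curve_unique:
  assumes "\<And>t. (c has_vector_derivative A (c t) eta) (at t)"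
  shows "c t = mul (c 0) (t *\<^sub>R eta)"
proof -
  let ?M = "\<lambda>a b. frechet_derivative Mul (at (a, b))"
  have M: "(Mul has_derivative ?M a b) (at (a, b))" for a b by (rule smooth_has_derivative[OF smooth_Mul])
  have lin: "linear (?M a b)" for a b using M has_derivative_linear by blast
  \<comment> \<open>The product of \<open>w\<close>, \<open>s eta\<close> and \<open>- t eta\<close>
    can be grouped as \<open>(w, s eta)\<close> times \<open>- t eta\<close> or as \<open>w\<close>
    times \<open>(s - t) eta\<close>; differentiating at \<open>s = 0\<close> identifies the two
    partial derivatives of \<open>Mul\<close>.\<close>
  have key: "?M w (- (t *\<^sub>R eta)) (A w eta, 0) = ?M w (- (t *\<^sub>R eta)) (0, eta)" for w t
  proof -
    have "((\<lambda>s. (mul w (s *\<^sub>R eta), - (t *\<^sub>R eta))) has_derivative (\<lambda>h. (h *\<^sub>R A w eta, 0))) (at 0)"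
      using curve_deriv[of w eta 0] by (auto simp: has_vector_derivative_def intro!: derivative_intros)
    from has_derivative_compose[OF this, of Mul] M[of w "- (t *\<^sub>R eta)"]
    have 1: "((\<lambda>s. mul (mul w (s *\<^sub>R eta)) (- (t *\<^sub>R eta))) has_derivative (\<lambda>h. ?M w (- (t *\<^sub>R eta)) (h *\<^sub>R A w eta, 0))) (at 0)"
      by simp
    have "((\<lambda>s. (w, (s - t) *\<^sub>R eta)) has_derivative (\<lambda>h. (0, h *\<^sub>R eta))) (at 0)"
      by (auto intro!: derivative_eq_intros)
    from has_derivative_compose[OF this, of Mul] M[of w "- (t *\<^sub>R eta)"]
    have 2: "((\<lambda>s. mul w ((s - t) *\<^sub>R eta)) has_derivative (\<lambda>h. ?M w (- (t *\<^sub>R eta)) (0, h *\<^sub>R eta))) (at 0)"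
      by simp
    have "mul (mul w (s *\<^sub>R eta)) (- (t *\<^sub>R eta)) = mul w ((s - t) *\<^sub>R eta)" for s
      using mul_exp[of s eta "- t"] by (simp add: mul_assoc)
    with 1 have "((\<lambda>s. mul w ((s - t) *\<^sub>R eta)) has_derivative (\<lambda>h. ?M w (- (t *\<^sub>R eta)) (h *\<^sub>R A w eta, 0))) (at 0)" by simp
    from has_derivative_unique[OF this 2] show ?thesis by (auto dest: fun_cong[where x = 1])
  qed
  have "((\<lambda>t. mul (c t) (- (t *\<^sub>R eta))) has_derivative (\<lambda>h. 0)) (at t)" for t
  proof -
    have "((\<lambda>t. (c t, - (t *\<^sub>R eta))) has_derivative (\<lambda>h. (h *\<^sub>R A (c t) eta, - (h *\<^sub>R eta)))) (at t)"
      using assms[of t] by (auto simp: has_vector_derivative_def intro!: derivative_intros)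
    from has_derivative_compose[OF this M]
    have "((\<lambda>t. mul (c t) (- (t *\<^sub>R eta))) has_derivative (\<lambda>h. ?M (c t) (- (t *\<^sub>R eta)) (h *\<^sub>R A (c t) eta, - (h *\<^sub>R eta)))) (at t)"
      by simp
    moreover have "?M (c t) (- (t *\<^sub>R eta)) (h *\<^sub>R A (c t) eta, - (h *\<^sub>R eta)) = 0" for h
    proof -
      have "(h *\<^sub>R A (c t) eta, - (h *\<^sub>R eta)) = h *\<^sub>R ((A (c t) eta, 0) - (0, eta))" by simp
      then show ?thesis by (simp only: linear_scale[OF lin] linear_diff[OF lin] key) simp
    qed
    ultimately show ?thesis by simp
  qed
  then obtain q where "\<And>t. mul (c t) (- (t *\<^sub>R eta)) = q"
    using has_derivative_zero_constant[of UNIV "\<lambda>t. mul (c t) (- (t *\<^sub>R eta))"] by auto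
  from this[of t] this[of 0] have "mul (c t) (- (t *\<^sub>R eta)) = c 0" by simp
  then have "mul (mul (c t) (- (t *\<^sub>R eta))) (t *\<^sub>R eta) = mul (c 0) (t *\<^sub>R eta)" by simp
  then show ?thesis by (simp add: mul_assoc)
qed

text \<open>Dilations are group endomorphisms: by \<open>A_dil\<close> they map integral curves to
  integral curves of the dilated direction.\<close>

lemma dil_mul_exp: "dl l (mul z (t *\<^sub>R xi)) = mul (dl l z) (t *\<^sub>R dl l xi)"
proof -
  have "((\<lambda>t. dl l (mul z (t *\<^sub>R xi))) has_vector_derivative A (dl l (mul z (t *\<^sub>R xi))) (dl l xi)) (at t)" for t
    using bounded_linear.has_vector_derivative[OF dil_bounded_linear curve_deriv] by (simp add: A_dil)
  from integral_curve_unique[OF this, of t] show ?thesis by simp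
qed

end

subsection \<open>Cut-off functions\<close>

context stratified_group begin

text \<open>The argument is contracted by dilations rather than by Euclidean scaling, so that a
  horizontal derivative gains exactly the factor \<open>1 / (n + 1)\<close> and \<open>Z\<close>
  commutes with the rescaling. The \<open>n + 1\<close> keeps the factor meaningful at
  \<open>n = 0\<close>.\<close>

definition chi :: "nat \<Rightarrow> complex^'n \<Rightarrow> complex" where
  "chi n z = complex_of_real (bump (dl (complex_of_real (1 / (real n + 1))) z))"

lemma Cc_inf_bump: "Cc_inf (\<lambda>z. complex_of_real (bump z))"
  by (rule Cc_infI[of _ "cball 0 1"]) (use bump_support in \<open>auto intro: smooth_of_real smooth_bump\<close>)

lemma Cc_inf_chi: "Cc_inf (chi n)"
proof -
  have "complex_of_real (1 / (real n + 1)) \<noteq> 0"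
    by (simp only: of_real_eq_0_iff) (simp add: add_nonneg_pos less_imp_neq[symmetric])
  then show ?thesis unfolding chi_def by (rule Cc_inf_dil[OF Cc_inf_bump])
qed

lemma chi_range: "0 \<le> Re (chi n z)" "Re (chi n z) \<le> 1" "Im (chi n z) = 0" "cmod (chi n z) \<le> 1" "cnj (chi n z) = chi n z"
  by (simp_all add: chi_def bump_range)

lemma tendsto_dil_shrink: "(\<lambda>n. dl (complex_of_real (1 / (real n + 1))) z) \<longlonglongrightarrow> 0"
proof -
  have 1: "(\<lambda>n. complex_of_real (1 / (real n + 1))) \<longlonglongrightarrow> complex_of_real 0"
    using LIMSEQ_inverse_real_of_nat by (intro tendsto_of_real) (simp add: inverse_eq_divide add.commute)
  have "continuous_on UNIV (\<lambda>l. dl l z)" by (intro continuous_intros)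
  then have "isCont (\<lambda>l. dl l z) (complex_of_real 0)" using continuous_on_eq_continuous_at open_UNIV by blast
  from isCont_tendsto_compose[OF this 1] show ?thesis by (simp add: dil_eq power_0_left)
qed

lemma chi_tendsto: "(\<lambda>n. chi n z) \<longlonglongrightarrow> 1"
proof -
  have "isCont (bump :: complex^'n \<Rightarrow> real) 0"
    using smooth_continuous_on[OF smooth_bump, of UNIV] continuous_on_eq_continuous_at open_UNIV by blast
  from isCont_tendsto_compose[OF this tendsto_dil_shrink[of z]] have "(\<lambda>n. chi n z) \<longlonglongrightarrow> of_real 1"
    unfolding chi_def by (intro tendsto_of_real) (simp add: bump_0)
  then show ?thesis by simp
qed

lemma L_chi:
  assumes "xi \<in> V 1"
  shows "L xi (chi n) z = (1 / (real n + 1)) *\<^sub>R L xi (\<lambda>z. complex_of_real (bump z)) (dl (complex_of_real (1 / (real n + 1))) z)"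
    and "L xi (L xi (chi n)) z = (1 / (real n + 1))\<^sup>2 *\<^sub>R
      L xi (L xi (\<lambda>z. complex_of_real (bump z))) (dl (complex_of_real (1 / (real n + 1))) z)"
proof -
  let ?b = "\<lambda>z::complex^'n. complex_of_real (bump z)" and ?l = "1 / (real n + 1)"
  have dil_xi: "dl (complex_of_real ?l) xi = ?l *\<^sub>R xi"
    using dil_V1[OF assms] by (simp add: scaleR_eq_vec_scale)
  have b: "smooth ?b" by (intro smooth_of_real smooth_bump)
  have gen: "L xi (\<lambda>z. f (dl (complex_of_real ?l) z)) z = ?l *\<^sub>R L xi f (dl (complex_of_real ?l) z)" if "smooth f" for f z
    using L_dil[OF that] that by (simp only: dil_xi L_vec_scaleR)
  show 1: "L xi (chi n) z = ?l *\<^sub>R L xi ?b (dl (complex_of_real ?l) z)" for z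
    unfolding chi_def[abs_def] by (rule gen[OF b])
  have "L xi (L xi (chi n)) z = L xi (\<lambda>z. complex_of_real ?l * L xi ?b (dl (complex_of_real ?l) z)) z"
    by (simp only: 1[abs_def] scaleR_conv_of_real)
  also have "\<dots> = complex_of_real ?l * (?l *\<^sub>R L xi (L xi ?b) (dl (complex_of_real ?l) z))"
    by (subst L_cmult[OF smooth_dil[OF smooth_L[OF b]]]) (simp only: gen[OF smooth_L[OF b]])
  finally show "L xi (L xi (chi n)) z = ?l\<^sup>2 *\<^sub>R L xi (L xi ?b) (dl (complex_of_real ?l) z)"
    by (simp add: scaleR_conv_of_real power2_eq_square mult.assoc)
qed

lemma chi_bounds:
  assumes "finite I" "\<And>i. i \<in> I \<Longrightarrow> e i \<in> V 1"
  obtains C where "C > 0" "\<And>i n z. i \<in> I \<Longrightarrow> cmod (L (e i) (chi n) z) \<le> C / (real n + 1)"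
    "\<And>i n z. i \<in> I \<Longrightarrow> cmod (L (e i) (L (e i) (chi n)) z) \<le> C / (real n + 1)"
proof -
  let ?b = "\<lambda>z::complex^'n. complex_of_real (bump z)"
  have "\<exists>B>0. (\<forall>z. cmod (L (e i) ?b z) \<le> B) \<and> (\<forall>z. cmod (L (e i) (L (e i) ?b) z) \<le> B)" for i
  proof -
    obtain B where B: "B > 0" "\<And>z. cmod (L (e i) ?b z) \<le> B" by (rule Cc_inf_bounded[OF Cc_inf_L[OF Cc_inf_bump]]) blast
    obtain B' where B': "B' > 0" "\<And>z. cmod (L (e i) (L (e i) ?b) z) \<le> B'"
      by (rule Cc_inf_bounded[OF Cc_inf_L[OF Cc_inf_L[OF Cc_inf_bump]]]) blast
    show ?thesis using B B' by (intro exI[of _ "max B B'"]) (auto simp: le_max_iff_disj)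
  qed
  then obtain B where B: "\<And>i. B i > 0" "\<And>i z. cmod (L (e i) ?b z) \<le> B i" "\<And>i z. cmod (L (e i) (L (e i) ?b) z) \<le> B i" by metis
  \<comment> \<open>The summand 1 keeps \<open>C\<close> positive for empty
    \<open>I\<close>.\<close>
  define C where "C = 1 + (\<Sum>i\<in>I. B i)"
  have BC: "B i \<le> C" if "i \<in> I" for i
    using member_le_sum[of i I B] that assms(1) B(1) unfolding C_def by (smt (verit) less_imp_le)
  have C0: "C > 0" unfolding C_def using B(1) by (simp add: add_pos_nonneg sum_nonneg less_imp_le)
  show thesis
  proof (rule that[OF C0])
    fix i n z assume i: "i \<in> I"
    let ?w = "dl (complex_of_real (1 / (real n + 1))) z"
    have "cmod (L (e i) (chi n) z) = 1 / (real n + 1) * cmod (L (e i) ?b ?w)"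
      using L_chi(1)[OF assms(2)[OF i], of n z] by simp
    also have "\<dots> \<le> 1 / (real n + 1) * C" by (intro mult_left_mono order_trans[OF B(2) BC[OF i]]) auto
    finally show "cmod (L (e i) (chi n) z) \<le> C / (real n + 1)" by simp
    have "cmod (L (e i) (L (e i) (chi n)) z) = (1 / (real n + 1))\<^sup>2 * cmod (L (e i) (L (e i) ?b) ?w)"
      using L_chi(2)[OF assms(2)[OF i], of n z] by (simp only: norm_scaleR abs_power2)
    also have "\<dots> \<le> (1 / (real n + 1)) * C"
      by (intro mult_mono order_trans[OF B(3) BC[OF i]] power_le_one_iff[THEN iffD2])
        (auto simp: power2_eq_square divide_simps)
    finally show "cmod (L (e i) (L (e i) (chi n)) z) \<le> C / (real n + 1)" by simp
  qed
qed

end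

subsection \<open>The heat equation\<close>

lemma Cc_inf_sum: "finite I \<Longrightarrow> (\<And>i. i \<in> I \<Longrightarrow> Cc_inf (f i)) \<Longrightarrow> Cc_inf (\<lambda>z. \<Sum>i\<in>I. f i z)"
  by (induction I rule: finite_induct)
    (auto intro: Cc_inf_add Cc_infI[of _ "{}"] smooth_const)

lemma sum_lessThan_split: "(\<Sum>i<a + (b::nat). g i) = (\<Sum>i<a. g i) + (\<Sum>i<b. (g (a + i) :: 'a::comm_monoid_add))"
  by (induction b) (auto simp: algebra_simps)

text \<open>A positive second derivative would make \<open>h'\<close> positive just to the right of
  0, and \<open>h\<close> would rise above its maximum.\<close>

lemma second_derivative_at_max:
  fixes h h' :: "real \<Rightarrow> real"
  assumes "\<And>t. (h has_real_derivative h' t) (at t)" "(h' has_real_derivative d) (at 0)" "\<And>t. h t \<le> h 0"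
  shows "d \<le> 0"
proof (rule ccontr)
  assume "\<not> d \<le> 0"
  have h0: "h' 0 = 0" using DERIV_local_max[OF assms(1), of 1 0] assms(3) by auto
  obtain e where e: "e > 0" "\<And>t. 0 < t \<Longrightarrow> t < e \<Longrightarrow> h' 0 < h' (0 + t)"
    using DERIV_pos_inc_right[OF assms(2)] \<open>\<not> d \<le> 0\<close> by auto
  have "h 0 < h (e / 2)"
    by (rule DERIV_pos_imp_increasing_open[of 0 "e/2"])
      (use e h0 assms(1) in \<open>auto intro!: exI assms(1) continuous_at_imp_continuous_on DERIV_isCont\<close>)
  then show False using assms(3)[of "e/2"] by simp
qed

locale heat_group = stratified_group br V m mul
  for br :: "complex^'n \<Rightarrow> complex^'n \<Rightarrow> complex^'n" and V :: "nat \<Rightarrow> (complex^'n) set" and m :: nat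
    and mul :: "complex^'n \<Rightarrow> complex^'n \<Rightarrow> complex^'n" +
  fixes x :: "nat \<Rightarrow> complex^'n" and k :: nat and rho :: "real \<Rightarrow> complex^'n \<Rightarrow> real"
  assumes hb: "horiz_basis V x k" and hk: "heat_kernel mul x k rho"
begin

definition E :: "nat \<Rightarrow> complex^'n" where
  "E i = (if i < k then x i else \<i> *s x (i - k))"

lemma sum_E: "(\<Sum>i<2 * k. F (E i)) = (\<Sum>j<k. F (x j) + F (\<i> *s x j))"
  for F :: "complex^'n \<Rightarrow> 'a::comm_monoid_add"
  unfolding mult_2 sum_lessThan_split by (simp add: E_def sum.distrib)

lemma x_in_V1: "j < k \<Longrightarrow> x j \<in> V 1" "j < k \<Longrightarrow> \<i> *s x j \<in> V 1"
  using hb unfolding horiz_basis_def Let_def by (auto intro: span_base dest!: sym[where t = "V 1"])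

lemma E_in_V1: "i < 2 * k \<Longrightarrow> E i \<in> V 1"
  using x_in_V1 by (auto simp: E_def)

abbreviation "Lap \<equiv> subLap mul x k"

lemma subLap_eq: "Lap f z = (\<Sum>i<2 * k. L (E i) (L (E i) f) z)"
  unfolding subLap_def by (rule sum_E[symmetric])

lemma Cc_inf_Lap: "Cc_inf f \<Longrightarrow> Cc_inf (Lap f)"
  unfolding subLap_eq[abs_def] by (intro Cc_inf_sum Cc_inf_L) auto

definition mu :: "real \<Rightarrow> (complex^'n) measure" where
  "mu s = density lborel (\<lambda>y. ennreal (rho s y))"

lemma sets_mu [simp, measurable_cong]: "sets (mu s) = sets borel" and space_mu [simp]: "space (mu s) = UNIV"
  by (auto simp: mu_def)

lemma rho_pos: "s > 0 \<Longrightarrow> rho s y > 0" and smooth_rho: "s > 0 \<Longrightarrow> smooth (rho s)"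
  and rho_integrable: "s > 0 \<Longrightarrow> integrable lborel (rho s)" and rho_integral: "s > 0 \<Longrightarrow> integral\<^sup>L lborel (rho s) = 1"
  using hk unfolding heat_kernel_def by blast+

lemma rho_measurable [measurable]: "s > 0 \<Longrightarrow> rho s \<in> borel_measurable borel"
  by (intro smooth_borel_measurable smooth_rho)

lemma emeasure_mu: "s > 0 \<Longrightarrow> emeasure (mu s) UNIV = 1"
proof -
  assume s: "s > 0"
  have "emeasure (mu s) UNIV = (\<integral>\<^sup>+y. ennreal (rho s y) \<partial>lborel)"
    unfolding mu_def using s by (subst emeasure_density) auto
  also have "\<dots> = ennreal 1"
    using s rho_pos[OF s] by (subst nn_integral_eq_integral) (auto simp: rho_integrable rho_integral less_imp_le)
  finally show ?thesis by simp
qed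

lemma finite_measure_mu: "s > 0 \<Longrightarrow> finite_measure (mu s)"
  by (rule finite_measureI) (simp add: emeasure_mu)

lemma integral_mu_le:
  fixes f :: "complex^'n \<Rightarrow> real"
  assumes "s > 0" "integrable (mu s) f" "\<And>y. f y \<le> B"
  shows "integral\<^sup>L (mu s) f \<le> B"
proof -
  interpret finite_measure "mu s" using finite_measure_mu[OF assms(1)] .
  have "integral\<^sup>L (mu s) f \<le> integral\<^sup>L (mu s) (\<lambda>y. B)"
    using assms by (intro integral_mono) auto
  then show ?thesis by (simp add: measure_def emeasure_mu[OF assms(1)])
qed

lemma integral_mu:
  fixes f :: "complex^'n \<Rightarrow> complex"
  assumes "s > 0" "f \<in> borel_measurable borel"
  shows "integral\<^sup>L (mu s) f = integral\<^sup>L lborel (\<lambda>y. f y * complex_of_real (rho s y))"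
  unfolding mu_def using assms rho_pos[OF assms(1)]
  by (subst integral_density) (auto simp: less_imp_le scaleR_conv_of_real mult.commute)

lemma integral_mu_real:
  fixes f :: "complex^'n \<Rightarrow> real"
  assumes "s > 0" "f \<in> borel_measurable borel"
  shows "integral\<^sup>L (mu s) f = integral\<^sup>L lborel (\<lambda>y. f y * rho s y)"
  unfolding mu_def using assms rho_pos[OF assms(1)]
  by (subst integral_density) (auto simp: less_imp_le mult.commute)

lemma integrable_mu_real:
  fixes f :: "complex^'n \<Rightarrow> real"
  assumes "s > 0" "f \<in> borel_measurable borel"
  shows "integrable (mu s) f \<longleftrightarrow> integrable lborel (\<lambda>y. f y * rho s y)"
  unfolding mu_def using assms rho_pos[OF assms(1)]
  by (subst integrable_density) (auto simp: less_imp_le mult.commute)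

lemma integrable_mu_bounded:
  fixes f :: "complex^'n \<Rightarrow> complex"
  assumes "s > 0" "f \<in> borel_measurable borel" "\<And>z. norm (f z) \<le> B"
  shows "integrable (mu s) f"
proof -
  interpret finite_measure "mu s" using finite_measure_mu[OF assms(1)] .
  show ?thesis using assms by (intro integrable_const_bound[where B = B]) auto
qed

lemma Cc_inf_integrable_mu: "s > 0 \<Longrightarrow> Cc_inf f \<Longrightarrow> integrable (mu s) f"
  by (rule Cc_inf_bounded, assumption, rule integrable_mu_bounded) (auto intro: Cc_inf_borel_measurable)

abbreviation "ph f z \<equiv> (\<lambda>y. f (mul z (- y)))"

definition U :: "(complex^'n \<Rightarrow> complex) \<Rightarrow> real \<Rightarrow> complex^'n \<Rightarrow> complex" where
  "U f s z = integral\<^sup>L lborel (\<lambda>y. f (mul z (- y)) * complex_of_real (rho s y))"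

lemma continuous_on_mul [continuous_intros]:
  "continuous_on S f \<Longrightarrow> continuous_on S g \<Longrightarrow> continuous_on S (\<lambda>z. mul (f z) (g z))"
  using continuous_on_compose2[OF smooth_continuous_on[OF smooth_Mul, of UNIV], of S "\<lambda>z. (f z, g z)"]
  by (auto intro: continuous_intros)

lemma Cc_inf_ph:
  assumes "Cc_inf f" shows "Cc_inf (ph f z)"
  by (rule Cc_inf_compose[OF assms, of "\<lambda>y. mul z (- y)" "\<lambda>p. - mul (- z) p"])
    (auto intro!: smooth_mul smooth_const smooth_minus smooth_ident continuous_intros)

lemma U_mu: "s > 0 \<Longrightarrow> Cc_inf f \<Longrightarrow> U f s z = integral\<^sup>L (mu s) (ph f z)"
  unfolding U_def using integral_mu[of s "ph f z"] Cc_inf_borel_measurable[OF Cc_inf_ph[of f z]] by simp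

lemma U_bounded:
  assumes "s > 0" "Cc_inf f" "\<And>z. cmod (f z) \<le> B"
  shows "cmod (U f s z) \<le> B"
proof -
  interpret finite_measure "mu s" using finite_measure_mu[OF assms(1)] .
  have "cmod (U f s z) \<le> (\<integral>y. cmod (ph f z y) \<partial>mu s)"
    unfolding U_mu[OF assms(1,2)] by (rule integral_norm_bound)
  also have "\<dots> \<le> B"
    using assms by (intro integral_mu_le integrable_norm Cc_inf_integrable_mu Cc_inf_ph)
  finally show ?thesis .
qed

lemma translation_derivative:
  assumes s: "s > 0" and f: "Cc_inf f"
  shows "((\<lambda>t. \<integral>y. f (mul y (- (t *\<^sub>R xi))) \<partial>mu s) has_vector_derivative
    - (\<integral>y. L xi f (mul y (- (t0 *\<^sub>R xi))) \<partial>mu s)) (at t0)"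
proof -
  have Cc: "Cc_inf (\<lambda>y. g (mul y (- (t *\<^sub>R xi))))" if "Cc_inf g" for t g
    by (rule Cc_inf_compose[OF that, of "\<lambda>y. mul y (- (t *\<^sub>R xi))" "\<lambda>p. mul p (t *\<^sub>R xi)"])
      (auto intro!: smooth_mul smooth_const smooth_ident continuous_intros simp: mul_assoc)
  obtain B where B: "B > 0" "\<And>z. cmod (L xi f z) \<le> B" by (rule Cc_inf_bounded[OF Cc_inf_L[OF f]]) blast
  interpret finite_measure "mu s" using finite_measure_mu[OF s] .
  have "((\<lambda>t. \<integral>y. f (mul y (- (t *\<^sub>R xi))) \<partial>mu s) has_vector_derivative
    (\<integral>y. (\<lambda>t y. - L xi f (mul y (- (t *\<^sub>R xi)))) t0 y \<partial>mu s)) (at t0)"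
  proof (rule has_vector_derivative_integral[where G = "\<lambda>y. B"])
    show "integrable (mu s) (\<lambda>y. f (mul y (- (t *\<^sub>R xi))))" for t by (rule Cc_inf_integrable_mu[OF s Cc[OF f]])
    show "((\<lambda>t. f (mul y (- (t *\<^sub>R xi)))) has_vector_derivative - L xi f (mul y (- (t *\<^sub>R xi)))) (at t)" for t y
      using vector_diff_chain_at[of uminus "-1" t "\<lambda>t. f (mul y (t *\<^sub>R xi))", OF _ L_curve(1)]
        smooth_imp_differentiable[OF Cc_inf_smooth[OF f]] has_vector_derivative_minus[OF has_vector_derivative_id]
      by (simp add: o_def)
    show "(\<lambda>y. - L xi f (mul y (- (t0 *\<^sub>R xi)))) \<in> borel_measurable (mu s)"
      using Cc_inf_borel_measurable[OF Cc[OF Cc_inf_L[OF f]]] by simp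
  qed (use B in auto)
  then show ?thesis by simp
qed

text \<open>Since \<open>z exp(t xi) y^(-1) = z (y exp(- t xi))^(-1)\<close>, moving
  \<open>z\<close> along \<open>xi\<close> amounts to moving \<open>y\<close> on the right by
  \<open>exp(- t xi)\<close>. All derivatives of \<open>U\<close> thus fall on the test function
  \<open>ph f z\<close>, and the two minus signs of the second derivative cancel.\<close>

lemma U_along:
  assumes s: "s > 0" and f: "Cc_inf f"
  shows "((\<lambda>t. U f s (mul z (t *\<^sub>R xi))) has_vector_derivative - (\<integral>y. L xi (ph f z) (mul y (- (t0 *\<^sub>R xi))) \<partial>mu s)) (at t0)"
    and "((\<lambda>t. - (\<integral>y. L xi (ph f z) (mul y (- (t *\<^sub>R xi))) \<partial>mu s)) has_vector_derivative
      (\<integral>y. L xi (L xi (ph f z)) y \<partial>mu s)) (at 0)"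
proof -
  have "U f s (mul z (t *\<^sub>R xi)) = (\<integral>y. ph f z (mul y (- (t *\<^sub>R xi))) \<partial>mu s)" for t
    unfolding U_mu[OF s f] by (simp add: neg_mul mul_assoc)
  then show "((\<lambda>t. U f s (mul z (t *\<^sub>R xi))) has_vector_derivative - (\<integral>y. L xi (ph f z) (mul y (- (t0 *\<^sub>R xi))) \<partial>mu s)) (at t0)"
    using translation_derivative[OF s Cc_inf_ph[OF f], of z xi t0] by simp
  show "((\<lambda>t. - (\<integral>y. L xi (ph f z) (mul y (- (t *\<^sub>R xi))) \<partial>mu s)) has_vector_derivative
      (\<integral>y. L xi (L xi (ph f z)) y \<partial>mu s)) (at 0)"
    using has_vector_derivative_minus[OF translation_derivative[OF s Cc_inf_L[OF Cc_inf_ph[OF f]], of xi z xi 0]] by simp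
qed

text \<open>The derivatives are evaluated from the definition of \<open>lvf\<close> along the curve,
  for which \<open>U_along\<close> supplies them.\<close>

lemma LL_U:
  assumes s: "s > 0" and f: "Cc_inf f"
  shows "L xi (L xi (U f s)) z = (\<integral>y. L xi (L xi (ph f z)) y \<partial>mu s)"
proof -
  let ?h = "\<lambda>t. - (\<integral>y. L xi (ph f z) (mul y (- (t *\<^sub>R xi))) \<partial>mu s)"
  have "L xi (U f s) (mul z (t *\<^sub>R xi)) = ?h t" for t
  proof -
    have "((\<lambda>r. U f s (mul z ((t + r) *\<^sub>R xi))) has_vector_derivative ?h t) (at 0)"
      using vector_diff_chain_at[of "\<lambda>r. t + r" 1 0 "\<lambda>t. U f s (mul z (t *\<^sub>R xi))", OF _ U_along(1)[OF s f]]
        has_vector_derivative_add[OF has_vector_derivative_const[of t] has_vector_derivative_id[of "at (0::real)"]]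
      by (simp add: o_def)
    then show ?thesis unfolding lvf_def by (simp add: mul_assoc mul_exp vector_derivative_at)
  qed
  then show ?thesis
    using U_along(2)[OF s f, of xi z] unfolding lvf_def[of mul xi "L xi (U f s)"] by (simp add: vector_derivative_at)
qed

lemma Lap_U: "s > 0 \<Longrightarrow> Cc_inf f \<Longrightarrow> Lap (U f s) z = (\<integral>y. Lap (ph f z) y \<partial>mu s)"
  unfolding subLap_eq LL_U
  by (subst Bochner_Integration.integral_sum) (auto intro!: Cc_inf_integrable_mu Cc_inf_L Cc_inf_ph)

lemma heat_equation:
  assumes "s > 0" "Cc_inf f"
  shows "((\<lambda>s. U f s z) has_vector_derivative (\<integral>y. Lap (ph f z) y \<partial>mu s) / 4) (at s)"
  unfolding Lap_U[OF assms, symmetric]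
  using hk assms unfolding heat_kernel_def Let_def U_def[abs_def] by blast

lemma U_initial: "Cc_inf f \<Longrightarrow> uniform_limit UNIV (U f) f (at_right 0)"
  using hk unfolding heat_kernel_def Let_def U_def[abs_def] by blast

text \<open>The heat equation at the identity, for \<open>f\<close> composed with inversion; there
  \<open>ph\<close> undoes the inversion.\<close>

lemma heat_equation_weak:
  assumes "s > 0" "Cc_inf f"
  shows "((\<lambda>s. \<integral>y. f y \<partial>mu s) has_vector_derivative (\<integral>y. Lap f y \<partial>mu s) / 4) (at s)"
proof -
  let ?g = "\<lambda>y. f (- y)"
  have g: "Cc_inf ?g" using Cc_inf_ph[OF assms(2), of 0] by simp
  have "((\<lambda>s. U ?g s 0) has_vector_derivative (\<integral>y. Lap f y \<partial>mu s) / 4) (at s)"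
    using heat_equation[OF assms(1) g, of 0] by simp
  then show ?thesis
    by (rule has_vector_derivative_transform_within_open[of _ _ _ "{0<..}"]) (use assms U_mu[OF _ g, of _ 0] in auto)
qed

text \<open>For \<open>w\<close> in the unit ball around \<open>z\<close>, the point
  \<open>mul w y\<close> can meet the support of \<open>f\<close> only if \<open>y\<close> lies in a
  compact set \<open>S\<close>. On it uniform continuity applies, and off it both values vanish,
  which makes the estimate uniform in all \<open>y\<close>.\<close>

lemma translation_equicontinuous:
  assumes f: "Cc_inf f" and e: "e > 0"
  obtains d where "d > 0" "\<And>w y. dist w z < d \<Longrightarrow> cmod (f (mul w y) - f (mul z y)) < e"
proof -
  obtain K where K: "compact K" "\<And>z. z \<notin> K \<Longrightarrow> f z = 0" by (rule Cc_inf_support[OF f]) blast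
  define S where "S = (\<lambda>p. mul (- fst p) (snd p)) ` (cball z 1 \<times> K)"
  have "compact S" unfolding S_def
    by (intro compact_continuous_image compact_Times K continuous_intros) auto
  then have "compact (cball z 1 \<times> S)" by (intro compact_Times) auto
  moreover have "continuous_on (cball z 1 \<times> S) (\<lambda>p. f (mul (fst p) (snd p)))"
    by (rule continuous_on_compose2[OF smooth_continuous_on[OF Cc_inf_smooth[OF f], of UNIV]]) (auto intro!: continuous_intros)
  ultimately have "uniformly_continuous_on (cball z 1 \<times> S) (\<lambda>p. f (mul (fst p) (snd p)))"
    by (rule compact_uniformly_continuous[rotated])
  then obtain d where d: "d > 0" "\<And>p q. p \<in> cball z 1 \<times> S \<Longrightarrow> q \<in> cball z 1 \<times> S \<Longrightarrow> dist q p < d \<Longrightarrow>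
      dist (f (mul (fst q) (snd q))) (f (mul (fst p) (snd p))) < e"
    using e unfolding uniformly_continuous_on_def by metis
  show thesis
  proof (rule that[of "min d 1"])
    fix w y assume w: "dist w z < min d 1"
    show "cmod (f (mul w y) - f (mul z y)) < e"
    proof (cases "y \<in> S")
      case True
      then show ?thesis
        using d(2)[of "(z, y)" "(w, y)"] w by (auto simp: dist_norm[of "f _"] dist_Pair_Pair dist_commute)
    next
      case False
      have "mul v y \<notin> K" if "v \<in> cball z 1" for v
      proof
        assume "mul v y \<in> K"
        then have "mul (- v) (mul v y) \<in> S" unfolding S_def using that by (intro image_eqI[of _ _ "(v, mul v y)"]) auto
        then show False using False by simp
      qed
      then show ?thesis using K(2) w e by (auto simp: dist_commute)
    qed
  qed (use d in auto)
qed

lemma U_equicontinuous: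
  assumes f: "Cc_inf f" and e: "e > 0"
  obtains d where "d > 0" "\<And>w s. s > 0 \<Longrightarrow> dist w z < d \<Longrightarrow> cmod (U f s w - U f s z) \<le> e"
proof -
  obtain d where d: "d > 0" "\<And>w y. dist w z < d \<Longrightarrow> cmod (f (mul w y) - f (mul z y)) < e"
    by (rule translation_equicontinuous[OF f e]) blast
  show thesis
  proof (rule that[OF d(1)])
    fix w s assume s: "(s::real) > 0" and w: "dist w z < d"
    interpret finite_measure "mu s" using finite_measure_mu[OF s] .
    have "U f s w - U f s z = (\<integral>y. ph f w y - ph f z y \<partial>mu s)"
      unfolding U_mu[OF s f] by (subst Bochner_Integration.integral_diff) (auto intro!: Cc_inf_integrable_mu[OF s Cc_inf_ph[OF f]])
    then have "cmod (U f s w - U f s z) \<le> (\<integral>y. cmod (ph f w y - ph f z y) \<partial>mu s)"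
      by (simp add: integral_norm_bound)
    also have "\<dots> \<le> e"
      using d(2)[OF w] s by (intro integral_mu_le integrable_norm Bochner_Integration.integrable_diff Cc_inf_integrable_mu[OF s Cc_inf_ph[OF f]])
        (auto intro: less_imp_le)
    finally show "cmod (U f s w - U f s z) \<le> e" .
  qed
qed

text \<open>Continuity in \<open>s\<close> comes from the heat equation. It becomes joint continuity
  because the modulus of continuity in \<open>z\<close> is independent of \<open>s\<close>, every
  \<open>mu s\<close> having mass 1.\<close>

lemma U_continuous:
  assumes f: "Cc_inf f"
  shows "continuous_on ({0<..} \<times> UNIV) (\<lambda>p. U f (fst p) (snd p))"
proof (rule continuous_on_iff[THEN iffD2], intro ballI allI impI)
  fix p :: "real \<times> (complex^'n)" and e :: real assume p: "p \<in> {0<..} \<times> UNIV" and e: "0 < e"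
  obtain s z where sz: "p = (s, z)" "s > 0" using p by (cases p) auto
  obtain d where d: "d > 0" "\<And>w s. s > 0 \<Longrightarrow> dist w z < d \<Longrightarrow> cmod (U f s w - U f s z) \<le> e / 2"
    using U_equicontinuous[OF f, of "e/2" z] e by (metis half_gt_zero)
  have "isCont (\<lambda>s. U f s z) s"
    using heat_equation[OF sz(2) f] has_vector_derivative_continuous by blast
  then obtain d' where d': "d' > 0" "\<And>t. dist t s < d' \<Longrightarrow> dist (U f t z) (U f s z) < e / 2"
    unfolding continuous_at_eps_delta using e by (metis half_gt_zero dist_norm)
  show "\<exists>d>0. \<forall>x'\<in>{0<..} \<times> UNIV. dist x' p < d \<longrightarrow> dist (U f (fst x') (snd x')) (U f (fst p) (snd p)) < e"
  proof (intro exI[of _ "min d d'"] conjI ballI impI)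
    fix q :: "real \<times> (complex^'n)" assume q: "q \<in> {0<..} \<times> UNIV" "dist q p < min d d'"
    obtain t w where tw: "q = (t, w)" "t > 0" using q by (cases q) auto
    have "dist t s < d'" "dist w z < d"
      using q(2) dist_fst_le[of q p] dist_snd_le[of q p] by (auto simp: tw sz)
    then have "dist (U f t w) (U f t z) \<le> e / 2" "dist (U f t z) (U f s z) < e / 2"
      using d(2)[OF tw(2)] d'(2) by (auto simp: dist_norm)
    then show "dist (U f (fst q) (snd q)) (U f (fst p) (snd p)) < e"
      using dist_triangle[of "U f t w" "U f s z" "U f t z"] by (simp add: tw sz)
  qed (use d d' in auto)
qed

text \<open>The barrier is \<open>\<epsilon> (1 + s) + 2 M (1 - \<chi>)\<close> with a slowly varying cut-off \<open>\<chi>\<close>, so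
  no growth information on the heat kernel is needed.\<close>

lemma max_principle:
  fixes w :: "real \<Rightarrow> complex^'n \<Rightarrow> real" and w2 :: "nat \<Rightarrow> real \<Rightarrow> complex^'n \<Rightarrow> real"
  assumes bdd: "\<And>s z. s > 0 \<Longrightarrow> w s z \<le> M"
    and cont: "continuous_on ({0<..} \<times> UNIV) (\<lambda>p. w (fst p) (snd p))"
    and lim: "\<And>e. e > 0 \<Longrightarrow> \<exists>d>0. \<forall>s z. 0 < s \<and> s < d \<longrightarrow> w s z < e"
    and ds: "\<And>s z. s > 0 \<Longrightarrow> ((\<lambda>s. w s z) has_real_derivative (\<Sum>i<2*k. w2 i s z) / 4) (at s)"
    and dz: "\<And>s z i. s > 0 \<Longrightarrow> i < 2 * k \<Longrightarrow> \<exists>h'. (\<forall>t. ((\<lambda>t. w s (mul z (t *\<^sub>R E i))) has_real_derivative h' t) (at t)) \<and>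
        (h' has_real_derivative w2 i s z) (at 0)"
    and s0: "s0 > 0"
  shows "w s0 z0 \<le> 0"
proof -
  define M' where "M' = max M 1"
  have M': "M' > 0" "\<And>s z. s > 0 \<Longrightarrow> w s z \<le> M'" using bdd by (auto simp: M'_def le_max_iff_disj)
  obtain C where C: "C > 0" "\<And>i n z. i \<in> {..<2*k} \<Longrightarrow> cmod (L (E i) (chi n) z) \<le> C / (real n + 1)"
    "\<And>i n z. i \<in> {..<2*k} \<Longrightarrow> cmod (L (E i) (L (E i) (chi n)) z) \<le> C / (real n + 1)"
    by (rule chi_bounds[of "{..<2*k}" E]) (use E_in_V1 in auto)
  \<comment> \<open>Roles of the terms: \<open>e\<close> dominates the initial values,
    \<open>e * s\<close> makes the time derivative strictly smaller, and the last term equals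
    \<open>2 * M'\<close> off the support of the cut-off, beyond the bound of
    \<open>w\<close>.\<close>
  have main: "w s0 z0 \<le> e + e * s0 + 2 * M' * (1 - Re (chi n z0))"
    if e: "e > 0" and n: "M' * (real k * (C / (real n + 1))) < e" for e n
  proof (rule ccontr)
    define W where "W s z = w s z - e - e * s - 2 * M' * (1 - Re (chi n z))" for s z
    assume "\<not> ?thesis"
    then have W0: "W s0 z0 > 0" by (simp add: W_def)
    obtain d where d: "d > 0" "\<And>s z. 0 < s \<Longrightarrow> s < d \<Longrightarrow> w s z < e" using lim[OF e] by blast
    have W_small: "W s z < 0" if "0 < s" "s < d" for s z
    proof -
      have "0 \<le> 2 * M' * (1 - Re (chi n z))" using M' chi_range(2) by simp
      moreover have "0 < e * s" using e that by simp
      ultimately show ?thesis using d(2)[OF that, of z] by (simp add: W_def)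
    qed
    have d_s0: "d \<le> s0" using W_small[of s0 z0] W0 s0 by force
    obtain K where K: "compact K" "\<And>z. z \<notin> K \<Longrightarrow> chi n z = 0" by (rule Cc_inf_support[OF Cc_inf_chi]) blast
    have W_out: "W s z < 0" if "0 < s" "z \<notin> K" for s z
    proof -
      have "0 < e * s" using e that by simp
      then show ?thesis using M'(2)[OF that(1), of z] K(2)[OF that(2)] M'(1) e unfolding W_def by simp
    qed
    have contW: "continuous_on ({0<..} \<times> UNIV) (\<lambda>p. W (fst p) (snd p))"
      unfolding W_def
      by (intro continuous_intros cont continuous_on_compose2[OF smooth_continuous_on[OF Cc_inf_smooth[OF Cc_inf_chi], of UNIV]]) auto
    have "z0 \<in> K" using W_out[OF s0] W0 by force
    then have ne: "({d/2..s0} \<times> K) \<noteq> {}" using d_s0 d(1) by auto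
    have "compact ({d/2..s0} \<times> K)" using K by (intro compact_Times) auto
    \<comment> \<open>Before time \<open>d\<close> and outside \<open>K\<close> the function
      \<open>W\<close> is negative, so a positive maximum sits at a time \<open>s \<ge> d\<close>.
      Starting the interval at \<open>d/2\<close> leaves room to step back in time from
      \<open>s\<close>; only such backward steps are taken, so \<open>s = s0\<close> is
      admissible.\<close>
    then obtain p where p: "p \<in> {d/2..s0} \<times> K" "\<And>q. q \<in> {d/2..s0} \<times> K \<Longrightarrow> W (fst q) (snd q) \<le> W (fst p) (snd p)"
      using continuous_attains_sup[OF _ ne continuous_on_subset[OF contW]] d(1) by force
    obtain s z where sz: "p = (s, z)" by (cases p)
    have "(s0, z0) \<in> {d/2..s0} \<times> K" using \<open>z0 \<in> K\<close> d_s0 d(1) by auto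
    from p(2)[OF this] W0 have Wp: "W s z > 0" by (simp add: sz)
    have s: "s > 0" "s \<le> s0" using p(1) d(1) by (auto simp: sz)
    have "d \<le> s" using W_small[of s z] Wp s by force
    have sup_z: "W s v \<le> W s z" for v
      using p(2)[of "(s, v)"] p(1) W_out[OF s(1), of v] Wp by (cases "v \<in> K") (auto simp: sz)
    have sup_s: "W t z \<le> W s z" if "d/2 \<le> t" "t \<le> s" for t
      using p(2)[of "(t, z)"] p(1) that s by (auto simp: sz)
    define c where "c = (\<Sum>i<2*k. w2 i s z) / 4"
    have D: "((\<lambda>t. W t z) has_real_derivative c - e) (at s)"
      unfolding W_def c_def by (auto intro!: derivative_eq_intros ds[OF s(1)])
    have ce: "c - e \<ge> 0"
    proof (rule ccontr)
      assume "\<not> 0 \<le> c - e"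
      from DERIV_neg_dec_left[OF D] this
      obtain r where r: "r > 0" "\<And>h. 0 < h \<Longrightarrow> h < r \<Longrightarrow> W s z < W (s - h) z" by auto
      have "W s z < W (s - min (r/2) (d/2)) z" using r d(1) by (intro r(2)) auto
      moreover have "W (s - min (r/2) (d/2)) z \<le> W s z" using \<open>d \<le> s\<close> r d(1) by (intro sup_s) auto
      ultimately show False by simp
    qed
    have "w2 i s z + 2 * M' * Re (L (E i) (L (E i) (chi n)) z) \<le> 0" if i: "i < 2 * k" for i
    proof -
      obtain h' where h': "\<And>t. ((\<lambda>t. w s (mul z (t *\<^sub>R E i))) has_real_derivative h' t) (at t)"
        "(h' has_real_derivative w2 i s z) (at 0)" using dz[OF s(1) i, of z] by blast
      have sc: "smooth (chi n)" "smooth (L (E i) (chi n))" by (intro smooth_L Cc_inf_smooth Cc_inf_chi)+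
      have Re: "((\<lambda>t. Re (g (mul z (t *\<^sub>R E i)))) has_real_derivative Re (L (E i) g (mul z (t *\<^sub>R E i)))) (at t)"
        if "smooth g" for g t
        using bounded_linear.has_vector_derivative[OF bounded_linear_Re L_curve(1)[OF smooth_imp_differentiable[OF that]]]
        by (simp add: has_real_derivative_iff_has_vector_derivative)
      show ?thesis
      proof (rule second_derivative_at_max[where h = "\<lambda>t. W s (mul z (t *\<^sub>R E i))" and h' = "\<lambda>t. h' t + 2 * M' * Re (L (E i) (chi n) (mul z (t *\<^sub>R E i)))"])
        show "((\<lambda>t. W s (mul z (t *\<^sub>R E i))) has_real_derivative h' t + 2 * M' * Re (L (E i) (chi n) (mul z (t *\<^sub>R E i)))) (at t)" for t
        proof -
          have "((\<lambda>t. (w s (mul z (t *\<^sub>R E i)) + 2 * M' * Re (chi n (mul z (t *\<^sub>R E i)))) + (- e - e * s - 2 * M')) has_real_derivative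
              (h' t + 2 * M' * Re (L (E i) (chi n) (mul z (t *\<^sub>R E i)))) + 0) (at t)"
            by (intro DERIV_add h'(1) DERIV_cmult Re[OF sc(1)] DERIV_const)
          then show ?thesis by (simp add: W_def algebra_simps)
        qed
        show "((\<lambda>t. h' t + 2 * M' * Re (L (E i) (chi n) (mul z (t *\<^sub>R E i)))) has_real_derivative
            w2 i s z + 2 * M' * Re (L (E i) (L (E i) (chi n)) z)) (at 0)"
          using DERIV_add[OF h'(2) DERIV_cmult[OF Re[OF sc(2), of 0], of "2 * M'"]] by simp
        show "W s (mul z (t *\<^sub>R E i)) \<le> W s (mul z (0 *\<^sub>R E i))" for t using sup_z by simp
      qed
    qed
    moreover have "- (C / (real n + 1)) \<le> Re (L (E i) (L (E i) (chi n)) z)" if "i < 2 * k" for i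
      using C(3)[of i n z] that abs_Re_le_cmod[of "L (E i) (L (E i) (chi n)) z"] by auto
    ultimately have "w2 i s z \<le> 2 * M' * (C / (real n + 1))" if "i < 2 * k" for i
    proof -
      have "2 * M' * (- (C / (real n + 1))) \<le> 2 * M' * Re (L (E i) (L (E i) (chi n)) z)"
        using M'(1) \<open>\<And>i. i < 2 * k \<Longrightarrow> - (C / (real n + 1)) \<le> Re (L (E i) (L (E i) (chi n)) z)\<close>[OF that]
        by (intro mult_left_mono) auto
      then show ?thesis
        using \<open>\<And>i. i < 2 * k \<Longrightarrow> w2 i s z + 2 * M' * Re (L (E i) (L (E i) (chi n)) z) \<le> 0\<close>[OF that] by simp
    qed
    \<comment> \<open>Adding the \<open>2 * k\<close> directions and dividing by 4 gives
      \<open>c \<le> M' * k * C / (n + 1) < e\<close>, which contradicts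
      \<open>c \<ge> e\<close>.\<close>
    then have "(\<Sum>i<2*k. w2 i s z) \<le> (\<Sum>i<2*k. 2 * M' * (C / (real n + 1)))" by (intro sum_mono) auto
    then have "c \<le> M' * (real k * (C / (real n + 1)))" unfolding c_def by (simp add: mult_ac)
    then show False using ce n by simp
  qed
  have "w s0 z0 \<le> e + e * s0" if e: "e > 0" for e
  proof (rule LIMSEQ_le_const)
    show "(\<lambda>n. e + e * s0 + 2 * M' * (1 - Re (chi n z0))) \<longlonglongrightarrow> e + e * s0"
    proof -
      have "(\<lambda>n. e + e * s0 + 2 * M' * (1 - Re (chi n z0))) \<longlonglongrightarrow> e + e * s0 + 2 * M' * (1 - Re 1)"
        by (intro tendsto_intros chi_tendsto)
      then show ?thesis by simp
    qed
    have "(\<lambda>n. M' * (real k * (C * inverse (real (Suc n))))) \<longlonglongrightarrow> M' * (real k * (C * 0))"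
      by (intro tendsto_intros LIMSEQ_inverse_real_of_nat)
    then have "\<forall>\<^sub>F n in sequentially. M' * (real k * (C / (real n + 1))) < e"
      using e order_tendstoD(2)[of _ 0 sequentially e] by (simp add: inverse_eq_divide add.commute)
    then show "\<exists>N. \<forall>n\<ge>N. w s0 z0 \<le> e + e * s0 + 2 * M' * (1 - Re (chi n z0))"
      using main[OF e] unfolding eventually_sequentially by blast
  qed
  note bound = this
  have "w s0 z0 \<le> 0 + e" if "e > 0" for e
  proof -
    have "e / (1 + s0) + e / (1 + s0) * s0 = e / (1 + s0) * (1 + s0)" by (simp only: distrib_left mult_1_right)
    also have "\<dots> = e" using s0 by simp
    finally show ?thesis using bound[of "e / (1 + s0)"] that s0 by simp
  qed
  then show ?thesis using field_le_epsilon by blast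
qed

end

subsection \<open>Scaling of the heat kernel\<close>

context stratified_algebra begin

text \<open>The weighted Euler field, generator of the dilation flow: the radial and angular fields
  differentiate in the directions \<open>Eul z\<close> and \<open>i Eul z\<close>.\<close>

definition Eul :: "complex^'n \<Rightarrow> complex^'n" where
  "Eul z = (\<Sum>j=1..m. of_nat j *s lay z j)"

lemma Eul_vec_scale: "Eul (c *s z) = c *s Eul z"
  unfolding Eul_def vec.scale_sum_right
  by (rule sum.cong) (auto simp: layer_scale mult.commute)

lemma bounded_linear_Eul: "bounded_linear Eul"
proof (rule linear_conv_bounded_linear[THEN iffD1], rule linearI)
  show "Eul (x + y) = Eul x + Eul y" for x y
    unfolding Eul_def sum.distrib[symmetric]
    by (rule sum.cong) (auto simp: layer_add vec_eq_iff algebra_simps)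
qed (simp add: scaleR_eq_vec_scale Eul_vec_scale)

text \<open>The rate \<open>c = 1\<close> gives the radial flow and \<open>c = \<i>\<close> the
  rotations.\<close>

lemma flow_deriv:
  "((\<lambda>t. dl (exp (c * complex_of_real t)) z) has_vector_derivative c *s Eul (dl (exp (c * complex_of_real t)) z)) (at t)"
proof -
  have "((\<lambda>t. exp (c * complex_of_real t) ^ j *s lay z j) has_vector_derivative
      (of_nat j * c * exp (c * complex_of_real t) ^ j) *s lay z j) (at t)" for j
  proof -
    have "((\<lambda>u. exp (c * u) ^ j) has_field_derivative of_nat j * c * exp (c * of_real t) ^ j) (at (complex_of_real t))"
      unfolding exp_of_nat_mult[symmetric] by (auto intro!: derivative_eq_intros simp: algebra_simps)
    from has_vector_derivative_real_field[OF this]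
    show ?thesis by (rule bounded_linear.has_vector_derivative[OF bounded_linear_vec_scale])
  qed
  then have "((\<lambda>t. dl (exp (c * complex_of_real t)) z) has_vector_derivative
      (\<Sum>j=1..m. (of_nat j * c * exp (c * complex_of_real t) ^ j) *s lay z j)) (at t)"
    unfolding dil_eq by (intro has_vector_derivative_sum)
  moreover have "(\<Sum>j=1..m. (of_nat j * c * exp (c * complex_of_real t) ^ j) *s lay z j) =
      c *s Eul (dl (exp (c * complex_of_real t)) z)"
    unfolding Eul_def vec.scale_sum_right
    by (rule sum.cong) (auto simp: layer_dil mult_ac)
  ultimately show ?thesis by simp
qed

lemma flow_deriv_smooth:
  assumes "smooth f"
  shows "((\<lambda>t. f (dl (exp (c * complex_of_real t)) z)) has_vector_derivative
    frechet_derivative f (at (dl (exp (c * complex_of_real t)) z)) (c *s Eul (dl (exp (c * complex_of_real t)) z))) (at t)"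
  using has_derivative_compose[OF flow_deriv[unfolded has_vector_derivative_def] smooth_has_derivative[OF assms]]
  by (simp add: has_vector_derivative_def linear_scale[OF linear_frechet_derivative[OF smooth_imp_differentiable[OF assms]]])

lemma Zop_eq:
  assumes "smooth f"
  shows "Zop V m f z = (frechet_derivative f (at z) (Eul z) - \<i> * frechet_derivative f (at z) (\<i> *s Eul z)) / 2"
  using vector_derivative_at[OF flow_deriv_smooth[OF assms, of 1 z 0]] vector_derivative_at[OF flow_deriv_smooth[OF assms, of \<i> z 0]]
  by (simp add: Zop_def Xrad_def Yrot_def dil_1)

lemma Zop_holo: "holo f \<Longrightarrow> Zop V m f z = frechet_derivative f (at z) (Eul z)"
  by (simp add: Zop_eq holo_imp_smooth holoD(2))

text \<open>Conjugation makes the derivative antilinear, so the angular term cancels the radial one;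
  for holomorphic functions the two coincide instead.\<close>

lemma Zop_cnj_holo:
  assumes "holo f" shows "Zop V m (\<lambda>z. cnj (f z)) z = 0"
proof -
  have "((\<lambda>z. cnj (f z)) has_derivative (\<lambda>h. cnj (frechet_derivative f (at z) h))) (at z)"
    by (rule has_derivative_cnj[OF holoD(1)[OF assms]])
  then have "frechet_derivative (\<lambda>z. cnj (f z)) (at z) = (\<lambda>h. cnj (frechet_derivative f (at z) h))"
    by (rule frechet_derivative_at[symmetric])
  then show ?thesis
    by (simp add: Zop_eq smooth_cnj holo_imp_smooth assms holoD(2)[OF assms])
qed

lemma Zop_mult:
  assumes "smooth f" "smooth g"
  shows "Zop V m (\<lambda>z. f z * g z) z = f z * Zop V m g z + Zop V m f z * g z"
proof -
  have "((\<lambda>z. f z * g z) has_derivative (\<lambda>h. f z * frechet_derivative g (at z) h + frechet_derivative f (at z) h * g z)) (at z)"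
    by (intro has_derivative_mult smooth_has_derivative assms)
  then have eq: "frechet_derivative (\<lambda>z. f z * g z) (at z) = (\<lambda>h. f z * frechet_derivative g (at z) h + frechet_derivative f (at z) h * g z)"
    by (rule frechet_derivative_at[symmetric])
  show ?thesis
    unfolding Zop_eq[OF smooth_mult[OF assms]] Zop_eq[OF assms(1)] Zop_eq[OF assms(2)] eq by (simp add: field_simps)
qed

lemma smooth_Eul: "smooth (\<lambda>z. c *s Eul z)"
  by (intro smooth_bounded_linear[OF bounded_linear_vec_scale2] smooth_bounded_linear_ident bounded_linear_Eul)

lemma smooth_Zop:
  assumes "smooth f" shows "smooth (Zop V m f)"
proof -
  have "smooth (\<lambda>z. (1/2) * (frechet_derivative f (at z) (1 *s Eul z) - \<i> * frechet_derivative f (at z) (\<i> *s Eul z)))"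
    by (intro smooth_mult smooth_const smooth_diff smooth_derivative_apply[OF assms smooth_ident] smooth_Eul)
  then show ?thesis by (simp add: Zop_eq[OF assms, abs_def])
qed

lemma Cc_inf_Zop:
  assumes "Cc_inf f" shows "Cc_inf (Zop V m f)"
proof -
  have "Cc_inf (\<lambda>z. (1/2) * (frechet_derivative f (at z) (1 *s Eul z) - \<i> * frechet_derivative f (at z) (\<i> *s Eul z)))"
    by (intro Cc_inf_mult_left Cc_inf_diff smooth_const Cc_inf_derivative_apply[OF assms] smooth_Eul)
  then show ?thesis by (simp add: Zop_eq[OF Cc_inf_smooth[OF assms], abs_def])
qed

end

context heat_group begin

lemma LL_combination:
  assumes "smooth f"
  shows "L (a *\<^sub>R u + b *\<^sub>R v) (L (a *\<^sub>R u + b *\<^sub>R v) f) z =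
    of_real a * (of_real a * L u (L u f) z + of_real b * L u (L v f) z) + of_real b * (of_real a * L v (L u f) z + of_real b * L v (L v f) z)"
proof -
  have 1: "L (a *\<^sub>R u + b *\<^sub>R v) g z = of_real a * L u g z + of_real b * L v g z" if "smooth g" for g z
    using that by (simp add: L_vec_add L_vec_scaleR) (simp add: scaleR_conv_of_real)
  have 2: "L w (\<lambda>z. of_real a * L u f z + of_real b * L v f z) z = of_real a * L w (L u f) z + of_real b * L w (L v f) z" for w z
    using assms by (subst L_add) (auto intro!: smooth_mult smooth_const smooth_L simp: L_cmult smooth_L)
  have "L (a *\<^sub>R u + b *\<^sub>R v) f = (\<lambda>z. of_real a * L u f z + of_real b * L v f z)" using 1[OF assms] by blast
  then show ?thesis
    by (simp only: 2 1[OF smooth_L[OF assms]]) (simp add: algebra_simps)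
qed

text \<open>When \<open>l u\<close> and \<open>l (i u)\<close> are expressed through
  \<open>u\<close> and \<open>i u\<close>, each mixed second derivative occurs twice with opposite
  signs; the pure ones collect the factor \<open>|l|^2\<close>.\<close>

lemma Lap_rotate:
  assumes f: "smooth f"
  shows "(\<Sum>i<2*k. L (l *s E i) (L (l *s E i) f) z) = of_real ((cmod l)\<^sup>2) * Lap f z"
proof -
  have "L (l *s u) (L (l *s u) f) z + L (l *s (\<i> *s u)) (L (l *s (\<i> *s u)) f) z =
      of_real ((cmod l)\<^sup>2) * (L u (L u f) z + L (\<i> *s u) (L (\<i> *s u) f) z)" for u
  proof -
    have 1: "l *s u = Re l *\<^sub>R u + Im l *\<^sub>R (\<i> *s u)"
      unfolding scaleR_eq_vec_scale
      by (simp add: vec.scale_left_distrib[symmetric] complex_eq[symmetric] mult.commute)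
    have 2: "l *s (\<i> *s u) = Re l *\<^sub>R (\<i> *s u) + (- Im l) *\<^sub>R u"
      unfolding scaleR_eq_vec_scale vec.scale_scale vec.scale_left_distrib[symmetric]
      by (rule arg_cong[of _ _ "\<lambda>c. c *s u"]) (simp add: complex_eq_iff)
    show ?thesis
      unfolding 1 2 LL_combination[OF f] cmod_power2 by (simp add: algebra_simps power2_eq_square)
  qed
  then show ?thesis
    using sum_E[of "\<lambda>v. L (l *s v) (L (l *s v) f) z"] by (simp add: subLap_def sum_distrib_left)
qed

text \<open>As functions of \<open>(s, z)\<close> both sides solve the heat equation with initial
  value \<open>f\<close>: the chain rule in time produces the same \<open>|l|^2\<close> as
  \<open>Lap_rotate\<close>. Their difference \<open>D\<close> is bounded and vanishes uniformly at
  time 0, so the maximum principle applies.\<close>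

lemma U_dil:
  assumes f: "Cc_inf f" and l: "l \<noteq> 0" and s: "s > 0"
  shows "U (\<lambda>y. f (dl (inverse l) y)) ((cmod l)\<^sup>2 * s) (dl l z) = U f s z"
proof -
  define g where "g y = f (dl (inverse l) y)" for y
  define r where "r = (cmod l)\<^sup>2"
  have r: "r > 0" using l by (simp add: r_def)
  have g: "Cc_inf g" unfolding g_def using l by (intro Cc_inf_dil f) simp
  have gl: "g (dl l z) = f z" for z by (simp add: g_def dil_inverse l)
  define D where "D s z = U f s z - U g (r * s) (dl l z)" for s z
  obtain B where B: "B > 0" "\<And>z. cmod (f z) \<le> B" by (rule Cc_inf_bounded[OF f]) blast
  have Bg: "cmod (g z) \<le> B" for z using B by (simp add: g_def)
  have D_bound: "cmod (D s z) \<le> 2 * B" if "s > 0" for s z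
    using U_bounded[OF that f B(2), of z] U_bounded[OF _ g Bg, of "r * s" "dl l z"] r that
      norm_triangle_ineq4[of "U f s z" "U g (r * s) (dl l z)"] by (simp add: D_def)
  have D_cont: "continuous_on ({0<..} \<times> UNIV) (\<lambda>p. D (fst p) (snd p))"
    unfolding D_def
    by (intro continuous_intros U_continuous f
        continuous_on_compose2[OF U_continuous[OF g], of _ "\<lambda>p. (r * fst p, dl l (snd p))", unfolded fst_conv snd_conv])
      (use r in auto)
  have D_lim: "\<exists>d>0. \<forall>s z. 0 < s \<and> s < d \<longrightarrow> cmod (D s z) < e" if "e > 0" for e
  proof -
    have "\<forall>\<^sub>F s in at_right 0. \<forall>z\<in>UNIV. dist (U f s z) (f z) < e / 2" "\<forall>\<^sub>F s in at_right 0. \<forall>z\<in>UNIV. dist (U g s z) (g z) < e / 2"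
      using U_initial[OF f] U_initial[OF g] that unfolding uniform_limit_iff by (meson half_gt_zero)+
    then obtain d d' where d: "d > 0" "\<And>s z. 0 < s \<Longrightarrow> s < d \<Longrightarrow> dist (U f s z) (f z) < e / 2"
      and d': "d' > 0" "\<And>s z. 0 < s \<Longrightarrow> s < d' \<Longrightarrow> dist (U g s z) (g z) < e / 2"
      unfolding eventually_at_right_field by (metis UNIV_I)
    show ?thesis
    proof (intro exI[of _ "min d (d' / r)"] conjI allI impI)
      fix s z assume "0 < s \<and> s < min d (d' / r)"
      then have "dist (U f s z) (f z) < e / 2" "dist (U g (r * s) (dl l z)) (f z) < e / 2"
        using d(2)[of s z] d'(2)[of "r * s" "dl l z"] r by (auto simp: gl field_simps)
      then show "cmod (D s z) < e"
        unfolding D_def dist_norm[symmetric] using dist_triangle_half_l[of "U f s z" "f z" e "U g (r * s) (dl l z)"]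
        by (metis dist_commute dist_triangle_half_r)
    qed (use d d' r in auto)
  qed
  \<comment> \<open>Second derivatives of \<open>D\<close> along \<open>E i\<close>. Moving
    \<open>z\<close> along \<open>E i\<close> moves \<open>dl l z\<close> along
    \<open>l *s E i\<close>, hence the rotated directions in the second integral.\<close>
  define w2 where "w2 i s z = (\<integral>y. L (E i) (L (E i) (ph f z)) y \<partial>mu s) -
      (\<integral>y. L (l *s E i) (L (l *s E i) (ph g (dl l z))) y \<partial>mu (r * s))" for i s z
  have sum_w2: "(\<Sum>i<2*k. w2 i s z) = (\<integral>y. Lap (ph f z) y \<partial>mu s) - of_real r * (\<integral>y. Lap (ph g (dl l z)) y \<partial>mu (r * s))"
    if "s > 0" for s z
  proof -
    have "(\<Sum>i<2*k. \<integral>y. L (l *s E i) (L (l *s E i) (ph g (dl l z))) y \<partial>mu (r * s)) =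
        (\<integral>y. (\<Sum>i<2*k. L (l *s E i) (L (l *s E i) (ph g (dl l z))) y) \<partial>mu (r * s))"
      using that r by (intro Bochner_Integration.integral_sum[symmetric] Cc_inf_integrable_mu Cc_inf_L Cc_inf_ph g) auto
    also have "\<dots> = of_real r * (\<integral>y. Lap (ph g (dl l z)) y \<partial>mu (r * s))"
      unfolding Lap_rotate[OF Cc_inf_smooth[OF Cc_inf_ph[OF g]]] r_def by simp
    finally have "(\<Sum>i<2*k. \<integral>y. L (l *s E i) (L (l *s E i) (ph g (dl l z))) y \<partial>mu (r * s)) = \<dots>" .
    moreover have "(\<Sum>i<2*k. \<integral>y. L (E i) (L (E i) (ph f z)) y \<partial>mu s) = (\<integral>y. Lap (ph f z) y \<partial>mu s)"
      unfolding subLap_eq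
      using that by (intro Bochner_Integration.integral_sum[symmetric] Cc_inf_integrable_mu Cc_inf_L Cc_inf_ph f) auto
    ultimately show ?thesis by (simp add: w2_def sum_subtractf)
  qed
  have D_s: "((\<lambda>s. D s z) has_vector_derivative (\<Sum>i<2*k. w2 i s z) / 4) (at s)" if "s > 0" for s z
  proof -
    have "((\<lambda>s. r * s) has_vector_derivative r) (at s)"
      unfolding has_real_derivative_iff_has_vector_derivative[symmetric] by (auto intro!: derivative_eq_intros)
    from vector_diff_chain_at[OF this heat_equation[OF _ g, of "r * s" "dl l z"]]
    have "((\<lambda>s. U g (r * s) (dl l z)) has_vector_derivative r *\<^sub>R ((\<integral>y. Lap (ph g (dl l z)) y \<partial>mu (r * s)) / 4)) (at s)"
      using r that by (simp add: o_def)
    from has_vector_derivative_diff[OF heat_equation[OF that f, of z] this]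
    show ?thesis unfolding D_def sum_w2[OF that] by (simp add: scaleR_conv_of_real diff_divide_distrib)
  qed
  have D_z: "\<exists>h'. (\<forall>t. ((\<lambda>t. D s (mul z (t *\<^sub>R E i))) has_vector_derivative h' t) (at t)) \<and> (h' has_vector_derivative w2 i s z) (at 0)"
    if "s > 0" "i < 2 * k" for s z i
  proof -
    have rs: "r * s > 0" using that r by simp
    have dE: "dl l (mul z (t *\<^sub>R E i)) = mul (dl l z) (t *\<^sub>R (l *s E i))" for t
      by (simp add: dil_mul_exp dil_V1[OF E_in_V1[OF that(2)]])
    show ?thesis
      unfolding D_def w2_def dE
      by (rule exI[of _ "\<lambda>t. - (\<integral>y. L (E i) (ph f z) (mul y (- (t *\<^sub>R E i))) \<partial>mu s) -
          - (\<integral>y. L (l *s E i) (ph g (dl l z)) (mul y (- (t *\<^sub>R (l *s E i)))) \<partial>mu (r * s))"])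
        (intro conjI allI has_vector_derivative_diff U_along(1)[OF that(1) f] U_along(1)[OF rs g]
          U_along(2)[OF that(1) f] U_along(2)[OF rs g])
  qed
  \<comment> \<open>The factor \<open>c\<close> is left free so that \<open>c = cnj (D s z)\<close>
    can be chosen at the end, which turns the real part into \<open>|D|^2\<close>.\<close>
  have *: "Re (c * D s z) \<le> 0" if "s > 0" for c s z
  proof (rule max_principle[where w = "\<lambda>s z. Re (c * D s z)" and ?w2.0 = "\<lambda>i s z. Re (c * w2 i s z)" and M = "cmod c * (2 * B)"])
    have Rec: "bounded_linear (\<lambda>w. Re (c * w))"
      by (rule bounded_linear_compose[OF bounded_linear_Re bounded_linear_mult_right])
    show "Re (c * D s z) \<le> cmod c * (2 * B)" if "s > 0" for s z
      using complex_Re_le_cmod[of "c * D s z"] mult_left_mono[OF D_bound[OF that], of "cmod c" z] by (simp add: norm_mult)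
    show "continuous_on ({0<..} \<times> UNIV) (\<lambda>p. Re (c * D (fst p) (snd p)))" by (intro continuous_intros D_cont)
    show "\<exists>d>0. \<forall>s z. 0 < s \<and> s < d \<longrightarrow> Re (c * D s z) < e" if e: "e > 0" for e
    proof -
      obtain d where d: "d > 0" "\<And>s z. 0 < s \<and> s < d \<Longrightarrow> cmod (D s z) < e / (cmod c + 1)"
        using D_lim[of "e / (cmod c + 1)"] e by (metis add_nonneg_pos divide_pos_pos norm_ge_zero zero_less_one)
      have "Re (c * D s z) < e" if "0 < s \<and> s < d" for s z
      proof -
        have "Re (c * D s z) \<le> cmod c * cmod (D s z)" using complex_Re_le_cmod[of "c * D s z"] by (simp add: norm_mult)
        also have "\<dots> \<le> (cmod c + 1) * cmod (D s z)" by (simp add: mult_right_mono)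
        also have "\<dots> < e" using d(2)[OF that, of z] pos_less_divide_eq[of "cmod c + 1" "cmod (D s z)" e]
          by (simp add: add_nonneg_pos mult.commute)
        finally show ?thesis .
      qed
      then show ?thesis using d(1) by blast
    qed
    show "((\<lambda>s. Re (c * D s z)) has_real_derivative (\<Sum>i<2*k. Re (c * w2 i s z)) / 4) (at s)" if "s > 0" for s z
    proof -
      have "(\<Sum>i<2*k. Re (c * w2 i s z)) / 4 = Re (c * ((\<Sum>i<2*k. w2 i s z) / 4))"
        by (simp add: sum_distrib_left Re_sum[symmetric] del: Re_sum times_complex.sel)
      then show ?thesis
        using bounded_linear.has_vector_derivative[OF Rec D_s[OF that, of z]]
        by (simp only: has_real_derivative_iff_has_vector_derivative)
    qed
    show "\<exists>h'. (\<forall>t. ((\<lambda>t. Re (c * D s (mul z (t *\<^sub>R E i)))) has_real_derivative h' t) (at t)) \<and>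
        (h' has_real_derivative Re (c * w2 i s z)) (at 0)" if si: "s > 0" "i < 2 * k" for s z i
    proof -
      obtain h' where "\<And>t. ((\<lambda>t. D s (mul z (t *\<^sub>R E i))) has_vector_derivative h' t) (at t)" "(h' has_vector_derivative w2 i s z) (at 0)"
        using D_z[OF si, of z] by blast
      then show ?thesis
        using bounded_linear.has_vector_derivative[OF Rec]
        by (intro exI[of _ "\<lambda>t. Re (c * h' t)"]) (simp add: has_real_derivative_iff_has_vector_derivative del: times_complex.sel)
    qed
  qed (rule that)
  have "Re (cnj (D s z) * D s z) = (cmod (D s z))\<^sup>2"
    unfolding cmod_power2 by (simp add: power2_eq_square)
  then have "D s z = 0" using *[OF s, of "cnj (D s z)" z] by simp
  then show ?thesis by (simp add: D_def g_def[abs_def] r_def)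
qed

text \<open>At the identity \<open>U_dil\<close> says that the dilation by \<open>l\<close> carries
  \<open>mu s\<close> to \<open>mu (|l|^2 s)\<close>, tested on \<open>Cc_inf\<close>; composition
  with inversion undoes the inverse inside \<open>U\<close>.\<close>

lemma integral_dil:
  assumes f: "Cc_inf f" and l: "l \<noteq> 0" and s: "s > 0"
  shows "(\<integral>y. f (dl l y) \<partial>mu s) = (\<integral>y. f y \<partial>mu ((cmod l)\<^sup>2 * s))"
proof -
  let ?g = "\<lambda>y. f (dl l (- y))"
  have neg: "dl l (- dl (inverse l) y) = - y" for y
    by (simp add: linear_neg[OF bounded_linear.linear[OF dil_bounded_linear]] dil_inverse l)
  have g: "Cc_inf ?g" using Cc_inf_ph[OF Cc_inf_dil[OF f l], of 0] by simp
  have f': "Cc_inf (\<lambda>y. f (- y))" using Cc_inf_ph[OF f, of 0] by simp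
  have rs: "(cmod l)\<^sup>2 * s > 0" using l s by simp
  show ?thesis
    using U_dil[OF g l s, of 0] U_mu[OF s g, of 0] U_mu[OF rs f', of 0] by (simp add: neg dil_0)
qed

lemma flow_integral_derivative:
  assumes f: "Cc_inf f" and s: "s > 0"
  shows "((\<lambda>t. \<integral>y. f (dl (exp (c * complex_of_real t)) y) \<partial>mu s) has_vector_derivative
    (\<integral>y. frechet_derivative f (at y) (c *s Eul y) \<partial>mu s)) (at 0)"
proof -
  let ?D = "\<lambda>y. frechet_derivative f (at y) (c *s Eul y)"
  have D: "Cc_inf ?D" by (rule Cc_inf_derivative_apply[OF f smooth_Eul])
  obtain B where B: "B > 0" "\<And>z. cmod (?D z) \<le> B" by (rule Cc_inf_bounded[OF D]) blast
  interpret finite_measure "mu s" using finite_measure_mu[OF s] .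
  have "((\<lambda>t. \<integral>y. f (dl (exp (c * complex_of_real t)) y) \<partial>mu s) has_vector_derivative
    (\<integral>y. (\<lambda>t y. ?D (dl (exp (c * complex_of_real t)) y)) 0 y \<partial>mu s)) (at 0)"
  proof (rule has_vector_derivative_integral[where G = "\<lambda>y. B"])
    show "integrable (mu s) (\<lambda>y. f (dl (exp (c * complex_of_real t)) y))" for t
      by (intro Cc_inf_integrable_mu s Cc_inf_dil f) simp
    show "((\<lambda>t. f (dl (exp (c * complex_of_real t)) y)) has_vector_derivative ?D (dl (exp (c * complex_of_real t)) y)) (at t)" for t y
      by (rule flow_deriv_smooth[OF Cc_inf_smooth[OF f]])
    show "(\<lambda>y. ?D (dl (exp (c * complex_of_real 0)) y)) \<in> borel_measurable (mu s)"
      using Cc_inf_borel_measurable[OF D] by (simp add: dil_1)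
  qed (use B in auto)
  then show ?thesis by (simp add: dil_1)
qed

lemma integral_Lap:
  assumes f: "Cc_inf f" and s: "s > 0"
  shows "(\<integral>y. Lap f y \<partial>mu s) = (4 / s) * (\<integral>y. Zop V m f y \<partial>mu s)"
proof -
  let ?X = "\<integral>y. frechet_derivative f (at y) (1 *s Eul y) \<partial>mu s" and ?Y = "\<integral>y. frechet_derivative f (at y) (\<i> *s Eul y) \<partial>mu s"
  have X: "((\<lambda>t. \<integral>y. f y \<partial>mu (exp (2 * t) * s)) has_vector_derivative ?X) (at 0)"
  proof -
    have "(cmod (exp (1 * complex_of_real t)))\<^sup>2 = exp (2 * t)" for t
      by (simp add: power2_eq_square exp_add[symmetric])
    then show ?thesis
      using flow_integral_derivative[OF f s, of 1] integral_dil[OF f _ s, of "exp (1 * complex_of_real _)"] by simp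
  qed
  have "((\<lambda>t. exp (2 * t) * s) has_vector_derivative 2 * s) (at 0)"
    unfolding has_real_derivative_iff_has_vector_derivative[symmetric] by (auto intro!: derivative_eq_intros)
  from vector_diff_chain_at[OF this, of "\<lambda>s. \<integral>y. f y \<partial>mu s"] heat_equation_weak[OF s f]
  have "((\<lambda>t. \<integral>y. f y \<partial>mu (exp (2 * t) * s)) has_vector_derivative (2 * s) *\<^sub>R ((\<integral>y. Lap f y \<partial>mu s) / 4)) (at 0)"
    by (simp add: o_def)
  from vector_derivative_unique_at[OF X this] have 1: "?X = of_real (s / 2) * (\<integral>y. Lap f y \<partial>mu s)"
    by (simp add: scaleR_conv_of_real)
  have "((\<lambda>t::real. \<integral>y. f y \<partial>mu s) has_vector_derivative ?Y) (at 0)"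
    using flow_integral_derivative[OF f s, of \<i>] integral_dil[OF f _ s, of "exp (\<i> * complex_of_real _)"] by simp
  then have 2: "?Y = 0" using vector_derivative_unique_at has_vector_derivative_const by blast
  have "(\<integral>y. Zop V m f y \<partial>mu s) = (\<integral>y. (1/2) * (frechet_derivative f (at y) (1 *s Eul y) - \<i> * frechet_derivative f (at y) (\<i> *s Eul y)) \<partial>mu s)"
    by (simp add: Zop_eq[OF Cc_inf_smooth[OF f]])
  also have "\<dots> = (1/2) * (?X - \<i> * ?Y)"
    by (subst integral_mult_right_zero, subst Bochner_Integration.integral_diff)
      (auto intro!: integrable_mult_right Cc_inf_integrable_mu s Cc_inf_derivative_apply f smooth_Eul[of 1, simplified] smooth_Eul)
  finally have "(\<integral>y. Zop V m f y \<partial>mu s) = of_real (s / 4) * (\<integral>y. Lap f y \<partial>mu s)"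
    unfolding 1 2 by simp
  then show ?thesis using s by (simp add: field_simps)
qed

lemma integral_rotation:
  assumes "Cc_inf f" "cmod l = 1" "s > 0"
  shows "(\<integral>y. f (dl l y) \<partial>mu s) = (\<integral>y. f y \<partial>mu s)"
  using integral_dil[OF assms(1) _ assms(3), of l] assms(2) by force

end

subsection \<open>Square-integrable functions\<close>

definition sqi :: "'a measure \<Rightarrow> ('a \<Rightarrow> complex) \<Rightarrow> bool" where
  "sqi M f \<longleftrightarrow> f \<in> borel_measurable M \<and> integrable M (\<lambda>z. (cmod (f z))\<^sup>2)"

lemma borel_measurable_cnj [measurable (raw)]:
  "f \<in> borel_measurable M \<Longrightarrow> (\<lambda>z. cnj (f z)) \<in> borel_measurable M"
  by (rule borel_measurable_continuous_on[OF continuous_on_cnj[OF continuous_on_id]])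

lemma sum_squares_bound': "cmod (u + v) ^ 2 \<le> 2 * (cmod u)\<^sup>2 + 2 * (cmod v)\<^sup>2"
proof -
  have "cmod (u + v) ^ 2 \<le> (cmod u + cmod v)\<^sup>2" by (intro power_mono norm_triangle_ineq) auto
  also have "\<dots> \<le> 2 * (cmod u)\<^sup>2 + 2 * (cmod v)\<^sup>2"
    using sum_squares_bound[of "cmod u" "cmod v"] by (simp add: power2_sum)
  finally show ?thesis .
qed

lemma mult_le_sum_squares: "a * b \<le> a\<^sup>2 + (b::real)\<^sup>2"
proof -
  have "2 * (a * b) \<le> a\<^sup>2 + b\<^sup>2" using sum_squares_bound[of a b] by (simp add: mult.assoc)
  then show ?thesis using zero_le_power2[of a] zero_le_power2[of b] by linarith
qed

lemma sqi_bound: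
  assumes "sqi M f" "sqi M g" "h \<in> borel_measurable M" "\<And>z. cmod (h z) \<le> C * (cmod (f z) + cmod (g z))"
  shows "sqi M h"
  unfolding sqi_def
proof (intro conjI assms(3))
  show "integrable M (\<lambda>z. (cmod (h z))\<^sup>2)"
  proof (rule Bochner_Integration.integrable_bound)
    show "integrable M (\<lambda>z. C\<^sup>2 * (2 * (cmod (f z))\<^sup>2 + 2 * (cmod (g z))\<^sup>2))"
      using assms(1,2) unfolding sqi_def by (intro integrable_mult_right Bochner_Integration.integrable_add) auto
    have "(cmod (h z))\<^sup>2 \<le> C\<^sup>2 * (2 * (cmod (f z))\<^sup>2 + 2 * (cmod (g z))\<^sup>2)" for z
    proof -
      have "(cmod (h z))\<^sup>2 \<le> (C * (cmod (f z) + cmod (g z)))\<^sup>2" by (intro power_mono assms(4)) auto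
      also have "\<dots> = C\<^sup>2 * (cmod (f z) + cmod (g z))\<^sup>2" by (simp add: power_mult_distrib)
      also have "\<dots> \<le> C\<^sup>2 * (2 * (cmod (f z))\<^sup>2 + 2 * (cmod (g z))\<^sup>2)"
        using sum_squares_bound[of "cmod (f z)" "cmod (g z)"] by (intro mult_left_mono) (auto simp: power2_sum)
      finally show ?thesis .
    qed
    then show "AE z in M. norm ((cmod (h z))\<^sup>2) \<le> norm (C\<^sup>2 * (2 * (cmod (f z))\<^sup>2 + 2 * (cmod (g z))\<^sup>2))"
      by (intro AE_I2) simp
  qed (use assms(3) in measurable)
qed

lemma sqi_measurable: "sqi M f \<Longrightarrow> f \<in> borel_measurable M"
  by (simp add: sqi_def)

lemma sqi_add: "sqi M f \<Longrightarrow> sqi M g \<Longrightarrow> sqi M (\<lambda>z. f z + g z)"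
  by (rule sqi_bound[of M f g _ 1]) (auto intro: norm_triangle_ineq borel_measurable_add sqi_measurable)

lemma sqi_diff: "sqi M f \<Longrightarrow> sqi M g \<Longrightarrow> sqi M (\<lambda>z. f z - g z)"
  by (rule sqi_bound[of M f g _ 1]) (auto intro: norm_triangle_ineq4 borel_measurable_diff sqi_measurable)

lemma sqi_cmult: "sqi M f \<Longrightarrow> sqi M (\<lambda>z. c * f z)"
  by (rule sqi_bound[of M f f _ "cmod c"]) (auto simp: norm_mult mult_left_mono intro!: borel_measurable_times borel_measurable_const dest: sqi_measurable)

lemma sqi_integrable_mult:
  assumes "sqi M f" "sqi M g"
  shows "integrable M (\<lambda>z. cmod (f z) * cmod (g z))" "integrable M (\<lambda>z. f z * g z)" "integrable M (\<lambda>z. f z * cnj (g z))"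
proof -
  have m [measurable]: "f \<in> borel_measurable M" "g \<in> borel_measurable M" using assms by (auto simp: sqi_def)
  show 1: "integrable M (\<lambda>z. cmod (f z) * cmod (g z))"
  proof (rule Bochner_Integration.integrable_bound)
    show "integrable M (\<lambda>z. (cmod (f z))\<^sup>2 + (cmod (g z))\<^sup>2)" using assms by (simp add: sqi_def)
    show "AE z in M. norm (cmod (f z) * cmod (g z)) \<le> norm ((cmod (f z))\<^sup>2 + (cmod (g z))\<^sup>2)"
      by (intro AE_I2) (simp add: mult_le_sum_squares)
  qed (use m in measurable)
  show "integrable M (\<lambda>z. f z * g z)" "integrable M (\<lambda>z. f z * cnj (g z))"
    by (rule Bochner_Integration.integrable_bound[OF 1], use m in measurable, simp add: norm_mult)+
qed

text \<open>The integral of \<open>(|f| - t |g|)^2\<close> is nonnegative for every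
  \<open>t\<close>; evaluate at the minimum \<open>t = ?C / ?B\<close>. For \<open>?B = 0\<close> it
  is affine in \<open>t\<close> and would equal \<open>-1\<close> at
  \<open>t = (?A + 1) / (2 * ?C)\<close> if \<open>?C\<close> were nonzero.\<close>

lemma Cauchy_Schwarz_sqi:
  assumes "sqi M f" "sqi M g"
  shows "(\<integral>z. cmod (f z) * cmod (g z) \<partial>M)\<^sup>2 \<le> (\<integral>z. (cmod (f z))\<^sup>2 \<partial>M) * (\<integral>z. (cmod (g z))\<^sup>2 \<partial>M)"
proof -
  let ?A = "\<integral>z. (cmod (f z))\<^sup>2 \<partial>M" and ?B = "\<integral>z. (cmod (g z))\<^sup>2 \<partial>M" and ?C = "\<integral>z. cmod (f z) * cmod (g z) \<partial>M"
  have q: "0 \<le> ?A - 2 * t * ?C + t\<^sup>2 * ?B" for t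
  proof -
    have "0 \<le> (\<integral>z. (cmod (f z) - t * cmod (g z))\<^sup>2 \<partial>M)" by simp
    also have "\<dots> = (\<integral>z. (cmod (f z))\<^sup>2 - 2 * t * (cmod (f z) * cmod (g z)) + t\<^sup>2 * (cmod (g z))\<^sup>2 \<partial>M)"
      by (simp add: power2_diff power_mult_distrib algebra_simps)
    also have "\<dots> = ?A - 2 * t * ?C + t\<^sup>2 * ?B"
      using assms sqi_integrable_mult(1)[OF assms] by (simp add: sqi_def)
    finally show ?thesis .
  qed
  have C0: "?C \<ge> 0" by simp
  show ?thesis
  proof (cases "?B = 0")
    case True
    have "?C = 0"
    proof (rule ccontr)
      assume "?C \<noteq> 0"
      then show False using q[of "(?A + 1) / (2 * ?C)"] True C0 by simp
    qed
    then show ?thesis using True by simp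
  next
    case False
    then have B: "?B > 0" by (simp add: order_less_le)
    have "0 \<le> ?B * (?A - 2 * (?C / ?B) * ?C + (?C / ?B)\<^sup>2 * ?B)"
      using q[of "?C / ?B"] B by (intro mult_nonneg_nonneg) auto
    also have "\<dots> = ?A * ?B - ?C\<^sup>2" using B by (simp add: field_simps power2_eq_square)
    finally show ?thesis by simp
  qed
qed

lemma Cauchy_Schwarz_norm:
  assumes "sqi M f" "sqi M g"
  shows "cmod (\<integral>z. f z * cnj (g z) \<partial>M) \<le> sqrt (\<integral>z. (cmod (f z))\<^sup>2 \<partial>M) * sqrt (\<integral>z. (cmod (g z))\<^sup>2 \<partial>M)"
proof -
  have "cmod (\<integral>z. f z * cnj (g z) \<partial>M) \<le> (\<integral>z. cmod (f z) * cmod (g z) \<partial>M)"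
    using integral_norm_bound[of M "\<lambda>z. f z * cnj (g z)"] by (simp add: norm_mult)
  also have "\<dots> \<le> sqrt ((\<integral>z. (cmod (f z))\<^sup>2 \<partial>M) * (\<integral>z. (cmod (g z))\<^sup>2 \<partial>M))"
    using Cauchy_Schwarz_sqi[OF assms] real_le_rsqrt by blast
  finally show ?thesis by (simp add: real_sqrt_mult)
qed

lemma sqi_inner_tendsto_zero:
  assumes "\<And>n::nat. sqi M (f n)" "\<And>n. sqi M (g n)" "(\<lambda>n. \<integral>z. (cmod (f n z))\<^sup>2 \<partial>M) \<longlonglongrightarrow> 0" "(\<lambda>n. \<integral>z. (cmod (g n z))\<^sup>2 \<partial>M) \<longlonglongrightarrow> b"
  shows "(\<lambda>n. \<integral>z. f n z * cnj (g n z) \<partial>M) \<longlonglongrightarrow> 0"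
proof (rule Lim_null_comparison)
  show "\<forall>\<^sub>F n in sequentially. cmod (\<integral>z. f n z * cnj (g n z) \<partial>M) \<le> sqrt (\<integral>z. (cmod (f n z))\<^sup>2 \<partial>M) * sqrt (\<integral>z. (cmod (g n z))\<^sup>2 \<partial>M)"
    using Cauchy_Schwarz_norm[OF assms(1,2)] by simp
  have "(\<lambda>n. sqrt (\<integral>z. (cmod (f n z))\<^sup>2 \<partial>M) * sqrt (\<integral>z. (cmod (g n z))\<^sup>2 \<partial>M)) \<longlonglongrightarrow> sqrt 0 * sqrt b"
    by (intro tendsto_intros assms)
  then show "(\<lambda>n. sqrt (\<integral>z. (cmod (f n z))\<^sup>2 \<partial>M) * sqrt (\<integral>z. (cmod (g n z))\<^sup>2 \<partial>M)) \<longlonglongrightarrow> 0" by simp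
qed

lemma sqi_inner_tendsto:
  assumes f: "\<And>n::nat. sqi M (f n)" "sqi M f'" "(\<lambda>n. \<integral>z. (cmod (f n z - f' z))\<^sup>2 \<partial>M) \<longlonglongrightarrow> 0"
    and g: "\<And>n. sqi M (g n)" "sqi M g'" "(\<lambda>n. \<integral>z. (cmod (g n z - g' z))\<^sup>2 \<partial>M) \<longlonglongrightarrow> 0"
  shows "(\<lambda>n. \<integral>z. f n z * cnj (g n z) \<partial>M) \<longlonglongrightarrow> (\<integral>z. f' z * cnj (g' z) \<partial>M)"
proof -
  let ?a = "\<lambda>n z. f n z - f' z" and ?b = "\<lambda>n z. g n z - g' z"
  have s: "sqi M (?a n)" "sqi M (?b n)" for n using f g by (auto intro: sqi_diff)
  have eq: "(\<integral>z. f n z * cnj (g n z) \<partial>M) = (\<integral>z. ?a n z * cnj (?b n z) \<partial>M) + (\<integral>z. ?a n z * cnj (g' z) \<partial>M)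
      + (\<integral>z. f' z * cnj (?b n z) \<partial>M) + (\<integral>z. f' z * cnj (g' z) \<partial>M)" for n
  proof -
    have "(\<integral>z. f n z * cnj (g n z) \<partial>M) = (\<integral>z. ?a n z * cnj (?b n z) + ?a n z * cnj (g' z) + f' z * cnj (?b n z) + f' z * cnj (g' z) \<partial>M)"
      by (rule Bochner_Integration.integral_cong) (auto simp: algebra_simps)
    also have "\<dots> = (\<integral>z. ?a n z * cnj (?b n z) \<partial>M) + (\<integral>z. ?a n z * cnj (g' z) \<partial>M)
      + (\<integral>z. f' z * cnj (?b n z) \<partial>M) + (\<integral>z. f' z * cnj (g' z) \<partial>M)"
      using s f g by (simp only: Bochner_Integration.integral_add Bochner_Integration.integrable_add sqi_integrable_mult(3))
    finally show ?thesis .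
  qed
  have 1: "(\<lambda>n. \<integral>z. ?a n z * cnj (?b n z) \<partial>M) \<longlonglongrightarrow> 0" "(\<lambda>n. \<integral>z. ?a n z * cnj (g' z) \<partial>M) \<longlonglongrightarrow> 0"
    by (rule sqi_inner_tendsto_zero[OF s f(3) g(3)], rule sqi_inner_tendsto_zero[OF s(1) g(2) f(3) tendsto_const])
  have "(\<lambda>n. \<integral>z. ?b n z * cnj (f' z) \<partial>M) \<longlonglongrightarrow> 0"
    by (rule sqi_inner_tendsto_zero[OF s(2) f(2) g(3) tendsto_const])
  from tendsto_cnj[OF this] have 2: "(\<lambda>n. \<integral>z. f' z * cnj (?b n z) \<partial>M) \<longlonglongrightarrow> 0"
    by (simp add: Bochner_Integration.integral_cnj[symmetric] mult.commute[of "cnj _"] mult.commute[of "f' _"] del: Bochner_Integration.integral_cnj)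
  have "(\<lambda>n. \<integral>z. f n z * cnj (g n z) \<partial>M) \<longlonglongrightarrow> 0 + 0 + 0 + (\<integral>z. f' z * cnj (g' z) \<partial>M)"
    unfolding eq by (intro tendsto_add 1 2 tendsto_const)
  then show ?thesis by simp
qed

text \<open>Fatou's lemma, since the cut-offs converge pointwise without any assumed monotonicity in
  \<open>n\<close>.\<close>

lemma integrable_of_cutoffs:
  fixes G :: "'a \<Rightarrow> real" and p :: "nat \<Rightarrow> 'a \<Rightarrow> real"
  assumes G: "G \<in> borel_measurable M" "\<And>z. 0 \<le> G z"
    and p: "\<And>n z. 0 \<le> p n z" "\<And>z. (\<lambda>n. p n z) \<longlonglongrightarrow> 1"
    and int: "\<And>n. integrable M (\<lambda>z. G z * p n z)" "\<And>n. (\<integral>z. G z * p n z \<partial>M) \<le> K"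
  shows "integrable M G" "(\<integral>z. G z \<partial>M) \<le> K"
proof -
  have "0 \<le> (\<integral>z. G z * p 0 z \<partial>M)" by (intro integral_nonneg_AE AE_I2 mult_nonneg_nonneg G p)
  then have K: "K \<ge> 0" using int(2)[of 0] by linarith
  have "ennreal (G z) = liminf (\<lambda>n. ennreal (G z * p n z))" for z
  proof -
    have "(\<lambda>n. ennreal (G z * p n z)) \<longlonglongrightarrow> ennreal (G z * 1)" by (intro tendsto_intros p)
    from lim_imp_Liminf[OF _ this] show ?thesis by simp
  qed
  then have "(\<integral>\<^sup>+z. ennreal (G z) \<partial>M) = (\<integral>\<^sup>+z. liminf (\<lambda>n. ennreal (G z * p n z)) \<partial>M)" by simp
  also have "\<dots> \<le> liminf (\<lambda>n. \<integral>\<^sup>+z. ennreal (G z * p n z) \<partial>M)"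
    by (rule nn_integral_liminf) (use int(1) in \<open>auto dest: borel_measurable_integrable\<close>)
  also have "\<dots> \<le> ennreal K"
  proof -
    have "(\<integral>\<^sup>+z. ennreal (G z * p n z) \<partial>M) \<le> ennreal K" for n
      using int G p by (subst nn_integral_eq_integral) (auto intro: ennreal_leI)
    then show ?thesis by (intro Liminf_le) auto
  qed
  finally have le: "(\<integral>\<^sup>+z. ennreal (G z) \<partial>M) \<le> ennreal K" .
  show "integrable M G"
    by (rule integrableI_bounded) (use G le in \<open>auto intro: le_less_trans\<close>)
  then show "(\<integral>z. G z \<partial>M) \<le> K" using le G K by (simp add: nn_integral_eq_integral)
qed

subsection \<open>The Dirichlet form on smooth functions\<close>

lemma (in heat_group) sqi_mu_L2:
  "a > 0 \<Longrightarrow> L2 (rho a) f \<longleftrightarrow> sqi (mu a) f"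
proof -
  assume a: "a > 0"
  have "integrable (mu a) (\<lambda>z. (cmod (f z))\<^sup>2) \<longleftrightarrow> integrable lborel (\<lambda>z. (cmod (f z))\<^sup>2 * rho a z)"
    if "f \<in> borel_measurable borel"
    using that a by (intro integrable_mu_real) auto
  then show ?thesis
    by (auto simp: L2_def sqi_def measurable_cong_sets[OF sets_mu refl])
qed

locale heat_form = heat_group br V m mul x k rho
  for br :: "complex^'n \<Rightarrow> complex^'n \<Rightarrow> complex^'n" and V :: "nat \<Rightarrow> (complex^'n) set" and m :: nat
    and mul :: "complex^'n \<Rightarrow> complex^'n \<Rightarrow> complex^'n"
    and x :: "nat \<Rightarrow> complex^'n" and k :: nat and rho :: "real \<Rightarrow> complex^'n \<Rightarrow> real" +
  fixes a :: real
  assumes a: "a > 0"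
begin

abbreviation "M \<equiv> mu a"
abbreviation "Z \<equiv> Zop V m"
abbreviation "Qa \<equiv> Q0 mul x k (rho a)"

lemma L2_sqi: "L2 (rho a) f \<longleftrightarrow> sqi M f"
  by (rule sqi_mu_L2[OF a])

lemma ipL2_eq: "f \<in> borel_measurable borel \<Longrightarrow> g \<in> borel_measurable borel \<Longrightarrow> ipL2 (rho a) f g = (\<integral>z. f z * cnj (g z) \<partial>M)"
  unfolding ipL2_def using a by (subst integral_mu) (auto intro!: borel_measurable_times borel_measurable_cnj)

lemma normL2_eq: "f \<in> borel_measurable borel \<Longrightarrow> normL2 (rho a) f = sqrt (\<integral>z. (cmod (f z))\<^sup>2 \<partial>M)"
  unfolding normL2_def using a by (subst integral_mu_real) auto

lemma smooth_measurable_M: "smooth f \<Longrightarrow> f \<in> borel_measurable M"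
  using smooth_borel_measurable[of f] by (simp add: measurable_cong_sets[OF sets_mu refl])

lemma sqi_bounded:
  assumes "f \<in> borel_measurable M" "\<And>z. cmod (f z) \<le> B" shows "sqi M f"
proof -
  interpret finite_measure M using finite_measure_mu[OF a] .
  have "(cmod (f z))\<^sup>2 \<le> B\<^sup>2" for z using assms(2)[of z] by (intro power_mono) auto
  then show ?thesis
    unfolding sqi_def using assms by (intro conjI integrable_const_bound[where B = "B\<^sup>2"]) auto
qed

lemma Cc_inf_sqi: "Cc_inf f \<Longrightarrow> sqi M f"
  by (rule Cc_inf_bounded, assumption, rule sqi_bounded) (auto intro: smooth_measurable_M Cc_inf_smooth)

lemma Q0_eq:
  assumes "smooth f" "smooth g" "\<And>i. i < 2 * k \<Longrightarrow> sqi M (L (E i) f)" "\<And>i. i < 2 * k \<Longrightarrow> sqi M (L (E i) g)"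
  shows "Qa f g = (\<Sum>i<2*k. \<integral>z. L (E i) f z * cnj (L (E i) g z) \<partial>M)"
proof -
  have "Qa f g = integral\<^sup>L lborel (\<lambda>z. (\<Sum>i<2*k. L (E i) f z * cnj (L (E i) g z)) * complex_of_real (rho a z))"
    unfolding Q0_def sum_E[of "\<lambda>v. L v f _ * cnj (L v g _)"] ..
  also have "\<dots> = (\<integral>z. (\<Sum>i<2*k. L (E i) f z * cnj (L (E i) g z)) \<partial>M)"
    using assms by (intro integral_mu[symmetric] a borel_measurable_sum smooth_borel_measurable smooth_mult smooth_L smooth_cnj)
  also have "\<dots> = (\<Sum>i<2*k. \<integral>z. L (E i) f z * cnj (L (E i) g z) \<partial>M)"
    using assms by (intro Bochner_Integration.integral_sum sqi_integrable_mult) auto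
  finally show ?thesis .
qed

lemma Q0_Cc: "Cc_inf f \<Longrightarrow> Cc_inf g \<Longrightarrow> Qa f g = (\<Sum>i<2*k. \<integral>z. L (E i) f z * cnj (L (E i) g z) \<partial>M)"
  by (intro Q0_eq Cc_inf_smooth Cc_inf_sqi Cc_inf_L)

lemma Q0_hermitian: "Cc_inf f \<Longrightarrow> Cc_inf g \<Longrightarrow> Qa g f = cnj (Qa f g)"
  by (simp add: Q0_Cc Bochner_Integration.integral_cnj[symmetric] mult.commute[of "L _ g _"] del: Bochner_Integration.integral_cnj)

lemma Q0_diag:
  assumes "Cc_inf f"
  shows "cmod (Qa f f) = (\<Sum>i<2*k. \<integral>z. (cmod (L (E i) f z))\<^sup>2 \<partial>M)"
proof -
  have "Qa f f = (\<Sum>i<2*k. complex_of_real (\<integral>z. (cmod (L (E i) f z))\<^sup>2 \<partial>M))"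
    unfolding Q0_Cc[OF assms assms] integral_complex_of_real[symmetric] by (simp only: complex_norm_square)
  also have "\<dots> = complex_of_real (\<Sum>i<2*k. \<integral>z. (cmod (L (E i) f z))\<^sup>2 \<partial>M)" by simp
  finally have "cmod (Qa f f) = \<bar>\<Sum>i<2*k. \<integral>z. (cmod (L (E i) f z))\<^sup>2 \<partial>M\<bar>" by (simp only: norm_of_real)
  also have "\<dots> = (\<Sum>i<2*k. \<integral>z. (cmod (L (E i) f z))\<^sup>2 \<partial>M)" by (intro abs_of_nonneg sum_nonneg integral_nonneg_AE AE_I2) auto
  finally show ?thesis .
qed

text \<open>The formal adjoint of \<open>L xi\<close> for the weighted measure: \<open>q\<close> is
  minus the conjugate of \<open>L xi (cnj p * rho)\<close>, divided by \<open>rho\<close>.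
  Positivity and continuity of the density keep the quotient bounded on a compact support, so the
  pairing of \<open>L xi h\<close> with \<open>p\<close> is controlled by the norm of
  \<open>h\<close>.\<close>

lemma integration_by_parts:
  assumes p: "Cc_inf p" and xi: "xi \<in> V 1"
  obtains q where "sqi M q" "\<And>h. smooth h \<Longrightarrow> (\<integral>z. L xi h z * cnj (p z) \<partial>M) = (\<integral>z. h z * cnj (q z) \<partial>M)"
proof -
  let ?r = "\<lambda>z. complex_of_real (rho a z)"
  have r0: "?r z \<noteq> 0" for z using rho_pos[OF a, of z] by simp
  have r: "smooth ?r" by (intro smooth_of_real smooth_rho a)
  define b where "b z = cnj (p z) * ?r z" for z
  have b: "Cc_inf b" unfolding b_def by (intro Cc_inf_mult_right Cc_inf_cnj p r)
  define q where "q z = - cnj (L xi b z)" for z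
  have q: "Cc_inf q" unfolding q_def using Cc_inf_mult_left[OF Cc_inf_cnj[OF Cc_inf_L[OF b, of xi]] smooth_const[of "-1"]] by simp
  have mr: "(\<lambda>z. q z / ?r z) \<in> borel_measurable borel"
    by (intro borel_measurable_divide Cc_inf_borel_measurable q smooth_borel_measurable r)
  obtain K where K: "compact K" "\<And>z. z \<notin> K \<Longrightarrow> q z = 0" by (rule Cc_inf_support[OF q]) blast
  have "continuous_on UNIV (\<lambda>z. q z / ?r z)"
    using r0 by (intro continuous_on_divide smooth_continuous_on Cc_inf_smooth[OF q] r) auto
  then obtain B where "B > 0" and B: "\<And>z. cmod (q z / ?r z) \<le> B"
    by (rule continuous_compact_support_bounded[OF _ K(1)]) (use K(2) in auto)
  show thesis
  proof (rule that)
    show "sqi M (\<lambda>z. q z / ?r z)"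
      by (rule sqi_bounded[OF _ B]) (use mr in \<open>simp add: measurable_cong_sets[OF sets_mu refl]\<close>)
    fix h :: "complex^'n \<Rightarrow> complex" assume h: "smooth h"
    have hb: "Cc_inf (\<lambda>z. h z * b z)" by (intro Cc_inf_mult_left b h)
    have c1: "Cc_inf (\<lambda>z. h z * L xi b z)" "Cc_inf (\<lambda>z. L xi h z * b z)"
      by (intro Cc_inf_mult_left Cc_inf_L b h smooth_L)+
    have "0 = integral\<^sup>L lborel (\<lambda>z. h z * L xi b z + L xi h z * b z)"
      using integral_L_zero[OF hb xi] by (simp add: L_mult[OF h Cc_inf_smooth[OF b], abs_def])
    also have "\<dots> = integral\<^sup>L lborel (\<lambda>z. h z * L xi b z) + integral\<^sup>L lborel (\<lambda>z. L xi h z * b z)"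
      by (intro Bochner_Integration.integral_add Cc_inf_integrable_lborel c1)
    finally have 1: "integral\<^sup>L lborel (\<lambda>z. L xi h z * b z) = integral\<^sup>L lborel (\<lambda>z. h z * cnj (q z))"
      by (simp add: q_def add_eq_0_iff)
    have "(\<integral>z. h z * cnj (q z / ?r z) \<partial>M) = integral\<^sup>L lborel (\<lambda>z. h z * cnj (q z / ?r z) * ?r z)"
      using mr smooth_borel_measurable[OF h] by (intro integral_mu a borel_measurable_times borel_measurable_cnj)
    also have "\<dots> = integral\<^sup>L lborel (\<lambda>z. h z * cnj (q z))" using r0 by simp
    finally have 2: "(\<integral>z. h z * cnj (q z / ?r z) \<partial>M) = integral\<^sup>L lborel (\<lambda>z. h z * cnj (q z))" .
    have "(\<integral>z. L xi h z * cnj (p z) \<partial>M) = integral\<^sup>L lborel (\<lambda>z. L xi h z * b z)"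
      using smooth_borel_measurable[OF smooth_L[OF h, of xi]] Cc_inf_borel_measurable[OF p]
      by (subst integral_mu[OF a]) (auto simp: b_def mult.assoc)
    then show "(\<integral>z. L xi h z * cnj (p z) \<partial>M) = (\<integral>z. h z * cnj (q z / ?r z) \<partial>M)" using 1 2 by simp
  qed
qed

lemma Qapprox_tendsto:
  assumes "Qapprox mul x k (rho a) f fs" "f \<in> borel_measurable borel"
  shows "(\<lambda>n. \<integral>z. (cmod (fs n z - f z))\<^sup>2 \<partial>M) \<longlonglongrightarrow> 0"
proof -
  have m: "(\<lambda>z. fs n z - f z) \<in> borel_measurable borel" for n
    using assms by (intro borel_measurable_diff) (auto simp: Qapprox_def intro!: Cc_inf_borel_measurable)
  have "(\<lambda>n. (normL2 (rho a) (\<lambda>z. fs n z - f z))\<^sup>2) \<longlonglongrightarrow> 0\<^sup>2"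
    using assms(1) unfolding Qapprox_def by (intro tendsto_power) auto
  then show ?thesis by (simp add: normL2_eq[OF m])
qed

text \<open>Closability: the test function \<open>(L fs\<^sub>n - L f) \<chi>\<close> is admissible because \<open>f\<close> is smooth,
  which avoids completeness of the weighted L2 space.\<close>

lemma Qapprox_gradient:
  assumes Q: "Qapprox mul x k (rho a) f fs" and f: "smooth f" "sqi M f" and i: "i < 2 * k"
  shows "sqi M (L (E i) f)" "(\<lambda>n. \<integral>z. (cmod (L (E i) (fs n) z - L (E i) f z))\<^sup>2 \<partial>M) \<longlonglongrightarrow> 0"
proof -
  have xi: "E i \<in> V 1" by (rule E_in_V1[OF i])
  have fs: "Cc_inf (fs n)" for n using Q by (simp add: Qapprox_def)
  let ?L = "L (E i)"
  let ?D = "\<lambda>n z. ?L (fs n) z - ?L f z"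
  have sD: "smooth (?D n)" for n by (intro smooth_diff smooth_L Cc_inf_smooth fs f)
  have key: "\<exists>N. \<forall>n\<ge>N. integrable M (\<lambda>z. (cmod (?D n z))\<^sup>2) \<and> (\<integral>z. (cmod (?D n z))\<^sup>2 \<partial>M) \<le> e" if e: "e > 0" for e
  proof -
    obtain N where N: "\<And>n p. n \<ge> N \<Longrightarrow> p \<ge> N \<Longrightarrow> cmod (Qa (\<lambda>z. fs n z - fs p z) (\<lambda>z. fs n z - fs p z)) < e"
      using Q e unfolding Qapprox_def by blast
    have np: "(\<integral>z. (cmod (?L (fs n) z - ?L (fs p) z))\<^sup>2 \<partial>M) \<le> e" if "n \<ge> N" "p \<ge> N" for n p
    proof -
      have "(\<integral>z. (cmod (?L (\<lambda>z. fs n z - fs p z) z))\<^sup>2 \<partial>M) \<le> (\<Sum>i<2*k. \<integral>z. (cmod (L (E i) (\<lambda>z. fs n z - fs p z) z))\<^sup>2 \<partial>M)"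
        using i by (intro member_le_sum[of i "{..<2*k}" "\<lambda>i. \<integral>z. (cmod (L (E i) (\<lambda>z. fs n z - fs p z) z))\<^sup>2 \<partial>M"]) auto
      also have "\<dots> < e" using N[OF that] by (simp only: Q0_diag[OF Cc_inf_diff[OF fs fs]])
      finally show ?thesis by (simp add: L_diff Cc_inf_smooth fs)
    qed
    have "integrable M (\<lambda>z. (cmod (?D n z))\<^sup>2) \<and> (\<integral>z. (cmod (?D n z))\<^sup>2 \<partial>M) \<le> e" if n: "n \<ge> N" for n
    proof -
      have int: "integrable M (\<lambda>z. (cmod (?D n z))\<^sup>2 * Re (chi R z))" and le: "(\<integral>z. (cmod (?D n z))\<^sup>2 * Re (chi R z) \<partial>M) \<le> e" for R
      proof -
        \<comment> \<open>Pairing \<open>?D n\<close> with \<open>p\<close> gives the cut-off energy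
          \<open>I\<close>, whose integrand dominates \<open>|p|^2\<close> because the cut-off lies
          between 0 and 1.\<close>
        define p where "p z = ?D n z * chi R z" for z
        have p: "Cc_inf p" unfolding p_def by (intro Cc_inf_mult_left Cc_inf_chi sD)
        have Dp: "?D n z * cnj (p z) = complex_of_real ((cmod (?D n z))\<^sup>2 * Re (chi R z))" for z
        proof -
          have "chi R z = complex_of_real (Re (chi R z))" using chi_range(3)[of R z] by (simp add: complex_eq_iff)
          then show ?thesis unfolding p_def using chi_range(5)[of R z]
            by (simp add: complex_norm_square mult_ac del: of_real_power)
        qed
        have "Cc_inf (\<lambda>z. ?D n z * cnj (p z))" by (intro Cc_inf_mult_left sD Cc_inf_cnj p)
        from Cc_inf_integrable_mu[OF a this] have intc: "integrable M (\<lambda>z. complex_of_real ((cmod (?D n z))\<^sup>2 * Re (chi R z)))"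
          by (simp only: Dp)
        then show int: "integrable M (\<lambda>z. (cmod (?D n z))\<^sup>2 * Re (chi R z))" by (simp only: complex_of_real_integrable_eq)
        define I where "I = (\<integral>z. (cmod (?D n z))\<^sup>2 * Re (chi R z) \<partial>M)"
        have I: "(\<integral>z. ?D n z * cnj (p z) \<partial>M) = complex_of_real I"
          unfolding Dp I_def by (rule integral_complex_of_real)
        have I0: "I \<ge> 0" unfolding I_def using chi_range(1) by (intro integral_nonneg_AE AE_I2) auto
        have pI: "(\<integral>z. (cmod (p z))\<^sup>2 \<partial>M) \<le> I"
          unfolding I_def
        proof (rule integral_mono)
          show "integrable M (\<lambda>z. (cmod (p z))\<^sup>2)" using Cc_inf_sqi[OF p] by (simp add: sqi_def)
          show "(cmod (p z))\<^sup>2 \<le> (cmod (?D n z))\<^sup>2 * Re (chi R z)" for z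
          proof -
            have "cmod (chi R z) = Re (chi R z)" using chi_range(1,3)[of R z] by (simp add: cmod_def)
            then show ?thesis unfolding p_def
              using chi_range(1,2)[of R z] by (simp add: norm_mult power_mult_distrib power2_eq_square[of "Re _"] mult_left_le mult_left_mono)
          qed
        qed (rule int)
        obtain q where q: "sqi M q" "\<And>h. smooth h \<Longrightarrow> (\<integral>z. ?L h z * cnj (p z) \<partial>M) = (\<integral>z. h z * cnj (q z) \<partial>M)"
          by (rule integration_by_parts[OF p xi]) blast
        have Dq: "(\<integral>z. ?D j z * cnj (p z) \<partial>M) = (\<integral>z. (fs j z - f z) * cnj (q z) \<partial>M)" for j
          using q(2)[OF smooth_diff[OF Cc_inf_smooth[OF fs[of j]] f(1)]] by (simp add: L_diff Cc_inf_smooth fs f)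
        have "(\<lambda>j. \<integral>z. (fs j z - f z) * cnj (q z) \<partial>M) \<longlonglongrightarrow> 0"
          using f q(1) Cc_inf_sqi[OF fs] Qapprox_tendsto[OF Q smooth_borel_measurable[OF f(1)]]
          by (intro sqi_inner_tendsto_zero[where b = "\<integral>z. (cmod (q z))\<^sup>2 \<partial>M"]) (auto intro: sqi_diff)
        then have lim: "(\<lambda>j. (e + I) / 2 + cmod (\<integral>z. ?D j z * cnj (p z) \<partial>M)) \<longlonglongrightarrow> (e + I) / 2 + cmod 0"
          unfolding Dq by (intro tendsto_intros)
        \<comment> \<open>Split \<open>?D n\<close> into a Cauchy difference and
          \<open>?D j\<close>. The first pairing is at most \<open>sqrt e * sqrt I\<close>, the
          second tends to 0 as \<open>j\<close> grows. The arithmetic-geometric mean inequality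
          leaves \<open>I \<le> (e + I) / 2\<close>, so \<open>I \<le> e\<close> independently of
          \<open>R\<close>.\<close>
        have "I \<le> (e + I) / 2 + cmod (\<integral>z. ?D j z * cnj (p z) \<partial>M)" if j: "j \<ge> N" for j
        proof -
          have s1: "sqi M (\<lambda>z. ?L (fs n) z - ?L (fs j) z)" by (intro sqi_diff Cc_inf_sqi Cc_inf_L fs)
          have Cj: "Cc_inf (\<lambda>z. ?D j z * cnj (p z))" by (intro Cc_inf_mult_left sD Cc_inf_cnj p)
          have "complex_of_real I = (\<integral>z. (?L (fs n) z - ?L (fs j) z) * cnj (p z) + ?D j z * cnj (p z) \<partial>M)"
            unfolding I[symmetric] by (rule Bochner_Integration.integral_cong) (auto simp: algebra_simps)
          also have "\<dots> = (\<integral>z. (?L (fs n) z - ?L (fs j) z) * cnj (p z) \<partial>M) + (\<integral>z. ?D j z * cnj (p z) \<partial>M)"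
            by (intro Bochner_Integration.integral_add sqi_integrable_mult s1 Cc_inf_sqi p Cc_inf_integrable_mu[OF a Cj])
          finally have "I \<le> cmod ((\<integral>z. (?L (fs n) z - ?L (fs j) z) * cnj (p z) \<partial>M) + (\<integral>z. ?D j z * cnj (p z) \<partial>M))"
            using I0 by (metis abs_of_nonneg norm_of_real order_refl)
          also have "\<dots> \<le> cmod (\<integral>z. (?L (fs n) z - ?L (fs j) z) * cnj (p z) \<partial>M) + cmod (\<integral>z. ?D j z * cnj (p z) \<partial>M)"
            by (rule norm_triangle_ineq)
          also have "cmod (\<integral>z. (?L (fs n) z - ?L (fs j) z) * cnj (p z) \<partial>M) \<le> sqrt e * sqrt I"
            by (rule order_trans[OF Cauchy_Schwarz_norm[OF s1 Cc_inf_sqi[OF p]]])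
              (intro mult_mono real_sqrt_le_mono np[OF n j] pI, auto simp: I0 less_imp_le[OF e])
          also have "sqrt e * sqrt I \<le> (e + I) / 2"
            using arith_geo_mean_sqrt[of e I] e I0 by (simp add: real_sqrt_mult)
          finally show ?thesis by simp
        qed
        then have "I \<le> (e + I) / 2 + cmod 0"
          by (intro LIMSEQ_le_const[OF lim]) blast
        then show "(\<integral>z. (cmod (?D n z))\<^sup>2 * Re (chi R z) \<partial>M) \<le> e" by (simp add: I_def)
      qed
      show ?thesis
        using integrable_of_cutoffs[of "\<lambda>z. (cmod (?D n z))\<^sup>2" M "\<lambda>R z. Re (chi R z)" e] int le
          chi_range(1) tendsto_Re[OF chi_tendsto] smooth_measurable_M[OF sD[of n]] by auto
    qed
    then show ?thesis by blast
  qed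
  obtain N where "integrable M (\<lambda>z. (cmod (?D N z))\<^sup>2)" using key[of 1] by auto
  then have "sqi M (?D N)" using smooth_measurable_M[OF sD] by (simp add: sqi_def)
  from sqi_diff[OF Cc_inf_sqi[OF Cc_inf_L[OF fs[of N], of "E i"]] this] show "sqi M (?L f)" by simp
  show "(\<lambda>n. \<integral>z. (cmod (?D n z))\<^sup>2 \<partial>M) \<longlonglongrightarrow> 0"
  proof (rule LIMSEQ_I)
    fix e :: real assume "e > 0"
    then obtain N where N: "\<And>n. n \<ge> N \<Longrightarrow> (\<integral>z. (cmod (?D n z))\<^sup>2 \<partial>M) \<le> e / 2" using key[of "e/2"] by auto
    have "norm ((\<integral>z. (cmod (?D n z))\<^sup>2 \<partial>M) - 0) < e" if "n \<ge> N" for n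
      using N[OF that] \<open>e > 0\<close> by simp
    then show "\<exists>N. \<forall>n\<ge>N. norm ((\<integral>z. (cmod (?D n z))\<^sup>2 \<partial>M) - 0) < e" by blast
  qed
qed

end

subsection \<open>The operator on holomorphic functions with square-integrable \<open>Z f\<close>\<close>

lemma holoI:
  assumes "\<And>z. (f has_derivative D z) (at z)" "\<And>z c h. D z (c *s h) = c * D z h"
  shows "holo f"
  unfolding holo_def using assms by blast

lemma holo_mult:
  assumes f: "holo f" and g: "holo g" shows "holo (\<lambda>z. f z * g z)"
  by (rule holoI[OF has_derivative_mult[OF holoD(1)[OF f] holoD(1)[OF g]]])
    (simp add: holoD(2)[OF f] holoD(2)[OF g] algebra_simps)

lemma holo_add:
  assumes f: "holo f" and g: "holo g" shows "holo (\<lambda>z. f z + g z)"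
  by (rule holoI[OF has_derivative_add[OF holoD(1)[OF f] holoD(1)[OF g]]])
    (simp add: holoD(2)[OF f] holoD(2)[OF g] algebra_simps)

lemma holo_const: "holo (\<lambda>z. c)"
  unfolding holo_def by (auto intro!: exI[of _ "\<lambda>h. 0"])

lemma holo_sum: "finite I \<Longrightarrow> (\<And>i. i \<in> I \<Longrightarrow> holo (f i)) \<Longrightarrow> holo (\<lambda>z. \<Sum>i\<in>I. f i z)"
  by (induction I rule: finite_induct) (auto intro: holo_add holo_const)

lemma const_over_Suc_tendsto: "(\<lambda>n. c / (real n + 1)) \<longlonglongrightarrow> 0"
  using tendsto_mult[OF tendsto_const[of c] LIMSEQ_inverse_real_of_nat] by (simp add: inverse_eq_divide add.commute)

context stratified_algebra begin

lemma Eul_dil: "Eul (dl l z) = dl l (Eul z)"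
proof -
  have "dl l (Eul z) = (\<Sum>j=1..m. dl l (of_nat j *s lay z j))"
    unfolding Eul_def by (rule linear_sum[OF bounded_linear.linear[OF dil_bounded_linear]])
  also have "\<dots> = (\<Sum>j=1..m. of_nat j *s (l ^ j *s lay z j))"
    by (intro sum.cong refl) (simp add: dil_vec_scale dil_of_layer[OF layer_in])
  also have "\<dots> = Eul (dl l z)" unfolding Eul_def by (intro sum.cong refl) (simp add: layer_dil)
  finally show ?thesis by simp
qed

lemma Zop_dil:
  assumes "smooth f"
  shows "Zop V m (\<lambda>z. f (dl l z)) z = Zop V m f (dl l z)"
proof -
  have "((\<lambda>z. f (dl l z)) has_derivative (\<lambda>h. frechet_derivative f (at (dl l z)) (dl l h))) (at z)"
    by (rule has_derivative_compose[OF bounded_linear_imp_has_derivative[OF dil_bounded_linear] smooth_has_derivative[OF assms]])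
  then have "frechet_derivative (\<lambda>z. f (dl l z)) (at z) = (\<lambda>h. frechet_derivative f (at (dl l z)) (dl l h))"
    by (rule frechet_derivative_at[symmetric])
  moreover have "smooth (\<lambda>z. f (dl l z))"
    by (rule smooth_compose[of f "dl l"]) (auto intro: assms smooth_bounded_linear_ident dil_bounded_linear)
  ultimately show ?thesis by (simp add: Zop_eq assms Eul_dil dil_vec_scale)
qed

lemma Zop_0: "smooth f \<Longrightarrow> Zop V m f 0 = 0"
proof -
  assume f: "smooth f"
  have "Eul 0 = 0" using linear_0[OF bounded_linear.linear[OF bounded_linear_Eul]] .
  then show ?thesis using linear_0[OF linear_frechet_derivative[OF smooth_imp_differentiable[OF f]]] by (simp add: Zop_eq f)
qed

text \<open>\<open>Z f\<close> is the sum of the coordinates of \<open>Eul z\<close>, which are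
  complex linear, times the complex partial derivatives of \<open>f\<close>.\<close>

lemma holo_Zop:
  assumes f: "holo f" shows "holo (Zop V m f)"
proof -
  have lin: "linear (frechet_derivative f (at z))" for z using has_derivative_linear[OF holoD(1)[OF f]] .
  have eq: "Zop V m f z = (\<Sum>i\<in>UNIV. (Eul z $ i) * frechet_derivative f (at z) (axis i 1))" for z
  proof -
    have "Eul z = (\<Sum>i\<in>UNIV. (Eul z $ i) *s axis i 1)" by (simp add: basis_expansion)
    then have "frechet_derivative f (at z) (Eul z) = (\<Sum>i\<in>UNIV. frechet_derivative f (at z) ((Eul z $ i) *s axis i 1))"
      by (metis (no_types, lifting) linear_sum[OF lin] sum.cong)
    then show ?thesis by (simp add: Zop_holo[OF f] holoD(2)[OF f])
  qed
  have hE: "holo (\<lambda>z. Eul z $ i)" for i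
    unfolding holo_def
    by (intro allI exI[of _ "\<lambda>h. Eul h $ i"])
      (auto intro!: bounded_linear_imp_has_derivative bounded_linear_compose[OF bounded_linear_vec_nth bounded_linear_Eul] simp: Eul_vec_scale)
  show ?thesis
    unfolding eq[abs_def] by (intro holo_sum holo_mult holo_frechet_derivative[OF f] hE) auto
qed

end

section \<open>Product rules and squared cut-offs\<close>

context heat_group begin

lemma Lap_mult:
  assumes "smooth f" "smooth g"
  shows "Lap (\<lambda>z. f z * g z) z = f z * Lap g z + g z * Lap f z + 2 * (\<Sum>i<2*k. L (E i) f z * L (E i) g z)"
proof -
  have "L v (L v (\<lambda>z. f z * g z)) z = f z * L v (L v g) z + g z * L v (L v f) z + 2 * (L v f z * L v g z)" for v
  proof -
    have 1: "L v (\<lambda>z. f z * g z) = (\<lambda>z. f z * L v g z + L v f z * g z)"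
      using L_mult[OF assms] by blast
    show ?thesis
      unfolding 1 using assms
      by (subst L_add) (auto intro!: smooth_mult smooth_L simp: L_mult smooth_L algebra_simps)
  qed
  then show ?thesis by (simp add: subLap_eq sum.distrib sum_distrib_left)
qed

lemma Lap_cnj:
  assumes "smooth f" shows "Lap (\<lambda>z. cnj (f z)) z = cnj (Lap f z)"
proof -
  have "L v (\<lambda>z. cnj (f z)) = (\<lambda>z. cnj (L v f z))" for v using L_cnj[OF assms] by blast
  then show ?thesis using assms by (simp add: subLap_eq L_cnj smooth_L)
qed

text \<open>The vanishing bracket of \<open>i x\<close> and \<open>x\<close> lets the two derivatives commute, so no holomorphy of
  \<open>L x f\<close> is needed.\<close>

lemma Lap_holo:
  assumes f: "holo f" shows "Lap f z = 0"
proof -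
  have sf: "smooth f" by (rule holo_imp_smooth[OF f])
  have "L v (L v f) z + L (\<i> *s v) (L (\<i> *s v) f) z = 0" for v
  proof -
    have i: "L (\<i> *s v) f = (\<lambda>z. \<i> * L v f z)" using L_i_holo[OF f] by blast
    have "br (\<i> *s v) v = 0" by (simp add: br_scale1 br_self)
    then have "L (\<i> *s v) (L v f) z - L v (L (\<i> *s v) f) z = L 0 f z"
      using fun_cong[OF L_bracket[OF sf, of "\<i> *s v" v], of z] by simp
    moreover have "L 0 f z = 0" using L_vec_scaleR[OF sf, of 0 0 z] by simp
    ultimately have "L (\<i> *s v) (L v f) z = L v (L (\<i> *s v) f) z" by simp
    also have "\<dots> = \<i> * L v (L v f) z" unfolding i by (rule L_cmult[OF smooth_L[OF sf]])
    finally have c: "L (\<i> *s v) (L v f) z = \<i> * L v (L v f) z" .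
    have "L (\<i> *s v) (L (\<i> *s v) f) z = \<i> * L (\<i> *s v) (L v f) z"
      unfolding i by (rule L_cmult[OF smooth_L[OF sf]])
    then show ?thesis unfolding c by simp
  qed
  then show ?thesis by (simp add: subLap_def)
qed

text \<open>Squaring bounds the first derivatives of the cut-off by a multiple of
  \<open>chi n\<close> itself, so that cross terms in the energy estimate can be absorbed into the
  energy weighted by \<open>chi2 n\<close>.\<close>

definition chi2 :: "nat \<Rightarrow> complex^'n \<Rightarrow> complex" where
  "chi2 n z = chi n z * chi n z"

lemma Cc_inf_chi2: "Cc_inf (chi2 n)"
  unfolding chi2_def[abs_def] by (intro Cc_inf_mult_left Cc_inf_chi Cc_inf_smooth)

lemma chi2_range: "chi2 n z = of_real (Re (chi2 n z))" "0 \<le> Re (chi2 n z)" "Re (chi2 n z) \<le> 1" "cmod (chi2 n z) \<le> 1"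
    "Re (chi2 n z) = (cmod (chi n z))\<^sup>2" "cnj (chi2 n z) = chi2 n z"
proof -
  have c: "chi n z = of_real (Re (chi n z))" using chi_range(3)[of n z] by (simp add: complex_eq_iff)
  have c2: "chi2 n z = of_real ((Re (chi n z))\<^sup>2)" unfolding chi2_def by (subst c, subst c) (simp add: power2_eq_square)
  have le: "(Re (chi n z))\<^sup>2 \<le> 1" using chi_range(1,2)[of n z] by (simp add: power_le_one)
  have "cmod (chi n z) = Re (chi n z)" using chi_range(1,3)[of n z] by (simp add: cmod_def)
  then show "chi2 n z = of_real (Re (chi2 n z))" "0 \<le> Re (chi2 n z)" "Re (chi2 n z) \<le> 1" "cmod (chi2 n z) \<le> 1"
    "Re (chi2 n z) = (cmod (chi n z))\<^sup>2" "cnj (chi2 n z) = chi2 n z"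
    using le by (simp_all add: c2 norm_power del: of_real_power)
qed

lemma chi2_tendsto: "(\<lambda>n. chi2 n z) \<longlonglongrightarrow> 1"
  using tendsto_mult[OF chi_tendsto[of z] chi_tendsto[of z]] by (simp add: chi2_def)

text \<open>Horizontal derivatives and \<open>Lap\<close> decay uniformly. \<open>Z\<close> is
  homogeneous of degree 0, so for \<open>Z (chi2 n)\<close> there is a uniform bound and pointwise
  decay only; the latter holds because \<open>Eul\<close>, and with it \<open>Z\<close> of the bump,
  vanishes at the origin.\<close>

lemma chi2_bounds:
  obtains C where "C > 0"
    "\<And>i n z. i < 2 * k \<Longrightarrow> cmod (L (E i) (chi n) z) \<le> C / (real n + 1)"
    "\<And>i n z. i < 2 * k \<Longrightarrow> cmod (L (E i) (chi2 n) z) \<le> C * cmod (chi n z) / (real n + 1)"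
    "\<And>n z. cmod (Lap (chi2 n) z) \<le> C / (real n + 1)"
    "\<And>n z. cmod (Zop V m (chi2 n) z) \<le> C" "\<And>z. (\<lambda>n. Zop V m (chi2 n) z) \<longlonglongrightarrow> 0"
proof -
  obtain C where C: "C > 0" "\<And>i n z. i \<in> {..<2*k} \<Longrightarrow> cmod (L (E i) (chi n) z) \<le> C / (real n + 1)"
    "\<And>i n z. i \<in> {..<2*k} \<Longrightarrow> cmod (L (E i) (L (E i) (chi n)) z) \<le> C / (real n + 1)"
    by (rule chi_bounds[of "{..<2*k}" E]) (use E_in_V1 in auto)
  let ?b = "\<lambda>z::complex^'n. complex_of_real (bump z)"
  obtain B where B: "B > 0" "\<And>z. cmod (Zop V m ?b z) \<le> B" by (rule Cc_inf_bounded[OF Cc_inf_Zop[OF Cc_inf_bump]]) blast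
  have sb: "smooth ?b" by (rule Cc_inf_smooth[OF Cc_inf_bump])
  have sc: "smooth (chi n)" for n by (intro Cc_inf_smooth Cc_inf_chi)
  have Zchi: "Zop V m (chi n) z = Zop V m ?b (dl (complex_of_real (1 / (real n + 1))) z)" for n z
    unfolding chi_def[abs_def] by (rule Zop_dil[OF sb])
  have Zchi2: "Zop V m (chi2 n) z = 2 * (chi n z * Zop V m (chi n) z)" for n z
    unfolding chi2_def[abs_def] using Zop_mult[OF sc sc, of n n z] by simp
  have L2: "L v (chi2 n) z = 2 * (chi n z * L v (chi n) z)" for v n z
    unfolding chi2_def[abs_def] using L_mult[OF sc sc, of v n n z] by simp
  let ?K = "real (2 * k)"
  define C' where "C' = 2 * C + 2 * B + ?K * (2 * C + 2 * C\<^sup>2)"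
  have C': "C' > 0" "2 * C \<le> C'" "2 * B \<le> C'" "?K * (2 * C + 2 * C\<^sup>2) \<le> C'" "C \<le> C'"
    using C(1) B(1) by (auto simp: C'_def add_pos_nonneg)
  show thesis
  proof (rule that[OF C'(1)])
    show "cmod (L (E i) (chi n) z) \<le> C' / (real n + 1)" if "i < 2 * k" for i n z
      using C(2)[of i n z] that divide_right_mono[OF C'(5), of "real n + 1"] by simp
    show "cmod (L (E i) (chi2 n) z) \<le> C' * cmod (chi n z) / (real n + 1)" if "i < 2 * k" for i n z
    proof -
      have "cmod (L (E i) (chi2 n) z) = 2 * (cmod (chi n z) * cmod (L (E i) (chi n) z))"
        unfolding L2 by (simp add: norm_mult)
      also have "\<dots> \<le> 2 * (cmod (chi n z) * (C / (real n + 1)))"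
        using that by (intro mult_left_mono C(2)) auto
      also have "\<dots> = (2 * C) * cmod (chi n z) / (real n + 1)" by simp
      also have "\<dots> \<le> C' * cmod (chi n z) / (real n + 1)"
        by (intro divide_right_mono mult_right_mono C') auto
      finally show ?thesis .
    qed
    show "cmod (Lap (chi2 n) z) \<le> C' / (real n + 1)" for n z
    proof -
      have one: "cmod (L (E i) (chi n) z * L (E i) (chi n) z) \<le> C\<^sup>2 / (real n + 1)" if "i < 2 * k" for i
      proof -
        have "cmod (L (E i) (chi n) z * L (E i) (chi n) z) \<le> (C / (real n + 1)) * (C / (real n + 1))"
          unfolding norm_mult using C(1,2) that by (intro mult_mono) (auto simp: less_imp_le)
        also have "\<dots> \<le> (C / (real n + 1)) * C" using C(1) by (intro mult_left_mono) (auto simp: divide_simps)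
        finally show ?thesis by (simp add: power2_eq_square)
      qed
      have two: "cmod (chi n z * L (E i) (L (E i) (chi n)) z) \<le> C / (real n + 1)" if "i < 2 * k" for i
      proof -
        have "cmod (chi n z * L (E i) (L (E i) (chi n)) z) \<le> 1 * (C / (real n + 1))"
          unfolding norm_mult using C(3)[of i n z] that by (intro mult_mono chi_range) auto
        then show ?thesis by simp
      qed
      have eq: "Lap (chi2 n) z = (\<Sum>i<2*k. 2 * (chi n z * L (E i) (L (E i) (chi n)) z) + 2 * (L (E i) (chi n) z * L (E i) (chi n) z))"
        unfolding chi2_def[abs_def] Lap_mult[OF sc sc] subLap_eq by (simp add: sum.distrib sum_distrib_left)
      have "cmod (Lap (chi2 n) z) \<le> (\<Sum>i<2*k. 2 * (C / (real n + 1)) + 2 * (C\<^sup>2 / (real n + 1)))"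
        unfolding eq
      proof (rule sum_norm_le)
        fix i assume i: "i \<in> {..<2*k}"
        have "cmod (2 * (chi n z * L (E i) (L (E i) (chi n)) z) + 2 * (L (E i) (chi n) z * L (E i) (chi n) z)) \<le>
          cmod (2 * (chi n z * L (E i) (L (E i) (chi n)) z)) + cmod (2 * (L (E i) (chi n) z * L (E i) (chi n) z))"
          by (rule norm_triangle_ineq)
        also have "\<dots> = 2 * cmod (chi n z * L (E i) (L (E i) (chi n)) z) + 2 * cmod (L (E i) (chi n) z * L (E i) (chi n) z)"
          by (simp only: norm_mult norm_numeral)
        also have "\<dots> \<le> 2 * (C / (real n + 1)) + 2 * (C\<^sup>2 / (real n + 1))"
          using one[of i] two[of i] i by (intro add_mono mult_left_mono) auto
        finally show "cmod (2 * (chi n z * L (E i) (L (E i) (chi n)) z) + 2 * (L (E i) (chi n) z * L (E i) (chi n) z)) \<le> \<dots>" .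
      qed
      also have "\<dots> = ?K * (2 * C + 2 * C\<^sup>2) / (real n + 1)"
        by (simp only: sum_constant card_lessThan times_divide_eq_right add_divide_distrib[symmetric])
      also have "\<dots> \<le> C' / (real n + 1)" by (intro divide_right_mono C') auto
      finally show ?thesis .
    qed
    show "cmod (Zop V m (chi2 n) z) \<le> C'" for n z
    proof -
      have "cmod (Zop V m (chi2 n) z) = 2 * (cmod (chi n z) * cmod (Zop V m (chi n) z))"
        unfolding Zchi2 by (simp add: norm_mult)
      also have "\<dots> \<le> 2 * (1 * B)" unfolding Zchi by (intro mult_left_mono mult_mono B chi_range) (auto simp: less_imp_le[OF B(1)])
      finally show ?thesis using C'(3) by simp
    qed
    show "(\<lambda>n. Zop V m (chi2 n) z) \<longlonglongrightarrow> 0" for z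
    proof -
      have "isCont (Zop V m ?b) 0"
        using smooth_continuous_on[OF smooth_Zop[OF sb], of UNIV] continuous_on_eq_continuous_at open_UNIV by blast
      from isCont_tendsto_compose[OF this tendsto_dil_shrink[of z]]
      have "(\<lambda>n. Zop V m (chi n) z) \<longlonglongrightarrow> 0" by (simp only: Zchi Zop_0[OF sb])
      from tendsto_mult[OF tendsto_const[of 2] tendsto_mult[OF chi_tendsto[of z] this]] show ?thesis by (simp add: Zchi2)
    qed
  qed
qed

end

section \<open>Energy estimate and the form identity\<close>

context heat_form begin

lemma Lap_product:
  assumes f: "holo f" and v: "holo v"
  shows "Lap (\<lambda>z. (f z * cnj (v z)) * chi2 n z) z = (f z * cnj (v z)) * Lap (chi2 n) z
    + chi2 n z * (2 * (\<Sum>i<2*k. L (E i) f z * cnj (L (E i) v z)))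
    + 2 * (\<Sum>i<2*k. (f z * cnj (L (E i) v z) + L (E i) f z * cnj (v z)) * L (E i) (chi2 n) z)"
    and "Z (\<lambda>z. (f z * cnj (v z)) * chi2 n z) z = (f z * cnj (v z)) * Z (chi2 n) z + Z f z * cnj (v z) * chi2 n z"
proof -
  note sf = holo_imp_smooth[OF f] and sv = smooth_cnj[OF holo_imp_smooth[OF v]]
  have Lc: "L w (\<lambda>z. cnj (v z)) z = cnj (L w v z)" for w z by (rule L_cnj[OF holo_imp_smooth[OF v]])
  have sc: "smooth (chi2 n)" by (rule Cc_inf_smooth[OF Cc_inf_chi2])
  have "Lap (\<lambda>z. f z * cnj (v z)) z = 2 * (\<Sum>i<2*k. L (E i) f z * cnj (L (E i) v z))"
    using Lap_mult[OF sf sv, of z] by (simp add: Lap_holo f v Lap_cnj[OF holo_imp_smooth[OF v]] Lc)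
  then show "Lap (\<lambda>z. (f z * cnj (v z)) * chi2 n z) z = (f z * cnj (v z)) * Lap (chi2 n) z
    + chi2 n z * (2 * (\<Sum>i<2*k. L (E i) f z * cnj (L (E i) v z)))
    + 2 * (\<Sum>i<2*k. (f z * cnj (L (E i) v z) + L (E i) f z * cnj (v z)) * L (E i) (chi2 n) z)"
    using Lap_mult[OF smooth_mult[OF sf sv] sc, of z] by (simp add: L_mult[OF sf sv] Lc)
  show "Z (\<lambda>z. (f z * cnj (v z)) * chi2 n z) z = (f z * cnj (v z)) * Z (chi2 n) z + Z f z * cnj (v z) * chi2 n z"
    using Zop_mult[OF smooth_mult[OF sf sv] sc, of z] Zop_mult[OF sf sv, of z] Zop_cnj_holo[OF v, of z] by simp
qed

lemma Cc_inf_product: "holo f \<Longrightarrow> holo v \<Longrightarrow> Cc_inf (\<lambda>z. (f z * cnj (v z)) * chi2 n z)"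
  by (intro Cc_inf_mult_left Cc_inf_chi2 smooth_mult smooth_cnj holo_imp_smooth)

text \<open>Caccioppoli argument: the product formula contains the weighted energy twice, and by
  \<open>2 x y \<le> x^2 + y^2\<close> with \<open>x = |L f| chi\<close> and
  \<open>y = 2 C |f|\<close> the cross terms cost at most one copy. The constant collects
  \<open>4 C^2\<close> from each of the \<open>2 * k\<close> directions and \<open>C\<close> from
  \<open>Lap (chi2 n)\<close>.\<close>

lemma gradient_energy_pointwise:
  fixes C :: real
  assumes f: "holo f" and C: "C > 0"
    "\<And>i. i < 2 * k \<Longrightarrow> cmod (L (E i) (chi2 n) z) \<le> C * cmod (chi n z)" "cmod (Lap (chi2 n) z) \<le> C"
  shows "(\<Sum>i<2*k. (cmod (L (E i) f z))\<^sup>2) * Re (chi2 n z) \<le>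
    Re (Lap (\<lambda>z. (f z * cnj (f z)) * chi2 n z) z) + (C + real (2 * k) * (4 * C\<^sup>2)) * (cmod (f z))\<^sup>2"
proof -
  let ?g = "\<lambda>i. cmod (L (E i) f z)" and ?c = "cmod (chi n z)" and ?f = "cmod (f z)"
  let ?T = "\<lambda>i. (f z * cnj (L (E i) f z) + L (E i) f z * cnj (f z)) * L (E i) (chi2 n) z"
  let ?S = "\<Sum>i<2*k. (?g i)\<^sup>2"
  have 1: "- (C * ?f\<^sup>2) \<le> Re ((f z * cnj (f z)) * Lap (chi2 n) z)"
  proof -
    have "\<bar>Re ((f z * cnj (f z)) * Lap (chi2 n) z)\<bar> \<le> cmod ((f z * cnj (f z)) * Lap (chi2 n) z)" by (rule abs_Re_le_cmod)
    also have "\<dots> = ?f\<^sup>2 * cmod (Lap (chi2 n) z)" by (simp add: norm_mult power2_eq_square)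
    also have "\<dots> \<le> ?f\<^sup>2 * C" by (intro mult_left_mono C) auto
    finally show ?thesis by (simp add: mult.commute)
  qed
  have 2: "Re (chi2 n z * (2 * (\<Sum>i<2*k. L (E i) f z * cnj (L (E i) f z)))) = 2 * ?S * Re (chi2 n z)"
  proof -
    have "(\<Sum>i<2*k. L (E i) f z * cnj (L (E i) f z)) = complex_of_real ?S" by (simp add: complex_norm_square[symmetric])
    then show ?thesis by (subst chi2_range(1)) simp
  qed
  have 3: "- ((?g i)\<^sup>2 * ?c\<^sup>2 + 4 * C\<^sup>2 * ?f\<^sup>2) \<le> 2 * Re (?T i)" if i: "i < 2 * k" for i
  proof -
    have "\<bar>Re (?T i)\<bar> \<le> cmod (?T i)" by (rule abs_Re_le_cmod)
    also have "\<dots> \<le> (2 * (?f * ?g i)) * (C * ?c)"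
      unfolding norm_mult
    proof (rule mult_mono[OF _ C(2)[OF i]])
      show "cmod (f z * cnj (L (E i) f z) + L (E i) f z * cnj (f z)) \<le> 2 * (?f * ?g i)"
        by (rule order_trans[OF norm_triangle_ineq]) (simp add: norm_mult)
    qed auto
    also have "2 * \<dots> = 2 * (?g i * ?c) * (2 * C * ?f)" by simp
    also have "\<dots> \<le> (?g i * ?c)\<^sup>2 + (2 * C * ?f)\<^sup>2" by (rule sum_squares_bound)
    finally show ?thesis by (simp add: power_mult_distrib)
  qed
  have "(\<Sum>i<2*k. - ((?g i)\<^sup>2 * ?c\<^sup>2 + 4 * C\<^sup>2 * ?f\<^sup>2)) \<le> (\<Sum>i<2*k. 2 * Re (?T i))"
    by (intro sum_mono 3) auto
  then have 4: "- (?S * ?c\<^sup>2 + real (2 * k) * (4 * C\<^sup>2) * ?f\<^sup>2) \<le> Re (2 * (\<Sum>i<2*k. ?T i))"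
  proof -
    have "(\<Sum>i<2*k. - ((?g i)\<^sup>2 * ?c\<^sup>2 + 4 * C\<^sup>2 * ?f\<^sup>2)) = - (?S * ?c\<^sup>2 + real (2 * k) * (4 * C\<^sup>2) * ?f\<^sup>2)"
      by (simp only: sum_negf sum.distrib sum_distrib_right sum_constant card_lessThan mult.assoc)
    moreover have Re2: "Re (2 * w) = 2 * Re w" for w by simp
    have "(\<Sum>i<2*k. 2 * Re (?T i)) = Re (2 * (\<Sum>i<2*k. ?T i))"
      by (simp only: Re2 Re_sum sum_distrib_left)
    ultimately show ?thesis using \<open>(\<Sum>i<2*k. - ((?g i)\<^sup>2 * ?c\<^sup>2 + 4 * C\<^sup>2 * ?f\<^sup>2)) \<le> (\<Sum>i<2*k. 2 * Re (?T i))\<close> by simp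
  qed
  have "Re (Lap (\<lambda>z. (f z * cnj (f z)) * chi2 n z) z) = Re ((f z * cnj (f z)) * Lap (chi2 n) z) +
     Re (chi2 n z * (2 * (\<Sum>i<2*k. L (E i) f z * cnj (L (E i) f z)))) + Re (2 * (\<Sum>i<2*k. ?T i))"
    unfolding Lap_product(1)[OF f f] by (simp only: plus_complex.sel)
  then show ?thesis
    using 1 4 unfolding 2 chi2_range(5) by (simp add: algebra_simps)
qed

text \<open>After integration of the pointwise estimate the second-order term becomes
  \<open>4 / a\<close> times the integral of \<open>Z\<close> of the product, which is bounded
  through \<open>f\<close> and \<open>Z f\<close> uniformly in \<open>n\<close>; Fatou's lemma
  removes the cut-off.\<close>

lemma gradient_sqi:
  assumes f: "holo f" "sqi M f" and Zf: "sqi M (Z f)" and i: "i < 2 * k"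
  shows "sqi M (L (E i) f)"
proof -
  obtain C where C: "C > 0"
    "\<And>i n z. i < 2 * k \<Longrightarrow> cmod (L (E i) (chi n) z) \<le> C / (real n + 1)"
    "\<And>i n z. i < 2 * k \<Longrightarrow> cmod (L (E i) (chi2 n) z) \<le> C * cmod (chi n z) / (real n + 1)"
    "\<And>n z. cmod (Lap (chi2 n) z) \<le> C / (real n + 1)"
    "\<And>n z. cmod (Z (chi2 n) z) \<le> C" "\<And>z. (\<lambda>n. Z (chi2 n) z) \<longlonglongrightarrow> 0"
    by (rule chi2_bounds) blast
  have dec: "c / (real n + 1) \<le> c" if "c \<ge> 0" for c n
    using that by (simp add: divide_le_eq mult_left_mono[of 1 "real n + 1" c, simplified] algebra_simps)
  let ?G = "\<lambda>z. \<Sum>i<2*k. (cmod (L (E i) f z))\<^sup>2"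
  let ?p = "\<lambda>n z. (f z * cnj (f z)) * chi2 n z"
  define K where "K = C + real (2 * k) * (4 * C\<^sup>2)"
  have K0: "K \<ge> 0" using C(1) by (simp add: K_def)
  have sf: "smooth f" by (rule holo_imp_smooth[OF f(1)])
  have mf [measurable]: "f \<in> borel_measurable M" "Z f \<in> borel_measurable M" "\<And>i. L (E i) f \<in> borel_measurable M"
    using f Zf smooth_measurable_M[OF smooth_L[OF sf]] by (auto simp: sqi_def)
  have int_f: "integrable M (\<lambda>z. (cmod (f z))\<^sup>2)" using f by (simp add: sqi_def)
  have pt: "?G z * Re (chi2 n z) \<le> Re (Lap (?p n) z) + K * (cmod (f z))\<^sup>2" for n z
    unfolding K_def
    using C(3)[of _ n z] dec[of "C * cmod (chi n z)" n] C(4)[of n z] dec[of C n] C(1)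
    by (intro gradient_energy_pointwise f) (auto intro: order_trans)
  have G_int: "integrable M (\<lambda>z. ?G z * Re (chi2 n z))" for n
  proof -
    have "Cc_inf (\<lambda>z. (\<Sum>i<2*k. L (E i) f z * cnj (L (E i) f z)) * chi2 n z)"
      by (intro Cc_inf_mult_left Cc_inf_chi2 smooth_sum smooth_mult smooth_cnj smooth_L sf)
    from Cc_inf_integrable_mu[OF a this] have "integrable M (\<lambda>z. complex_of_real (?G z * Re (chi2 n z)))"
      using chi2_range(1)[of n] by (simp add: complex_norm_square[symmetric])
    then show ?thesis by (simp only: complex_of_real_integrable_eq)
  qed
  define B where "B = (4 / a) * ((\<integral>z. cmod (Z f z) * cmod (f z) \<partial>M) + C * (\<integral>z. (cmod (f z))\<^sup>2 \<partial>M)) + K * (\<integral>z. (cmod (f z))\<^sup>2 \<partial>M)"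
  have bound: "(\<integral>z. ?G z * Re (chi2 n z) \<partial>M) \<le> B" for n
  proof -
    have Lp: "integrable M (Lap (?p n))" by (rule Cc_inf_integrable_mu[OF a Cc_inf_Lap[OF Cc_inf_product[OF f(1) f(1)]]])
    have "(\<integral>z. ?G z * Re (chi2 n z) \<partial>M) \<le> (\<integral>z. Re (Lap (?p n) z) + K * (cmod (f z))\<^sup>2 \<partial>M)"
      using Lp int_f by (intro integral_mono G_int pt Bochner_Integration.integrable_add integrable_Re integrable_mult_right)
    also have "\<dots> = Re (\<integral>z. Lap (?p n) z \<partial>M) + K * (\<integral>z. (cmod (f z))\<^sup>2 \<partial>M)"
      using Lp int_f by (simp add: integrable_Re)
    also have "Re (\<integral>z. Lap (?p n) z \<partial>M) \<le> (4 / a) * ((\<integral>z. cmod (Z f z) * cmod (f z) \<partial>M) + C * (\<integral>z. (cmod (f z))\<^sup>2 \<partial>M))"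
    proof -
      have "cmod (\<integral>z. Z (?p n) z \<partial>M) \<le> (\<integral>z. cmod (Z (?p n) z) \<partial>M)" by (rule integral_norm_bound)
      also have "\<dots> \<le> (\<integral>z. cmod (Z f z) * cmod (f z) + C * (cmod (f z))\<^sup>2 \<partial>M)"
      proof (rule integral_mono)
        show "integrable M (\<lambda>z. cmod (Z (?p n) z))"
          by (intro integrable_norm Cc_inf_integrable_mu[OF a] Cc_inf_Zop Cc_inf_product f)
        show "integrable M (\<lambda>z. cmod (Z f z) * cmod (f z) + C * (cmod (f z))\<^sup>2)"
          by (intro Bochner_Integration.integrable_add integrable_mult_right int_f sqi_integrable_mult(1) Zf f)
        show "cmod (Z (?p n) z) \<le> cmod (Z f z) * cmod (f z) + C * (cmod (f z))\<^sup>2" for z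
        proof -
          have "cmod (Z (?p n) z) \<le> cmod ((f z * cnj (f z)) * Z (chi2 n) z) + cmod (Z f z * cnj (f z) * chi2 n z)"
            unfolding Lap_product(2)[OF f(1) f(1)] by (rule norm_triangle_ineq)
          also have "\<dots> = (cmod (f z))\<^sup>2 * cmod (Z (chi2 n) z) + (cmod (Z f z) * cmod (f z)) * cmod (chi2 n z)"
            by (simp add: norm_mult power2_eq_square)
          also have "\<dots> \<le> (cmod (f z))\<^sup>2 * C + (cmod (Z f z) * cmod (f z)) * 1"
            by (intro add_mono mult_left_mono C chi2_range) auto
          finally show ?thesis by (simp add: mult.commute)
        qed
      qed
      also have "\<dots> = (\<integral>z. cmod (Z f z) * cmod (f z) \<partial>M) + C * (\<integral>z. (cmod (f z))\<^sup>2 \<partial>M)"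
        using int_f sqi_integrable_mult(1)[OF Zf f(2)] by simp
      finally have le: "cmod (\<integral>z. Z (?p n) z \<partial>M) \<le> (\<integral>z. cmod (Z f z) * cmod (f z) \<partial>M) + C * (\<integral>z. (cmod (f z))\<^sup>2 \<partial>M)" .
      have "Re (\<integral>z. Lap (?p n) z \<partial>M) \<le> cmod (\<integral>z. Lap (?p n) z \<partial>M)" by (rule complex_Re_le_cmod)
      also have "\<dots> = (4 / a) * cmod (\<integral>z. Z (?p n) z \<partial>M)"
        unfolding integral_Lap[OF Cc_inf_product[OF f(1) f(1)] a] using a by (simp add: norm_mult norm_divide)
      also have "\<dots> \<le> (4 / a) * ((\<integral>z. cmod (Z f z) * cmod (f z) \<partial>M) + C * (\<integral>z. (cmod (f z))\<^sup>2 \<partial>M))"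
        using a by (intro mult_left_mono le) auto
      finally show ?thesis .
    qed
    finally show ?thesis by (simp add: B_def)
  qed
  have "(\<lambda>n. Re (chi2 n z)) \<longlonglongrightarrow> 1" for z using tendsto_Re[OF chi2_tendsto[of z]] by simp
  then have "integrable M ?G"
    by (intro integrable_of_cutoffs(1)[of ?G M "\<lambda>n z. Re (chi2 n z)" B] G_int bound chi2_range(2) sum_nonneg) auto
  then have "integrable M (\<lambda>z. (cmod (L (E i) f z))\<^sup>2)"
  proof (rule Bochner_Integration.integrable_bound)
    show "AE z in M. norm ((cmod (L (E i) f z))\<^sup>2) \<le> norm (?G z)"
      using i member_le_sum[of i "{..<2*k}" "\<lambda>i. (cmod (L (E i) f _))\<^sup>2"] by (intro AE_I2) (simp add: abs_of_nonneg sum_nonneg)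
  qed measurable
  then show ?thesis by (simp add: sqi_def)
qed

text \<open>Both sides of \<open>integral_Lap\<close> for \<open>f cnj v chi2\<close> converge by
  dominated convergence as the cut-off is removed. The asymmetry of the hypotheses is deliberate:
  \<open>v\<close> runs through the holomorphic part of the form domain, where square-integrability
  is known for \<open>L v\<close> but not for \<open>Z v\<close>.\<close>

lemma form_identity:
  assumes f: "holo f" "sqi M f" and Zf: "sqi M (Z f)" and v: "holo v" "sqi M v"
    and Lf: "\<And>i. i < 2 * k \<Longrightarrow> sqi M (L (E i) f)" and Lv: "\<And>i. i < 2 * k \<Longrightarrow> sqi M (L (E i) v)"
  shows "(\<Sum>i<2*k. \<integral>z. L (E i) f z * cnj (L (E i) v z) \<partial>M) = (2 / a) * (\<integral>z. Z f z * cnj (v z) \<partial>M)"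
proof -
  obtain C where C: "C > 0"
    "\<And>i n z. i < 2 * k \<Longrightarrow> cmod (L (E i) (chi n) z) \<le> C / (real n + 1)"
    "\<And>i n z. i < 2 * k \<Longrightarrow> cmod (L (E i) (chi2 n) z) \<le> C * cmod (chi n z) / (real n + 1)"
    "\<And>n z. cmod (Lap (chi2 n) z) \<le> C / (real n + 1)"
    "\<And>n z. cmod (Z (chi2 n) z) \<le> C" "\<And>z. (\<lambda>n. Z (chi2 n) z) \<longlonglongrightarrow> 0"
    by (rule chi2_bounds) blast
  have dec: "c / (real n + 1) \<le> c" if "c \<ge> 0" for c n
    using that by (simp add: divide_le_eq mult_left_mono[of 1 "real n + 1" c, simplified] algebra_simps)
  have CL: "cmod (L (E i) (chi2 n) z) \<le> C / (real n + 1)" if "i < 2 * k" for i n z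
  proof -
    have "C * cmod (chi n z) / (real n + 1) \<le> C * 1 / (real n + 1)"
      using C(1) by (intro divide_right_mono mult_left_mono chi_range) auto
    then show ?thesis using C(3)[OF that, of n z] by simp
  qed
  note mf = sqi_measurable[OF f(2)] sqi_measurable[OF v(2)] sqi_measurable[OF Zf]
  let ?p = "\<lambda>n z. (f z * cnj (v z)) * chi2 n z"
  let ?S = "\<lambda>z. \<Sum>i<2*k. L (E i) f z * cnj (L (E i) v z)"
  let ?T = "\<lambda>i z. f z * cnj (L (E i) v z) + L (E i) f z * cnj (v z)"
  have int_S: "integrable M ?S" using Lf Lv by (intro Bochner_Integration.integrable_sum sqi_integrable_mult) auto
  have int_T: "integrable M (\<lambda>z. cmod (?T i z))" if "i < 2 * k" for i
    using Lf[OF that] Lv[OF that] f v by (intro integrable_norm Bochner_Integration.integrable_add sqi_integrable_mult)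
  have lim1: "(\<lambda>n. \<integral>z. Lap (?p n) z \<partial>M) \<longlonglongrightarrow> (\<integral>z. 2 * ?S z \<partial>M)"
  proof (rule integral_dominated_convergence[where w = "\<lambda>z. C * (cmod (f z) * cmod (v z)) + 2 * cmod (?S z) + 2 * (\<Sum>i<2*k. C * cmod (?T i z))"])
    show "(\<lambda>z. 2 * ?S z) \<in> borel_measurable M"
      using borel_measurable_integrable[OF integrable_mult_right[OF int_S, of 2]] .
    show "Lap (?p n) \<in> borel_measurable M" for n
      by (intro smooth_measurable_M Cc_inf_smooth Cc_inf_Lap Cc_inf_product f v)
    show "integrable M (\<lambda>z. C * (cmod (f z) * cmod (v z)) + 2 * cmod (?S z) + 2 * (\<Sum>i<2*k. C * cmod (?T i z)))"
      by (intro Bochner_Integration.integrable_add integrable_mult_right integrable_norm[OF int_S]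
          Bochner_Integration.integrable_sum sqi_integrable_mult(1) f v int_T) auto
    show "AE z in M. (\<lambda>n. Lap (?p n) z) \<longlonglongrightarrow> 2 * ?S z"
    proof (rule AE_I2)
      fix z
      have a1: "(\<lambda>n. Lap (chi2 n) z) \<longlonglongrightarrow> 0"
        by (rule Lim_null_comparison[OF _ const_over_Suc_tendsto[of C]]) (simp add: C(4))
      have a2: "(\<lambda>n. L (E i) (chi2 n) z) \<longlonglongrightarrow> 0" if "i < 2 * k" for i
        by (rule Lim_null_comparison[OF _ const_over_Suc_tendsto[of C]]) (simp add: CL[OF that])
      have "(\<lambda>n. Lap (?p n) z) \<longlonglongrightarrow> (f z * cnj (v z)) * 0 + 1 * (2 * ?S z) + 2 * (\<Sum>i<2*k. ?T i z * 0)"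
        unfolding Lap_product(1)[OF f(1) v(1)]
        by (intro tendsto_add tendsto_mult tendsto_const tendsto_sum a1 a2 chi2_tendsto) auto
      then show "(\<lambda>n. Lap (?p n) z) \<longlonglongrightarrow> 2 * ?S z" by simp
    qed
    show "AE z in M. cmod (Lap (?p n) z) \<le> C * (cmod (f z) * cmod (v z)) + 2 * cmod (?S z) + 2 * (\<Sum>i<2*k. C * cmod (?T i z))" for n
    proof (rule AE_I2)
      fix z
      have "cmod (Lap (?p n) z) \<le> cmod ((f z * cnj (v z)) * Lap (chi2 n) z) + cmod (chi2 n z * (2 * ?S z)) + cmod (2 * (\<Sum>i<2*k. ?T i z * L (E i) (chi2 n) z))"
        unfolding Lap_product(1)[OF f(1) v(1)] by (intro order_trans[OF norm_triangle_ineq] add_mono norm_triangle_ineq order_refl)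
      also have "cmod ((f z * cnj (v z)) * Lap (chi2 n) z) \<le> C * (cmod (f z) * cmod (v z))"
        using mult_left_mono[OF order_trans[OF C(4)[of n z] dec[of C n]], of "cmod (f z) * cmod (v z)"] C(1)
        by (simp add: norm_mult mult.commute)
      also have "cmod (chi2 n z * (2 * ?S z)) \<le> 2 * cmod (?S z)"
        using mult_right_mono[OF chi2_range(4)[of n z], of "cmod (2 * ?S z)"] by (simp add: norm_mult)
      also have "cmod (2 * (\<Sum>i<2*k. ?T i z * L (E i) (chi2 n) z)) \<le> 2 * (\<Sum>i<2*k. C * cmod (?T i z))"
      proof -
        have "cmod (\<Sum>i<2*k. ?T i z * L (E i) (chi2 n) z) \<le> (\<Sum>i<2*k. C * cmod (?T i z))"
        proof (rule sum_norm_le)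
          fix i assume "i \<in> {..<2*k}"
          then have "cmod (L (E i) (chi2 n) z) \<le> C" using CL[of i n z] dec[of C n] C(1) by simp
          then have "cmod (?T i z) * cmod (L (E i) (chi2 n) z) \<le> cmod (?T i z) * C" by (intro mult_left_mono) auto
          then show "cmod (?T i z * L (E i) (chi2 n) z) \<le> C * cmod (?T i z)" by (simp only: norm_mult mult.commute)
        qed
        then show ?thesis by (simp add: norm_mult)
      qed
      finally show "cmod (Lap (?p n) z) \<le> C * (cmod (f z) * cmod (v z)) + 2 * cmod (?S z) + 2 * (\<Sum>i<2*k. C * cmod (?T i z))" by simp
    qed
  qed
  have lim2: "(\<lambda>n. \<integral>z. Z (?p n) z \<partial>M) \<longlonglongrightarrow> (\<integral>z. Z f z * cnj (v z) \<partial>M)"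
  proof (rule integral_dominated_convergence[where w = "\<lambda>z. C * (cmod (f z) * cmod (v z)) + cmod (Z f z) * cmod (v z)"])
    show "(\<lambda>z. Z f z * cnj (v z)) \<in> borel_measurable M" using mf by (intro borel_measurable_times borel_measurable_cnj)
    show "Z (?p n) \<in> borel_measurable M" for n
      by (intro smooth_measurable_M Cc_inf_smooth Cc_inf_Zop Cc_inf_product f v)
    show "integrable M (\<lambda>z. C * (cmod (f z) * cmod (v z)) + cmod (Z f z) * cmod (v z))"
      by (intro Bochner_Integration.integrable_add integrable_mult_right sqi_integrable_mult(1) f v Zf)
    show "AE z in M. (\<lambda>n. Z (?p n) z) \<longlonglongrightarrow> Z f z * cnj (v z)"
    proof (rule AE_I2)
      fix z
      have "(\<lambda>n. Z (?p n) z) \<longlonglongrightarrow> (f z * cnj (v z)) * 0 + Z f z * cnj (v z) * 1"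
        unfolding Lap_product(2)[OF f(1) v(1)] by (intro tendsto_intros C chi2_tendsto)
      then show "(\<lambda>n. Z (?p n) z) \<longlonglongrightarrow> Z f z * cnj (v z)" by simp
    qed
    show "AE z in M. cmod (Z (?p n) z) \<le> C * (cmod (f z) * cmod (v z)) + cmod (Z f z) * cmod (v z)" for n
    proof (rule AE_I2)
      fix z
      have "cmod (Z (?p n) z) \<le> cmod ((f z * cnj (v z)) * Z (chi2 n) z) + cmod (Z f z * cnj (v z) * chi2 n z)"
        unfolding Lap_product(2)[OF f(1) v(1)] by (rule norm_triangle_ineq)
      also have "\<dots> = (cmod (f z) * cmod (v z)) * cmod (Z (chi2 n) z) + (cmod (Z f z) * cmod (v z)) * cmod (chi2 n z)"
        by (simp add: norm_mult)
      also have "\<dots> \<le> (cmod (f z) * cmod (v z)) * C + (cmod (Z f z) * cmod (v z)) * 1"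
        by (intro add_mono mult_left_mono C chi2_range) auto
      finally show "cmod (Z (?p n) z) \<le> C * (cmod (f z) * cmod (v z)) + cmod (Z f z) * cmod (v z)" by (simp add: mult.commute)
    qed
  qed
  have "(\<lambda>n. \<integral>z. Lap (?p n) z \<partial>M) \<longlonglongrightarrow> (4 / a) * (\<integral>z. Z f z * cnj (v z) \<partial>M)"
    unfolding integral_Lap[OF Cc_inf_product[OF f(1) v(1)] a] of_real_divide of_real_numeral
    by (intro tendsto_mult tendsto_const lim2)
  from LIMSEQ_unique[OF lim1 this]
  have "2 * (\<integral>z. ?S z \<partial>M) = (4 / a) * (\<integral>z. Z f z * cnj (v z) \<partial>M)" by simp
  moreover have "(\<integral>z. ?S z \<partial>M) = (\<Sum>i<2*k. \<integral>z. L (E i) f z * cnj (L (E i) v z) \<partial>M)"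
    using Lf Lv by (intro Bochner_Integration.integral_sum sqi_integrable_mult) auto
  ultimately have e: "2 * (\<Sum>i<2*k. \<integral>z. L (E i) f z * cnj (L (E i) v z) \<partial>M) = (4 / a) * (\<integral>z. Z f z * cnj (v z) \<partial>M)"
    by (simp only:)
  have "(\<Sum>i<2*k. \<integral>z. L (E i) f z * cnj (L (E i) v z) \<partial>M) = (2 * (\<Sum>i<2*k. \<integral>z. L (E i) f z * cnj (L (E i) v z) \<partial>M)) / 2"
    by simp
  also have "\<dots> = (2 / a) * (\<integral>z. Z f z * cnj (v z) \<partial>M)" unfolding e by simp
  finally show ?thesis .
qed

end

section \<open>Holomorphic elements of the form domain and the inclusion into D(B)\<close>

context heat_form begin

text \<open>The cut-off functions converge together with their horizontal gradients by dominated
  convergence; differentiating the cut-off costs only \<open>f\<close> times a term of order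
  \<open>1 / (n + 1)\<close>.\<close>

lemma cutoff_Qapprox:
  assumes f: "holo f" "sqi M f" and Lf: "\<And>i. i < 2 * k \<Longrightarrow> sqi M (L (E i) f)"
  shows "Qapprox mul x k (rho a) f (\<lambda>n z. f z * chi n z)"
proof -
  obtain C where C: "C > 0"
    "\<And>i n z. i < 2 * k \<Longrightarrow> cmod (L (E i) (chi n) z) \<le> C / (real n + 1)"
    by (rule chi2_bounds) blast
  have sf: "smooth f" by (rule holo_imp_smooth[OF f(1)])
  have sc: "smooth (chi n)" for n by (rule Cc_inf_smooth[OF Cc_inf_chi])
  let ?h = "\<lambda>n z. f z * chi n z"
  have h: "Cc_inf (?h n)" for n by (intro Cc_inf_mult_left Cc_inf_chi sf)
  have c1: "cmod (chi n z - 1) \<le> 1" for n z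
    using chi_range(1-3)[of n z] by (simp add: cmod_def abs_if)
  have A: "(\<lambda>n. \<integral>z. (cmod (?h n z - f z))\<^sup>2 \<partial>M) \<longlonglongrightarrow> 0"
  proof -
    have "(\<lambda>n. \<integral>z. (cmod (?h n z - f z))\<^sup>2 \<partial>M) \<longlonglongrightarrow> (\<integral>z. 0 \<partial>M)"
    proof (rule integral_dominated_convergence[where w = "\<lambda>z. (cmod (f z))\<^sup>2"])
      show "integrable M (\<lambda>z. (cmod (f z))\<^sup>2)" using f by (simp add: sqi_def)
      show "(\<lambda>z. (cmod (?h n z - f z))\<^sup>2) \<in> borel_measurable M" for n
        using smooth_measurable_M[OF smooth_diff[OF smooth_mult[OF sf sc] sf]] by measurable
      show "AE z in M. (\<lambda>n. (cmod (?h n z - f z))\<^sup>2) \<longlonglongrightarrow> 0"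
      proof (rule AE_I2)
        fix z
        have "(\<lambda>n. (cmod (?h n z - f z))\<^sup>2) \<longlonglongrightarrow> (cmod (f z * 1 - f z))\<^sup>2" by (intro tendsto_intros chi_tendsto)
        then show "(\<lambda>n. (cmod (?h n z - f z))\<^sup>2) \<longlonglongrightarrow> 0" by simp
      qed
      show "AE z in M. norm ((cmod (?h n z - f z))\<^sup>2) \<le> (cmod (f z))\<^sup>2" for n
      proof (rule AE_I2)
        fix z
        have "cmod (?h n z - f z) = cmod (f z) * cmod (chi n z - 1)" by (simp add: norm_mult[symmetric] algebra_simps)
        also have "\<dots> \<le> cmod (f z)" using mult_left_mono[OF c1[of n z], of "cmod (f z)"] by simp
        finally show "norm ((cmod (?h n z - f z))\<^sup>2) \<le> (cmod (f z))\<^sup>2" by (simp add: power_mono)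
      qed
    qed simp
    then show ?thesis by simp
  qed
  have Lh: "L (E i) (?h n) z - L (E i) f z = f z * L (E i) (chi n) z + L (E i) f z * (chi n z - 1)" for i n z
    by (simp add: L_mult[OF sf sc] algebra_simps)
  define d where "d n = (\<Sum>i<2*k. \<integral>z. (cmod (L (E i) (?h n) z - L (E i) f z))\<^sup>2 \<partial>M)" for n
  have "(\<lambda>n. \<integral>z. (cmod (L (E i) (?h n) z - L (E i) f z))\<^sup>2 \<partial>M) \<longlonglongrightarrow> 0" if i: "i < 2 * k" for i
  proof -
    have "(\<lambda>n. \<integral>z. (cmod (L (E i) (?h n) z - L (E i) f z))\<^sup>2 \<partial>M) \<longlonglongrightarrow> (\<integral>z. 0 \<partial>M)"
    proof (rule integral_dominated_convergence[where w = "\<lambda>z. 2 * (C\<^sup>2 * (cmod (f z))\<^sup>2) + 2 * (cmod (L (E i) f z))\<^sup>2"])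
      show "integrable M (\<lambda>z. 2 * (C\<^sup>2 * (cmod (f z))\<^sup>2) + 2 * (cmod (L (E i) f z))\<^sup>2)"
        using f Lf[OF i] by (simp add: sqi_def)
      show "(\<lambda>z. (cmod (L (E i) (?h n) z - L (E i) f z))\<^sup>2) \<in> borel_measurable M" for n
        using smooth_measurable_M[OF smooth_diff[OF smooth_L[OF smooth_mult[OF sf sc]] smooth_L[OF sf]]] by measurable
      show "AE z in M. (\<lambda>n. (cmod (L (E i) (?h n) z - L (E i) f z))\<^sup>2) \<longlonglongrightarrow> 0"
      proof (rule AE_I2)
        fix z
        have a2: "(\<lambda>n. L (E i) (chi n) z) \<longlonglongrightarrow> 0"
          by (rule Lim_null_comparison[OF _ const_over_Suc_tendsto[of C]]) (simp add: C(2)[OF i])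
        have "(\<lambda>n. (cmod (f z * L (E i) (chi n) z + L (E i) f z * (chi n z - 1)))\<^sup>2) \<longlonglongrightarrow> (cmod (f z * 0 + L (E i) f z * (1 - 1)))\<^sup>2"
          by (intro tendsto_intros a2 chi_tendsto)
        then show "(\<lambda>n. (cmod (L (E i) (?h n) z - L (E i) f z))\<^sup>2) \<longlonglongrightarrow> 0" by (simp add: Lh)
      qed
      show "AE z in M. norm ((cmod (L (E i) (?h n) z - L (E i) f z))\<^sup>2) \<le> 2 * (C\<^sup>2 * (cmod (f z))\<^sup>2) + 2 * (cmod (L (E i) f z))\<^sup>2" for n
      proof (rule AE_I2)
        fix z
        have Cn: "C / (real n + 1) \<le> C" using C(1) by (simp add: divide_le_eq)
        have "(cmod (L (E i) (?h n) z - L (E i) f z))\<^sup>2 \<le> 2 * (cmod (f z * L (E i) (chi n) z))\<^sup>2 + 2 * (cmod (L (E i) f z * (chi n z - 1)))\<^sup>2"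
          unfolding Lh by (rule sum_squares_bound')
        also have "\<dots> \<le> 2 * (cmod (f z) * C)\<^sup>2 + 2 * (cmod (L (E i) f z) * 1)\<^sup>2"
          unfolding norm_mult using order_trans[OF C(2)[OF i, of n z] Cn] c1[of n z]
          by (intro add_mono mult_left_mono power_mono) auto
        finally show "norm ((cmod (L (E i) (?h n) z - L (E i) f z))\<^sup>2) \<le> 2 * (C\<^sup>2 * (cmod (f z))\<^sup>2) + 2 * (cmod (L (E i) f z))\<^sup>2"
          by (simp add: power_mult_distrib mult.commute)
      qed
    qed simp
    then show ?thesis by simp
  qed
  then have "d \<longlonglongrightarrow> (\<Sum>i<2*k. 0)" unfolding d_def[abs_def] by (intro tendsto_sum) auto
  then have d: "d \<longlonglongrightarrow> 0" by simp
  have sD: "sqi M (\<lambda>z. L (E i) (?h n) z - L (E i) f z)" if "i < 2 * k" for i n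
    by (intro sqi_diff Cc_inf_sqi Cc_inf_L h Lf that)
  have Qd: "cmod (Qa (\<lambda>z. ?h n z - ?h p z) (\<lambda>z. ?h n z - ?h p z)) \<le> 2 * d n + 2 * d p" for n p
  proof -
    have "cmod (Qa (\<lambda>z. ?h n z - ?h p z) (\<lambda>z. ?h n z - ?h p z)) = (\<Sum>i<2*k. \<integral>z. (cmod (L (E i) (?h n) z - L (E i) (?h p) z))\<^sup>2 \<partial>M)"
      unfolding Q0_diag[OF Cc_inf_diff[OF h h]] by (simp only: L_diff[OF Cc_inf_smooth[OF h] Cc_inf_smooth[OF h]])
    also have "\<dots> \<le> (\<Sum>i<2*k. 2 * (\<integral>z. (cmod (L (E i) (?h n) z - L (E i) f z))\<^sup>2 \<partial>M) + 2 * (\<integral>z. (cmod (L (E i) (?h p) z - L (E i) f z))\<^sup>2 \<partial>M))"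
    proof (rule sum_mono)
      fix i assume "i \<in> {..<2*k}"
      then have i: "i < 2 * k" by simp
      let ?u = "\<lambda>n z. L (E i) (?h n) z - L (E i) f z"
      have int: "integrable M (\<lambda>z. (cmod (?u n z))\<^sup>2)" for n using sD[OF i] by (simp add: sqi_def)
      have "(\<integral>z. (cmod (L (E i) (?h n) z - L (E i) (?h p) z))\<^sup>2 \<partial>M) \<le> (\<integral>z. 2 * (cmod (?u n z))\<^sup>2 + 2 * (cmod (?u p z))\<^sup>2 \<partial>M)"
      proof (rule integral_mono)
        have "sqi M (\<lambda>z. L (E i) (?h n) z - L (E i) (?h p) z)" by (intro sqi_diff Cc_inf_sqi Cc_inf_L h)
        then show "integrable M (\<lambda>z. (cmod (L (E i) (?h n) z - L (E i) (?h p) z))\<^sup>2)" by (simp add: sqi_def)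
        show "(cmod (L (E i) (?h n) z - L (E i) (?h p) z))\<^sup>2 \<le> 2 * (cmod (?u n z))\<^sup>2 + 2 * (cmod (?u p z))\<^sup>2" for z
          using sum_squares_bound'[of "?u n z" "- ?u p z"] by (simp add: norm_minus_commute)
      qed (intro Bochner_Integration.integrable_add integrable_mult_right int)
      also have "\<dots> = 2 * (\<integral>z. (cmod (?u n z))\<^sup>2 \<partial>M) + 2 * (\<integral>z. (cmod (?u p z))\<^sup>2 \<partial>M)"
        using int by simp
      finally show "(\<integral>z. (cmod (L (E i) (?h n) z - L (E i) (?h p) z))\<^sup>2 \<partial>M) \<le> \<dots>" .
    qed
    also have "\<dots> = 2 * d n + 2 * d p" by (simp only: d_def sum.distrib sum_distrib_left)
    finally show ?thesis .
  qed
  have "(\<lambda>n. normL2 (rho a) (\<lambda>z. ?h n z - f z)) \<longlonglongrightarrow> 0"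
  proof -
    have "(\<lambda>n. sqrt (\<integral>z. (cmod (?h n z - f z))\<^sup>2 \<partial>M)) \<longlonglongrightarrow> sqrt 0" by (intro tendsto_intros A)
    moreover have "normL2 (rho a) (\<lambda>z. ?h n z - f z) = sqrt (\<integral>z. (cmod (?h n z - f z))\<^sup>2 \<partial>M)" for n
      by (intro normL2_eq smooth_borel_measurable smooth_diff smooth_mult sf sc)
    ultimately show ?thesis by simp
  qed
  moreover have "\<exists>N. \<forall>n\<ge>N. \<forall>p\<ge>N. cmod (Qa (\<lambda>z. ?h n z - ?h p z) (\<lambda>z. ?h n z - ?h p z)) < e" if e: "e > 0" for e
  proof -
    obtain N where N: "\<And>n. n \<ge> N \<Longrightarrow> d n < e / 4"
      using order_tendstoD(2)[OF d, of "e / 4"] e unfolding eventually_sequentially by auto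
    have "cmod (Qa (\<lambda>z. ?h n z - ?h p z) (\<lambda>z. ?h n z - ?h p z)) < e" if "n \<ge> N" "p \<ge> N" for n p
      using Qd[of n p] N[OF that(1)] N[OF that(2)] by linarith
    then show ?thesis by blast
  qed
  ultimately show ?thesis unfolding Qapprox_def using h by blast
qed

text \<open>By \<open>Qapprox_gradient\<close> the gradients of every admissible sequence converge
  to the classical gradient, so the limit is independent of the sequences chosen.\<close>

lemma Qval_smooth:
  assumes "smooth f" "sqi M f" "smooth v" "sqi M v"
  shows "Qval mul x k (rho a) f v (\<Sum>i<2*k. \<integral>z. L (E i) f z * cnj (L (E i) v z) \<partial>M)"
  unfolding Qval_def
proof (intro allI impI, elim conjE)
  fix fs gs assume fs: "Qapprox mul x k (rho a) f fs" and gs: "Qapprox mul x k (rho a) v gs"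
  have C: "Cc_inf (fs n)" "Cc_inf (gs n)" for n using fs gs by (auto simp: Qapprox_def)
  show "(\<lambda>n. Qa (fs n) (gs n)) \<longlonglongrightarrow> (\<Sum>i<2*k. \<integral>z. L (E i) f z * cnj (L (E i) v z) \<partial>M)"
    unfolding Q0_Cc[OF C]
  proof (rule tendsto_sum)
    fix i assume "i \<in> {..<2*k}"
    then have i: "i < 2 * k" by simp
    show "(\<lambda>n. \<integral>z. L (E i) (fs n) z * cnj (L (E i) (gs n) z) \<partial>M) \<longlonglongrightarrow> (\<integral>z. L (E i) f z * cnj (L (E i) v z) \<partial>M)"
      by (rule sqi_inner_tendsto[OF Cc_inf_sqi[OF Cc_inf_L[OF C(1)]] Qapprox_gradient[OF fs assms(1,2) i]
            Cc_inf_sqi[OF Cc_inf_L[OF C(2)]] Qapprox_gradient[OF gs assms(3,4) i]])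
  qed
qed

abbreviation "DQ \<equiv> domQ mul x k (rho a) \<inter> HL2 (rho a)"

lemma HL2_D: "f \<in> HL2 (rho a) \<longleftrightarrow> holo f \<and> sqi M f"
  by (simp add: HL2_def L2_sqi)

lemma Brel_Zop:
  assumes f: "f \<in> HL2 (rho a)" and Zf: "sqi M (Z f)"
  shows "Brel mul x k (rho a) f (\<lambda>z. complex_of_real (2 / a) * Z f z)"
proof -
  have f': "holo f" "sqi M f" using f by (auto simp: HL2_D)
  have Lf: "sqi M (L (E i) f)" if "i < 2 * k" for i by (rule gradient_sqi[OF f' Zf that])
  have fQ: "f \<in> domQ mul x k (rho a)"
    unfolding domQ_def using cutoff_Qapprox[OF f' Lf] f'(2) by (auto simp: L2_sqi)
  have w: "(\<lambda>z. complex_of_real (2 / a) * Z f z) \<in> HL2 (rho a)"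
    unfolding HL2_D using holo_mult[OF holo_const holo_Zop[OF f'(1)]] sqi_cmult[OF Zf] by blast
  have "Qval mul x k (rho a) f v (ipL2 (rho a) (\<lambda>z. complex_of_real (2 / a) * Z f z) v)" if v: "v \<in> DQ" for v
  proof -
    have v': "holo v" "sqi M v" using v by (auto simp: HL2_D)
    obtain gs where gs: "Qapprox mul x k (rho a) v gs" using v by (auto simp: domQ_def)
    have Lv: "sqi M (L (E i) v)" if "i < 2 * k" for i
      by (rule Qapprox_gradient(1)[OF gs holo_imp_smooth[OF v'(1)] v'(2) that])
    have sv: "smooth v" "smooth (Z f)" using holo_imp_smooth v'(1) smooth_Zop f'(1) by blast+
    have "ipL2 (rho a) (\<lambda>z. complex_of_real (2 / a) * Z f z) v = (\<integral>z. complex_of_real (2 / a) * Z f z * cnj (v z) \<partial>M)"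
      by (intro ipL2_eq smooth_borel_measurable smooth_mult smooth_const sv)
    also have "\<dots> = complex_of_real (2 / a) * (\<integral>z. Z f z * cnj (v z) \<partial>M)"
      by (simp only: mult.assoc integral_mult_right_zero)
    also have "\<dots> = (\<Sum>i<2*k. \<integral>z. L (E i) f z * cnj (L (E i) v z) \<partial>M)"
      using form_identity[OF f' Zf v' Lf Lv] by simp
    finally show ?thesis
      using Qval_smooth[OF holo_imp_smooth[OF f'(1)] f'(2) sv(1) v'(2)] by simp
  qed
  then show ?thesis unfolding Brel_def using f fQ w by blast
qed

subsection \<open>Homogeneous components\<close>

text \<open>Rotation invariance of the measure is available on test functions. It is applied to
  \<open>|f|^2\<close> times cut-offs, and Fatou's lemma yields the inequality.\<close>

lemma rotation_sqi:
  assumes f: "smooth f" "sqi M f" and l: "cmod l = 1"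
  shows "sqi M (\<lambda>z. f (dl l z))" "(\<integral>z. (cmod (f (dl l z)))\<^sup>2 \<partial>M) \<le> (\<integral>z. (cmod (f z))\<^sup>2 \<partial>M)"
proof -
  let ?G = "\<lambda>z. (cmod (f (dl l z)))\<^sup>2"
  let ?p = "\<lambda>n z. f z * cnj (f z) * chi n z"
  have l0: "l \<noteq> 0" using l by auto
  have p: "Cc_inf (?p n)" for n by (intro Cc_inf_mult_left Cc_inf_chi smooth_mult smooth_cnj f)
  have p_eq: "?p n z = complex_of_real ((cmod (f z))\<^sup>2 * Re (chi n z))" for n z
  proof -
    have "chi n z = complex_of_real (Re (chi n z))" using chi_range(3)[of n z] by (simp add: complex_eq_iff)
    then show ?thesis by (simp only: of_real_mult complex_norm_square)
  qed
  have sfl: "smooth (\<lambda>z. f (dl l z))" by (rule smooth_dil[OF f(1)])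
  have m: "(\<lambda>z. f (dl l z)) \<in> borel_measurable M" by (rule smooth_measurable_M[OF sfl])
  have int: "integrable M (\<lambda>z. ?G z * Re (chi n (dl l z)))" for n
    using Cc_inf_integrable_mu[OF a Cc_inf_dil[OF p l0, of n]] by (simp only: p_eq complex_of_real_integrable_eq)
  have le: "(\<integral>z. ?G z * Re (chi n (dl l z)) \<partial>M) \<le> (\<integral>z. (cmod (f z))\<^sup>2 \<partial>M)" for n
  proof -
    have "complex_of_real (\<integral>z. ?G z * Re (chi n (dl l z)) \<partial>M) = complex_of_real (\<integral>z. (cmod (f z))\<^sup>2 * Re (chi n z) \<partial>M)"
      using integral_rotation[OF p l a, of n] by (simp only: p_eq integral_complex_of_real)
    then have "(\<integral>z. ?G z * Re (chi n (dl l z)) \<partial>M) = (\<integral>z. (cmod (f z))\<^sup>2 * Re (chi n z) \<partial>M)" by (simp only: of_real_eq_iff)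
    also have "\<dots> \<le> (\<integral>z. (cmod (f z))\<^sup>2 \<partial>M)"
    proof (rule integral_mono)
      show "integrable M (\<lambda>z. (cmod (f z))\<^sup>2 * Re (chi n z))"
        using Cc_inf_integrable_mu[OF a p[of n]] by (simp only: p_eq complex_of_real_integrable_eq)
      show "integrable M (\<lambda>z. (cmod (f z))\<^sup>2)" using f by (simp add: sqi_def)
      show "(cmod (f z))\<^sup>2 * Re (chi n z) \<le> (cmod (f z))\<^sup>2" for z
        using mult_left_mono[OF chi_range(2)[of n z], of "(cmod (f z))\<^sup>2"] by simp
    qed
    finally show ?thesis .
  qed
  have lim: "(\<lambda>n. Re (chi n (dl l z))) \<longlonglongrightarrow> 1" for z using tendsto_Re[OF chi_tendsto[of "dl l z"]] by simp
  have "integrable M ?G" "(\<integral>z. ?G z \<partial>M) \<le> (\<integral>z. (cmod (f z))\<^sup>2 \<partial>M)"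
    by (rule integrable_of_cutoffs[of ?G M "\<lambda>n z. Re (chi n (dl l z))", OF _ _ chi_range(1) lim int le]; use m in simp)+
  then show "sqi M (\<lambda>z. f (dl l z))" "(\<integral>z. ?G z \<partial>M) \<le> (\<integral>z. (cmod (f z))\<^sup>2 \<partial>M)"
    using m by (auto simp: sqi_def)
qed

text \<open>The rotated functions are already square-integrable, so here the cut-off is removed by
  dominated convergence, both for the rotation \<open>l\<close> and for the trivial one.\<close>

lemma rotation_inner:
  assumes w: "smooth w" "sqi M w" and g: "smooth g" "sqi M g" and l: "cmod l = 1"
  shows "(\<integral>z. w (dl l z) * cnj (g (dl l z)) \<partial>M) = (\<integral>z. w z * cnj (g z) \<partial>M)"
proof -
  let ?p = "\<lambda>n z. w z * cnj (g z) * chi n z"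
  have p: "Cc_inf (?p n)" for n by (intro Cc_inf_mult_left Cc_inf_chi smooth_mult smooth_cnj w g)
  have lim: "(\<lambda>n. \<integral>z. ?p n (dl b z) \<partial>M) \<longlonglongrightarrow> (\<integral>z. w (dl b z) * cnj (g (dl b z)) \<partial>M)" if b: "cmod b = 1" for b
  proof (rule integral_dominated_convergence[where w = "\<lambda>z. cmod (w (dl b z)) * cmod (g (dl b z))"])
    note s = rotation_sqi(1)[OF w b] rotation_sqi(1)[OF g b]
    have b0: "b \<noteq> 0" using b by auto
    show "integrable M (\<lambda>z. cmod (w (dl b z)) * cmod (g (dl b z)))" by (rule sqi_integrable_mult(1)[OF s])
    show "(\<lambda>z. w (dl b z) * cnj (g (dl b z))) \<in> borel_measurable M"
      using borel_measurable_integrable[OF sqi_integrable_mult(3)[OF s]] .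
    show "(\<lambda>z. ?p n (dl b z)) \<in> borel_measurable M" for n
      using smooth_measurable_M[OF Cc_inf_smooth[OF Cc_inf_dil[OF p b0]]] .
    show "AE z in M. (\<lambda>n. ?p n (dl b z)) \<longlonglongrightarrow> w (dl b z) * cnj (g (dl b z))"
    proof (rule AE_I2)
      fix z
      have "(\<lambda>n. ?p n (dl b z)) \<longlonglongrightarrow> w (dl b z) * cnj (g (dl b z)) * 1" by (intro tendsto_intros chi_tendsto)
      then show "(\<lambda>n. ?p n (dl b z)) \<longlonglongrightarrow> w (dl b z) * cnj (g (dl b z))" by simp
    qed
    show "AE z in M. norm (?p n (dl b z)) \<le> cmod (w (dl b z)) * cmod (g (dl b z))" for n
      using chi_range(4)[of n] by (intro AE_I2) (simp add: norm_mult mult_left_le)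
  qed
  have "(\<lambda>n. \<integral>z. ?p n (dl l z) \<partial>M) = (\<lambda>n. \<integral>z. ?p n (dl 1 z) \<partial>M)"
    using integral_rotation[OF p l a] by (simp add: dil_1)
  with lim[OF l] lim[of 1] have "(\<integral>z. w (dl l z) * cnj (g (dl l z)) \<partial>M) = (\<integral>z. w (dl 1 z) * cnj (g (dl 1 z)) \<partial>M)"
    by (metis (no_types, lifting) LIMSEQ_unique norm_one)
  then show ?thesis by (simp add: dil_1)
qed

end

text \<open>Lebesgue measure on the unit interval as a density on the whole line, so that its
  measurable sets are all Borel sets of the line and products with \<open>M\<close> carry the
  ordinary Borel structure.\<close>

definition circ :: "real measure" where
  "circ = density lborel (\<lambda>t. ennreal (indicator {0..1} t))"

lemma sets_circ [simp, measurable_cong]: "sets circ = sets borel" and space_circ [simp]: "space circ = UNIV"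
  by (auto simp: circ_def)

lemma emeasure_circ: "emeasure circ UNIV = 1"
  unfolding circ_def by (subst emeasure_density) (auto simp: ennreal_indicator)

lemma finite_measure_circ: "finite_measure circ"
  by (rule finite_measureI) (simp add: emeasure_circ)

lemma circ_integral:
  fixes F :: "real \<Rightarrow> complex"
  assumes "continuous_on UNIV F"
  shows "integral\<^sup>L circ F = integral {0..1} F"
proof -
  have c: "continuous_on {0..1} F" using assms continuous_on_subset by blast
  have "integral\<^sup>L circ F = (LINT t:{0..1}|lborel. F t)"
    unfolding circ_def set_lebesgue_integral_def
    using borel_measurable_continuous_onI[OF assms] by (subst integral_density) auto
  also have "\<dots> = integral {0..1} F" by (rule set_borel_integral_eq_integral(2)[OF borel_integrable_atLeastAtMost'[OF c]])
  finally show ?thesis .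
qed

section \<open>Homogeneous components as Taylor coefficients along dilations\<close>

context stratified_algebra begin

text \<open>The \<open>j\<close>-th Fourier coefficient of \<open>f\<close> under the circle of
  unimodular dilations; for holomorphic \<open>f\<close> it is the part homogeneous of degree
  \<open>j\<close>.\<close>

definition hcomp :: "nat \<Rightarrow> (complex^'n \<Rightarrow> complex) \<Rightarrow> complex^'n \<Rightarrow> complex" where
  "hcomp j f z = integral {0..1} (\<lambda>t. cis (- (2 * pi * real j * t)) * f (dl (cis (2 * pi * t)) z))"

lemma holo_hcomp: "holo f \<Longrightarrow> holo (hcomp j f)"
  using holo_integral[of f "\<lambda>t. dl (cis (2 * pi * t))" "\<lambda>t. 0" "\<lambda>t. cis (- (2 * pi * real j * t))"]
  by (simp add: hcomp_def[abs_def] bounded_linear.linear[OF dil_bounded_linear] dil_vec_scale continuous_intros)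

text \<open>Dilations are polynomial in \<open>l\<close> and defined at \<open>l = 0\<close> too, so
  \<open>l \<mapsto> f (dl l z)\<close> is entire. The sum starts at \<open>j = 1\<close>, so the
  exponent \<open>j - 1\<close> is never truncated.\<close>

lemma dil_field_derivative:
  assumes f: "holo f"
  shows "((\<lambda>l. f (dl l z)) has_field_derivative
    frechet_derivative f (at (dl l z)) (\<Sum>j=1..m. (of_nat j * l ^ (j - 1)) *s lay z j)) (at l)"
proof (rule holo_line_field_derivative[OF f])
  have "((\<lambda>l. l ^ j *s lay z j) has_derivative (\<lambda>h. h *s ((of_nat j * l ^ (j - 1)) *s lay z j))) (at l)" for j
  proof -
    have "((\<lambda>l. l ^ j) has_derivative (\<lambda>h. h * (of_nat j * l ^ (j - 1)))) (at l)"
      by (auto intro!: derivative_eq_intros simp: mult_ac)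
    from bounded_linear.has_derivative[OF bounded_linear_vec_scale this] show ?thesis by simp
  qed
  then have "((\<lambda>l. dl l z) has_derivative (\<lambda>h. \<Sum>j=1..m. h *s ((of_nat j * l ^ (j - 1)) *s lay z j))) (at l)"
    unfolding dil_eq by (intro has_derivative_sum)
  then show "((\<lambda>l. dl l z) has_derivative (\<lambda>h. h *s (\<Sum>j=1..m. (of_nat j * l ^ (j - 1)) *s lay z j))) (at l)"
    by (simp only: vec.scale_sum_right)
qed

lemma dil_holomorphic:
  assumes "holo f" shows "(\<lambda>l. f (dl l z)) holomorphic_on S"
  unfolding holomorphic_on_def field_differentiable_def
  using has_field_derivative_at_within[OF dil_field_derivative[OF assms]] by blast

lemma Zop_deriv:
  assumes f: "holo f" shows "Zop V m f z = deriv (\<lambda>l. f (dl l z)) 1"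
  using DERIV_imp_deriv[OF dil_field_derivative[OF f, of z 1]] by (simp add: dil_1 Zop_holo[OF f] Eul_def)

lemma hcomp_deriv: "holo f \<Longrightarrow> hcomp j f z = (deriv ^^ j) (\<lambda>l. f (dl l z)) 0 / fact j"
  using integral_unique[OF circle_integral_Taylor_coeff[OF dil_holomorphic[of f z UNIV], of j]]
  by (simp add: hcomp_def mult.commute)

text \<open>Rescaling the variable of the entire function by \<open>l\<close> multiplies its
  \<open>j\<close>-th derivative at 0 by \<open>l ^ j\<close>.\<close>

lemma hcomp_homogeneous:
  assumes f: "holo f" shows "hcomp j f (dl l z) = l ^ j * hcomp j f z"
proof -
  have "(deriv ^^ j) (\<lambda>u. (\<lambda>v. f (dl v z)) (l * u)) 0 = l ^ j * (deriv ^^ j) (\<lambda>v. f (dl v z)) (l * 0)"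
    by (rule higher_deriv_compose_linear[OF dil_holomorphic[OF f, of z UNIV] open_UNIV open_UNIV]) auto
  then show ?thesis by (simp add: hcomp_deriv[OF f] dil_dil mult.commute)
qed

lemma Zop_homogeneous:
  assumes f: "holo f" and h: "\<And>l z. f (dl l z) = l ^ j * f z"
  shows "Zop V m f z = of_nat j * f z"
proof -
  have "((\<lambda>l. l ^ j * f z) has_field_derivative of_nat j * f z) (at 1)" by (auto intro!: derivative_eq_intros)
  then show ?thesis unfolding Zop_deriv[OF f] h by (rule DERIV_imp_deriv)
qed

lemma holo_sum_hcomp:
  assumes f: "holo f" shows "(\<lambda>j. hcomp j f z) sums f z"
  using holomorphic_power_series[OF dil_holomorphic[OF f, of z], of 1 0 2] by (simp add: hcomp_deriv[OF f] dil_1)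

text \<open>\<open>Z f z\<close> is the derivative of \<open>l \<mapsto> f (dl l z)\<close> at 1;
  the Taylor series at 0 of that derivative converges on the disc of radius 2 and is evaluated at 1.
  The index shift is harmless since the term \<open>j = 0\<close> is 0.\<close>

lemma Zop_sum_hcomp:
  assumes f: "holo f" shows "(\<lambda>j. of_nat j * hcomp j f z) sums Zop V m f z"
proof -
  let ?F = "\<lambda>l. f (dl l z)"
  have "deriv ?F holomorphic_on ball 0 2" using dil_holomorphic[OF f] by (intro holomorphic_deriv) auto
  from holomorphic_power_series[OF this, of 1]
  have "(\<lambda>j. (deriv ^^ j) (deriv ?F) 0 / fact j) sums Zop V m f z" by (simp add: Zop_deriv[OF f])
  moreover have "(deriv ^^ j) (deriv ?F) 0 / fact j = of_nat (Suc j) * hcomp (Suc j) f z" for j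
    unfolding hcomp_deriv[OF f] funpow_Suc_right o_def fact_Suc by (simp del: of_nat_Suc)
  ultimately have "(\<lambda>j. of_nat (Suc j) * hcomp (Suc j) f z) sums Zop V m f z" by simp
  then show ?thesis by (subst (asm) sums_Suc_iff) simp
qed

end

section \<open>Square-integrable components and the identification of B f\<close>

context heat_form begin

lemma sigma_pair: "pair_sigma_finite circ M"
  by (intro pair_sigma_finite.intro finite_measure.axioms(1) finite_measure_circ finite_measure_mu a)

lemma sets_pair: "sets (circ \<Otimes>\<^sub>M M) = sets borel"
  unfolding borel_prod[symmetric] by (rule sets_pair_measure_cong) simp_all

lemma continuous_measurable_pair:
  fixes F :: "real \<times> (complex^'n) \<Rightarrow> 'b::topological_space"
  assumes "continuous_on UNIV F" shows "F \<in> borel_measurable (circ \<Otimes>\<^sub>M M)"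
  using borel_measurable_continuous_onI[OF assms] by (simp add: measurable_cong_sets[OF sets_pair refl])

lemma continuous_on_rotated:
  assumes "holo w" shows "continuous_on S (\<lambda>p. w (dl (cis (2 * pi * fst p)) (snd p)))"
  by (rule continuous_on_compose2[OF holo_continuous_on[OF assms, of UNIV]]) (auto intro!: continuous_intros)

text \<open>A dominating function on the product for the Fubini exchanges below: by
  \<open>rotation_sqi\<close> its integral over the group is bounded independently of the
  angle.\<close>

lemma integrable_pair_rotated:
  assumes w: "holo w" "sqi M w" and g: "holo g" "sqi M g"
  shows "integrable (circ \<Otimes>\<^sub>M M) (\<lambda>p. (cmod (w (dl (cis (2 * pi * fst p)) (snd p))))\<^sup>2 + (cmod (g (snd p)))\<^sup>2)"
proof -
  interpret T: finite_measure circ by (rule finite_measure_circ)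
  interpret P: pair_sigma_finite circ M by (rule sigma_pair)
  let ?F = "\<lambda>p. (cmod (w (dl (cis (2 * pi * fst p)) (snd p))))\<^sup>2 + (cmod (g (snd p)))\<^sup>2"
  have c: "continuous_on UNIV ?F"
    by (intro continuous_intros continuous_on_rotated w continuous_on_compose2[OF holo_continuous_on[OF g(1), of UNIV]]) auto
  have m: "?F \<in> borel_measurable (circ \<Otimes>\<^sub>M M)" by (rule continuous_measurable_pair[OF c])
  let ?A = "\<integral>z. (cmod (w z))\<^sup>2 \<partial>M" and ?B = "\<integral>z. (cmod (g z))\<^sup>2 \<partial>M"
  have r: "sqi M (\<lambda>z. w (dl (cis (2 * pi * t)) z))" "(\<integral>z. (cmod (w (dl (cis (2 * pi * t)) z)))\<^sup>2 \<partial>M) \<le> ?A" for t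
    using rotation_sqi[OF holo_imp_smooth[OF w(1)] w(2)] by auto
  have i: "integrable M (\<lambda>z. ?F (t, z))" for t
    using r(1)[of t] g(2) by (simp add: sqi_def)
  have le: "(\<integral>z. norm (?F (t, z)) \<partial>M) \<le> ?A + ?B" for t
    using r[of t] g(2) by (simp add: sqi_def abs_of_nonneg)
  show ?thesis
  proof (rule P.Fubini_integrable[OF m])
    show "AE t in circ. integrable M (\<lambda>z. ?F (t, z))" using i by simp
    have "(\<lambda>(t, z). norm (?F (t, z))) \<in> borel_measurable (circ \<Otimes>\<^sub>M M)"
      unfolding split_beta' prod.collapse by (rule measurable_compose[OF m borel_measurable_norm])
    then have "(\<lambda>t. \<integral>z. norm (?F (t, z)) \<partial>M) \<in> borel_measurable circ"
      by (rule P.M2.borel_measurable_lebesgue_integral)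
    then show "integrable circ (\<lambda>t. \<integral>z. norm (?F (t, z)) \<partial>M)"
      using le by (intro T.integrable_const_bound[where B = "?A + ?B"]) auto
  qed
qed

lemma circ_rotation_integral:
  assumes w: "holo w"
  shows "hcomp j w z = (\<integral>t. cis (- (2 * pi * real j * t)) * w (dl (cis (2 * pi * t)) z) \<partial>circ)"
  unfolding hcomp_def
  by (rule circ_integral[symmetric])
    (intro continuous_intros continuous_on_compose2[OF holo_continuous_on[OF w, of UNIV]], auto)

text \<open>Cauchy-Schwarz on the circle, which has mass 1, bounds \<open>|hcomp j w z|^2\<close> by
  the mean of \<open>|w|^2\<close> over the orbit of \<open>z\<close>, and Fubini makes this mean
  integrable.\<close>

lemma sqi_hcomp:
  assumes w: "holo w" "sqi M w"
  shows "sqi M (hcomp j w)"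
proof -
  interpret T: finite_measure circ by (rule finite_measure_circ)
  interpret P: pair_sigma_finite circ M by (rule sigma_pair)
  let ?I = "\<lambda>z. \<integral>t. (cmod (w (dl (cis (2 * pi * t)) z)))\<^sup>2 \<partial>circ"
  have z0: "holo (\<lambda>z. 0)" "sqi M (\<lambda>z. 0)" by (auto simp: holo_const sqi_def)
  have int: "integrable (circ \<Otimes>\<^sub>M M) (\<lambda>(t, z). (cmod (w (dl (cis (2 * pi * t)) z)))\<^sup>2)"
    using integrable_pair_rotated[OF w z0] by (simp add: split_beta')
  have iI: "integrable M ?I" using P.integrable_snd[OF int] .
  have "(cmod (hcomp j w z))\<^sup>2 \<le> ?I z" for z
  proof -
    let ?f = "\<lambda>t. w (dl (cis (2 * pi * t)) z)" and ?c = "\<lambda>t. cis (- (2 * pi * real j * t))"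
    have cont: "continuous_on UNIV ?f"
      by (rule continuous_on_compose2[OF holo_continuous_on[OF w(1), of UNIV]]) (auto intro!: continuous_intros)
    have sf: "sqi circ ?f"
    proof -
      have "continuous_on {0..1} (\<lambda>t. (cmod (?f t))\<^sup>2)" by (intro continuous_intros continuous_on_subset[OF cont]) auto
      from borel_integrable_atLeastAtMost'[OF this] have "integrable circ (\<lambda>t. (cmod (?f t))\<^sup>2)"
        unfolding circ_def set_integrable_def using borel_measurable_continuous_onI[OF cont]
        by (subst integrable_density) auto
      then show ?thesis unfolding sqi_def using borel_measurable_continuous_onI[OF cont] by simp
    qed
    have s1: "sqi circ (\<lambda>t. 1)" by (simp add: sqi_def)
    have "cmod (hcomp j w z) \<le> (\<integral>t. cmod (?c t * ?f t) \<partial>circ)"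
      unfolding circ_rotation_integral[OF w(1)] by (rule integral_norm_bound)
    also have "\<dots> = (\<integral>t. cmod (?f t) * cmod 1 \<partial>circ)" by (simp add: norm_mult)
    finally have "(cmod (hcomp j w z))\<^sup>2 \<le> (\<integral>t. cmod (?f t) * cmod 1 \<partial>circ)\<^sup>2" by (intro power_mono) auto
    also have "\<dots> \<le> ?I z * (\<integral>t. (cmod 1)\<^sup>2 \<partial>circ)" by (rule Cauchy_Schwarz_sqi[OF sf s1])
    also have "(\<integral>t. (cmod 1)\<^sup>2 \<partial>circ) = 1" by (simp add: measure_def emeasure_circ)
    finally show ?thesis by simp
  qed
  note le = this
  have m: "hcomp j w \<in> borel_measurable M" by (intro smooth_measurable_M holo_imp_smooth holo_hcomp w)
  have "integrable M (\<lambda>z. (cmod (hcomp j w z))\<^sup>2)"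
    by (rule Bochner_Integration.integrable_bound[OF iI]) (use m le in \<open>auto intro: order_trans[OF _ abs_ge_self]\<close>)
  then show ?thesis using m by (simp add: sqi_def)
qed

text \<open>Rotating both factors leaves the inner product unchanged, and homogeneity turns the
  rotation of \<open>g\<close> into a Fourier character. Averaging over the angle then replaces
  \<open>w\<close> by its component of degree \<open>j\<close>.\<close>

lemma inner_hcomp:
  assumes w: "holo w" "sqi M w" and g: "holo g" "sqi M g" and h: "\<And>l z. g (dl l z) = l ^ j * g z"
  shows "(\<integral>z. w z * cnj (g z) \<partial>M) = (\<integral>z. hcomp j w z * cnj (g z) \<partial>M)"
proof -
  interpret T: finite_measure circ by (rule finite_measure_circ)
  interpret P: pair_sigma_finite circ M by (rule sigma_pair)
  let ?F = "\<lambda>t z. cis (- (2 * pi * real j * t)) * w (dl (cis (2 * pi * t)) z) * cnj (g z)"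
  have c: "continuous_on UNIV (case_prod ?F)"
    unfolding split_beta'
    by (intro continuous_intros continuous_on_rotated w continuous_on_compose2[OF holo_continuous_on[OF g(1), of UNIV]]) auto
  have int: "integrable (circ \<Otimes>\<^sub>M M) (case_prod ?F)"
  proof (rule Bochner_Integration.integrable_bound[OF integrable_pair_rotated[OF w g]])
    show "case_prod ?F \<in> borel_measurable (circ \<Otimes>\<^sub>M M)" by (rule continuous_measurable_pair[OF c])
    show "AE p in circ \<Otimes>\<^sub>M M. norm (case_prod ?F p) \<le> norm ((cmod (w (dl (cis (2 * pi * fst p)) (snd p))))\<^sup>2 + (cmod (g (snd p)))\<^sup>2)"
      by (intro AE_I2) (simp add: split_beta' norm_mult mult_le_sum_squares)
  qed
  have rot: "(\<integral>z. ?F t z \<partial>M) = (\<integral>z. w z * cnj (g z) \<partial>M)" for t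
  proof -
    let ?l = "cis (2 * pi * t)"
    have "cnj (?l ^ j) = cis (- (2 * pi * real j * t))"
      by (simp only: Complex.DeMoivre cis_cnj) (simp add: mult_ac)
    then have F: "?F t z = w (dl ?l z) * cnj (g (dl ?l z))" for z
      unfolding h complex_cnj_mult by (simp add: mult_ac)
    show ?thesis
      unfolding F by (rule rotation_inner[OF holo_imp_smooth[OF w(1)] w(2) holo_imp_smooth[OF g(1)] g(2)]) simp
  qed
  have "(\<integral>z. hcomp j w z * cnj (g z) \<partial>M) = (\<integral>z. (\<integral>t. ?F t z \<partial>circ) \<partial>M)"
    unfolding circ_rotation_integral[OF w(1)] by (simp only: integral_mult_left_zero)
  also have "\<dots> = (\<integral>t. (\<integral>z. ?F t z \<partial>M) \<partial>circ)" by (rule P.Fubini_integral[OF int])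
  also have "\<dots> = (\<integral>z. w z * cnj (g z) \<partial>M)" unfolding rot by (simp add: measure_def emeasure_circ)
  finally show ?thesis by simp
qed

text \<open>Positivity of the density makes \<open>g\<close> vanish Lebesgue-almost everywhere; the
  set where it does not vanish is open and null, hence empty.\<close>

lemma sqi_norm_zero:
  assumes g: "holo g" "sqi M g" "(\<integral>z. g z * cnj (g z) \<partial>M) = 0"
  shows "g z = 0"
proof -
  have "complex_of_real (\<integral>z. (cmod (g z))\<^sup>2 \<partial>M) = 0"
    unfolding integral_complex_of_real[symmetric] complex_norm_square by (rule g(3))
  then have "AE z in M. (cmod (g z))\<^sup>2 = 0"
    using g(2) by (subst (asm) of_real_eq_0_iff, subst (asm) integral_nonneg_eq_0_iff_AE) (auto simp: sqi_def)
  then have "AE z in lborel. g z = 0"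
    unfolding mu_def using rho_measurable[OF a] rho_pos[OF a] by (subst (asm) AE_density) auto
  moreover have c: "continuous_on UNIV g" by (rule holo_continuous_on[OF g(1)])
  have o: "open {z. g z \<noteq> 0}" using open_Collect_neq[OF c continuous_on_const[of UNIV 0]] .
  ultimately have "{z. g z \<noteq> 0} \<in> null_sets lborel"
    by (subst (asm) AE_iff_null) (auto simp: borel_open)
  then have "negligible {z. g z \<noteq> 0}"
    by (simp add: negligible_iff_null_sets null_sets_completionI)
  then show ?thesis using open_not_negligible[OF o] by auto
qed

text \<open>\<open>w\<close> and \<open>Z f\<close> are compared degree by degree. The components
  are summed at the end pointwise, as Taylor series, and not in the weighted space, to which
  \<open>Z f\<close> is not yet known to belong.\<close>

lemma Brel_imp_eq:
  assumes B: "Brel mul x k (rho a) f w"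
  shows "w = (\<lambda>z. complex_of_real (2 / a) * Z f z)"
proof -
  have fQ: "f \<in> DQ" and w': "w \<in> HL2 (rho a)" and BQ: "\<And>v. v \<in> DQ \<Longrightarrow> Qval mul x k (rho a) f v (ipL2 (rho a) w v)"
    using B by (auto simp: Brel_def)
  have f: "holo f" "sqi M f" and w: "holo w" "sqi M w" using fQ w' by (auto simp: HL2_D)
  have comp: "hcomp j w z = complex_of_real (2 / a) * (of_nat j * hcomp j f z)" for j z
  proof -
    define c where "c = complex_of_real (2 / a) * of_nat j"
    have cr: "cnj c = c" by (simp add: c_def)
    \<comment> \<open>The difference that has to vanish serves as its own test function. Being
      homogeneous of degree \<open>j\<close>, it satisfies \<open>Z g = j g\<close>, so
      \<open>Brel_Zop\<close> applies to it.\<close>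
    define g where "g z = hcomp j w z + (- c) * hcomp j f z" for z
    have g: "holo g" "sqi M g" "\<And>l z. g (dl l z) = l ^ j * g z"
      unfolding g_def
      by (intro holo_add holo_mult holo_const holo_hcomp f w, intro sqi_add sqi_cmult sqi_hcomp f w,
          simp add: hcomp_homogeneous[OF f(1)] hcomp_homogeneous[OF w(1)] algebra_simps)
    have Zg: "Z g = (\<lambda>z. of_nat j * g z)" using Zop_homogeneous[OF g(1) g(3)] by blast
    have gH: "g \<in> HL2 (rho a)" using g by (simp add: HL2_D)
    have Bg: "Brel mul x k (rho a) g (\<lambda>z. complex_of_real (2 / a) * Z g z)"
      by (rule Brel_Zop[OF gH]) (simp add: Zg sqi_cmult g)
    then have gQ: "g \<in> DQ" by (auto simp: Brel_def)
    obtain fs gs where fs: "Qapprox mul x k (rho a) f fs" and gs: "Qapprox mul x k (rho a) g gs"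
      using fQ gQ by (auto simp: domQ_def)
    have C: "Cc_inf (fs n)" "Cc_inf (gs n)" for n using fs gs by (auto simp: Qapprox_def)
    \<comment> \<open>The form at \<open>(f, g)\<close> is computed twice: from the representation
      of \<open>f\<close> by \<open>w\<close> and, after conjugation, from that of \<open>g\<close>
      by \<open>(2 / a) Z g\<close>.\<close>
    have 1: "(\<lambda>n. Qa (fs n) (gs n)) \<longlonglongrightarrow> ipL2 (rho a) w g"
      using BQ[OF gQ] fs gs unfolding Qval_def by blast
    have "(\<lambda>n. Qa (gs n) (fs n)) \<longlonglongrightarrow> ipL2 (rho a) (\<lambda>z. complex_of_real (2 / a) * Z g z) f"
      using Bg fQ fs gs unfolding Brel_def Qval_def by blast
    from tendsto_cnj[OF this] have 2: "(\<lambda>n. Qa (fs n) (gs n)) \<longlonglongrightarrow> cnj (ipL2 (rho a) (\<lambda>z. complex_of_real (2 / a) * Z g z) f)"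
      by (simp only: Q0_hermitian[OF C, symmetric] complex_cnj_cnj Q0_hermitian[OF C(2) C(1), symmetric])
    have mb: "f \<in> borel_measurable borel" "w \<in> borel_measurable borel" "g \<in> borel_measurable borel"
      by (intro smooth_borel_measurable holo_imp_smooth f w g)+
    have "ipL2 (rho a) (\<lambda>z. complex_of_real (2 / a) * Z g z) f = (\<integral>z. complex_of_real (2 / a) * Z g z * cnj (f z) \<partial>M)"
      using mb by (intro ipL2_eq) (auto simp: Zg intro!: borel_measurable_times)
    also have "\<dots> = c * (\<integral>z. g z * cnj (f z) \<partial>M)"
      by (simp only: Zg c_def mult.assoc integral_mult_right_zero)
    finally have "cnj (ipL2 (rho a) (\<lambda>z. complex_of_real (2 / a) * Z g z) f) = c * cnj (\<integral>z. g z * cnj (f z) \<partial>M)"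
      by (simp only: complex_cnj_mult cr)
    also have "\<dots> = c * (\<integral>z. f z * cnj (g z) \<partial>M)"
      unfolding Bochner_Integration.integral_cnj[symmetric] complex_cnj_mult complex_cnj_cnj
      by (simp only: mult.commute[of "f _"])
    finally have "(\<integral>z. w z * cnj (g z) \<partial>M) = c * (\<integral>z. f z * cnj (g z) \<partial>M)"
      using LIMSEQ_unique[OF 1 2] ipL2_eq[OF mb(2,3)] by simp
    \<comment> \<open>Against a \<open>g\<close> of degree \<open>j\<close> only the
      \<open>j\<close>-th components of \<open>w\<close> and \<open>f\<close> contribute.\<close>
    then have e: "(\<integral>z. hcomp j w z * cnj (g z) \<partial>M) = c * (\<integral>z. hcomp j f z * cnj (g z) \<partial>M)"
      using inner_hcomp[OF w g] inner_hcomp[OF f g] by simp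
    have "(\<integral>z. g z * cnj (g z) \<partial>M) = (\<integral>z. hcomp j w z * cnj (g z) + (- c) * (hcomp j f z * cnj (g z)) \<partial>M)"
      by (simp only: g_def distrib_right mult.assoc)
    also have "\<dots> = (\<integral>z. hcomp j w z * cnj (g z) \<partial>M) + (- c) * (\<integral>z. hcomp j f z * cnj (g z) \<partial>M)"
      by (subst Bochner_Integration.integral_add) (auto intro!: integrable_mult_right sqi_integrable_mult sqi_hcomp f w g)
    also have "\<dots> = 0" unfolding e by simp
    finally have "(\<integral>z. g z * cnj (g z) \<partial>M) = 0" .
    from sqi_norm_zero[OF g(1,2) this] have "g z = 0" .
    then show ?thesis by (simp add: g_def c_def algebra_simps)
  qed
  show ?thesis
  proof
    fix z
    have "(\<lambda>j. complex_of_real (2 / a) * (of_nat j * hcomp j f z)) sums (complex_of_real (2 / a) * Z f z)"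
      by (intro sums_mult Zop_sum_hcomp f)
    with holo_sum_hcomp[OF w(1), of z] show "w z = complex_of_real (2 / a) * Z f z"
      by (simp only: comp sums_unique2)
  qed
qed

lemma domB_eq: "domB mul x k (rho a) = {f \<in> HL2 (rho a). L2 (rho a) (Z f)}"
proof (intro set_eqI iffI)
  fix f assume "f \<in> domB mul x k (rho a)"
  then obtain w where B: "Brel mul x k (rho a) f w" by (auto simp: domB_def)
  then have f: "f \<in> HL2 (rho a)" and w: "sqi M w" by (auto simp: Brel_def HL2_D)
  have "Z f = (\<lambda>z. complex_of_real (a / 2) * w z)"
    using a unfolding Brel_imp_eq[OF B] by (auto simp: field_simps)
  then have "sqi M (Z f)" using sqi_cmult[OF w, of "complex_of_real (a / 2)"] by simp
  then show "f \<in> {f \<in> HL2 (rho a). L2 (rho a) (Z f)}" using f by (simp add: L2_sqi)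
next
  fix f assume "f \<in> {f \<in> HL2 (rho a). L2 (rho a) (Z f)}"
  then show "f \<in> domB mul x k (rho a)" using Brel_Zop[of f] by (auto simp: domB_def L2_sqi)
qed

text \<open>\<open>Brel_imp_eq\<close> supplies the uniqueness on which the definite description in
  \<open>Bop\<close> relies.\<close>

lemma Bop_eq:
  assumes "f \<in> domB mul x k (rho a)"
  shows "Bop mul x k (rho a) f = (\<lambda>z. complex_of_real (2 / a) * Z f z)"
proof -
  obtain w where "Brel mul x k (rho a) f w" using assms by (auto simp: domB_def)
  then show ?thesis
    unfolding Bop_def using Brel_imp_eq by (intro the_equality) metis+
qed

end

theorem theorem5p6:
  fixes br mul :: "complex^'n \<Rightarrow> complex^'n \<Rightarrow> complex^'n"
    and V :: "nat \<Rightarrow> (complex^'n) set" and m :: nat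
    and x :: "nat \<Rightarrow> complex^'n" and k :: nat
    and rho :: "real \<Rightarrow> complex^'n \<Rightarrow> real" and a :: real
  assumes "lie_algebra br"
    and "stratified br V m"
    and "lie_group_exp_id br mul"
    and "horiz_basis V x k"
    and "heat_kernel mul x k rho"
    and "a > 0"
  shows "domB mul x k (rho a) = {f \<in> HL2 (rho a). L2 (rho a) (Zop V m f)}
         \<and> (\<forall>f \<in> domB mul x k (rho a).
              Bop mul x k (rho a) f = (\<lambda>z. complex_of_real (2 / a) * Zop V m f z))"
proof -
  interpret heat_form br V m mul x k rho a
    using assms by unfold_locales
  show ?thesis using domB_eq Bop_eq by blast
qed

end
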